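(* Fix an integer $p\ge 2$, an integer $d\ge 1$ and a real number $\nu\ge 1$, and define $C_p=\exp\left\{-\frac{\pi}{2}\,\frac{2^p-p-1}{p-1}\right\}$. Let $z_0\in\mathbb{C}$ and let $u_0\in A_\nu(\mathbb{T}^d)$ satisfy $\|u_0\|<C_p|z_0|$. Let $u(t)$ be the solution of $$-i u_t=\triangle u+u^p,\qquad x\in\mathbb{T}^d,$$ with initial data $u(0,x)=z_0+u_0(x)$, and define $\vartheta=(p-1)\,\mathrm{Arg}(z_0) \bmod 2\pi$. (1) If $0\le\vartheta\le\pi$, then the solution $u(t)$ exists for all $t\ge 0$ and $\lim_{t\to+\infty}u(t)=0$. (2) If $\pi\le\vartheta\le 2\pi$, then the solution $u(t)$ exists for all $t\le 0$ and $\lim_{t\to-\infty}u(t)=0$. Furthermore, let $\zeta(t)$ denote the solution of the ordinary differential equation $\dot z=iz^p$ with initial condition $\zeta(0)=z_0$. If $0\le\vartheta\le\pi$ (respectively, if $\pi\le\vartheta\le 2\pi$), then $$\left|\frac{\zeta(t)}{z_0}\right|\le\left(\frac{1}{1+t^2\left|(p-1)z_0^{p-1}\right|^2}\right)^{\frac{1}{2(p-1)}},\qquad \|u(t)-\zeta(t)\|\le|z_0|\left|\frac{\zeta(t)}{z_0}\right|^p$$ for all $t\ge 0$ (respectively, for all $t\le 0$).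
   Context: Fix $\omega\in\mathbb{R}^d$ (with nonzero entries) and let $\mathbb{T}^d=\mathbb{R}^d/\frac{2\pi}{\omega}\mathbb{Z}^d$ be the torus with period $2\pi/\omega_j$ in the $j$-th coordinate. For $k\in\mathbb{Z}^d$ put $|k|=|k_1|+\dots+|k_d|$ and $k\omega x=\sum_j k_j\omega_j x_j$. For $u\in L^1(\mathbb{T}^d)$ let $\hat u(k)=\frac{1}{\mathrm{vol}(\mathbb{T}^d)}\int_{\mathbb{T}^d}u(x)e^{-i\omega kx}dx$ and $\|u\|=\sum_{k\in\mathbb{Z}^d}|\hat u(k)|\nu^{|k|}$. The weighted Wiener algebra $A_\nu(\mathbb{T}^d)$ is the set of $u\in L^1(\mathbb{T}^d)$ (complex valued) with $\|u\|<\infty$. Complex numbers are identified with constant functions. Limits of $u(t)$ are in $A_\nu(\mathbb{T}^d)$. Solutions are understood as curves $t\mapsto u(t)\in A_\nu(\mathbb{T}^d)$ whose Fourier coefficients satisfy the system of ODEs obtained from the equation (equivalently, its variation of constants formula). The angle $\vartheta$ is regarded modulo $2\pi$, so each of the conditions $0\le\vartheta\le\pi$, $\pi\le\vartheta\le2\pi$ means that some representative lies in the given interval. *)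

theory Defs
  imports "HOL-Analysis.Analysis"
begin

text \<open>Functions on the torus are represented by periodic functions on the whole space
  (elements of \<open>L\<^sup>1\<close> by arbitrary representatives, which are only identified almost everywhere).
  The entries of \<open>\<omega>\<close> are nonzero but may be negative, whence the absolute value in the
  fundamental cell.\<close>

definition torus_cell :: "real^'d \<Rightarrow> (real^'d) set" where
  "torus_cell \<omega> = cbox 0 (\<chi> j. 2 * pi / \<bar>\<omega> $ j\<bar>)"

definition torus_periodic :: "real^'d \<Rightarrow> (real^'d \<Rightarrow> complex) \<Rightarrow> bool" where
  "torus_periodic \<omega> u \<longleftrightarrow> (\<forall>x j. u (x + axis j (2 * pi / \<omega> $ j)) = u x)"

definition torus_L1 :: "real^'d \<Rightarrow> (real^'d \<Rightarrow> complex) set" where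
  "torus_L1 \<omega> = {u. torus_periodic \<omega> u \<and> u absolutely_integrable_on torus_cell \<omega>}"

definition index_norm :: "int^'d \<Rightarrow> nat" where
  "index_norm k = (\<Sum>j\<in>UNIV. nat \<bar>k $ j\<bar>)"

definition phase :: "real^'d \<Rightarrow> int^'d \<Rightarrow> real^'d \<Rightarrow> real" where
  "phase \<omega> k x = (\<Sum>j\<in>UNIV. of_int (k $ j) * \<omega> $ j * x $ j)"

definition fourier_coeff :: "real^'d \<Rightarrow> (real^'d \<Rightarrow> complex) \<Rightarrow> int^'d \<Rightarrow> complex" where
  "fourier_coeff \<omega> u k =
     (LINT x:torus_cell \<omega>|lebesgue. u x * exp (- \<i> * complex_of_real (phase \<omega> k x)))
       / complex_of_real (measure lebesgue (torus_cell \<omega>))"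

definition wiener_algebra :: "real^'d \<Rightarrow> real \<Rightarrow> (real^'d \<Rightarrow> complex) set" where
  "wiener_algebra \<omega> \<nu> =
     {u \<in> torus_L1 \<omega>. (\<lambda>k. cmod (fourier_coeff \<omega> u k) * \<nu> ^ index_norm k) summable_on UNIV}"

text \<open>Meaningful only on \<^const>\<open>wiener_algebra\<close>: a divergent \<^const>\<open>infsum\<close> is 0.\<close>

definition wiener_norm :: "real^'d \<Rightarrow> real \<Rightarrow> (real^'d \<Rightarrow> complex) \<Rightarrow> real" where
  "wiener_norm \<omega> \<nu> u = (\<Sum>\<^sub>\<infinity>k\<in>UNIV. cmod (fourier_coeff \<omega> u k) * \<nu> ^ index_norm k)"

text \<open>A solution of \<open>-\<i> u\<^sub>t = \<triangle>u + u\<^sup>p\<close> on a time interval \<open>I\<close> containing 0, with initial value \<open>w\<close>: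
  a continuous curve in the Wiener algebra whose Fourier coefficients satisfy the equation
  multiplied by \<open>\<i>\<close>. The Laplacian acts on the \<open>k\<close>-th coefficient as multiplication by
  \<open>-\<Sum>\<^sub>j (k\<^sub>j \<omega>\<^sub>j)\<^sup>2\<close>. Derivatives and limits are one-sided at endpoints of \<open>I\<close>.\<close>

definition nls_solution ::
  "real^'d \<Rightarrow> real \<Rightarrow> nat \<Rightarrow> (real^'d \<Rightarrow> complex) \<Rightarrow> real set \<Rightarrow> (real \<Rightarrow> real^'d \<Rightarrow> complex) \<Rightarrow> bool" where
  "nls_solution \<omega> \<nu> p w I u \<longleftrightarrow>
     (\<forall>t\<in>I. u t \<in> wiener_algebra \<omega> \<nu>) \<and>
     (\<forall>t\<in>I. ((\<lambda>s. wiener_norm \<omega> \<nu> (\<lambda>x. u s x - u t x)) \<longlongrightarrow> 0) (at t within I)) \<and>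
     (\<forall>t\<in>I. \<forall>k. ((\<lambda>s. fourier_coeff \<omega> (u s) k) has_vector_derivative
         \<i> * (- complex_of_real (\<Sum>j\<in>UNIV. (of_int (k $ j) * \<omega> $ j)\<^sup>2) * fourier_coeff \<omega> (u t) k
              + fourier_coeff \<omega> (\<lambda>x. u t x ^ p) k)) (at t within I)) \<and>
     (AE x in lebesgue. u 0 x = w x)"

text \<open>\<open>u\<close> is \<^emph>\<open>the\<close> solution on \<open>I\<close>: it also coincides with every solution that exists
  on only part of \<open>I\<close>.\<close>

definition nls_the_solution ::
  "real^'d \<Rightarrow> real \<Rightarrow> nat \<Rightarrow> (real^'d \<Rightarrow> complex) \<Rightarrow> real set \<Rightarrow> (real \<Rightarrow> real^'d \<Rightarrow> complex) \<Rightarrow> bool" where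
  "nls_the_solution \<omega> \<nu> p w I u \<longleftrightarrow>
     nls_solution \<omega> \<nu> p w I u \<and>
     (\<forall>J v. is_interval J \<and> 0 \<in> J \<and> J \<subseteq> I \<and> nls_solution \<omega> \<nu> p w J v \<longrightarrow>
        (\<forall>t\<in>J. AE x in lebesgue. v t x = u t x))"

definition ode_solution :: "nat \<Rightarrow> complex \<Rightarrow> real set \<Rightarrow> (real \<Rightarrow> complex) \<Rightarrow> bool" where
  "ode_solution p z0 I \<zeta> \<longleftrightarrow>
     (\<forall>t\<in>I. (\<zeta> has_vector_derivative \<i> * \<zeta> t ^ p) (at t within I)) \<and> \<zeta> 0 = z0"

definition ode_the_solution :: "nat \<Rightarrow> complex \<Rightarrow> real set \<Rightarrow> (real \<Rightarrow> complex) \<Rightarrow> bool" where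
  "ode_the_solution p z0 I \<zeta> \<longleftrightarrow>
     ode_solution p z0 I \<zeta> \<and>
     (\<forall>J \<eta>. is_interval J \<and> 0 \<in> J \<and> J \<subseteq> I \<and> ode_solution p z0 J \<eta> \<longrightarrow> (\<forall>t\<in>J. \<eta> t = \<zeta> t))"

definition C_const :: "nat \<Rightarrow> real" where
  "C_const p = exp (- (pi / 2) * ((2 ^ p - real p - 1) / (real p - 1)))"

text \<open>The angle \<open>\<theta>\<close>, regarded modulo \<open>2\<pi>\<close>, has a representative in \<open>[a, b]\<close>.\<close>

definition angle_in :: "real \<Rightarrow> real \<Rightarrow> real \<Rightarrow> bool" where
  "angle_in \<theta> a b \<longleftrightarrow> (\<exists>m::int. \<theta> + 2 * pi * of_int m \<in> {a..b})"

definition decay_bounds ::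
  "real^'d \<Rightarrow> real \<Rightarrow> nat \<Rightarrow> complex \<Rightarrow> real set \<Rightarrow> (real \<Rightarrow> real^'d \<Rightarrow> complex) \<Rightarrow> (real \<Rightarrow> complex) \<Rightarrow> bool" where
  "decay_bounds \<omega> \<nu> p z0 I u \<zeta> \<longleftrightarrow>
     (\<forall>t\<in>I.
        cmod (\<zeta> t / z0)
          \<le> (1 / (1 + t\<^sup>2 * (cmod (of_nat (p - 1) * z0 ^ (p - 1)))\<^sup>2)) powr (1 / (2 * (real p - 1))) \<and>
        wiener_norm \<omega> \<nu> (\<lambda>x. u t x - \<zeta> t) \<le> cmod z0 * cmod (\<zeta> t / z0) ^ p)"

end

theory Submission imports Defs
begin

text \<open>
A solution that starts near the constant \<open>z0\<close> follows the spatially constant solution \<open>\<zeta>\<close>, which solves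
\<open>z' = \<i> * z ^ p\<close> and is explicit: \<open>(\<zeta> / z0) ^ (p - 1) = 1 / (1 - \<i> * rate * t)\<close> with
\<open>rate = (p - 1) * z0 ^ (p - 1)\<close>. The condition on the argument of \<open>z0\<close> fixes the sign of the imaginary part
of the rate, so that in one direction of time the denominator has modulus at least
\<open>sqrt (1 + t\<^sup>2 * |rate|\<^sup>2)\<close>. Therefore \<open>\<zeta>\<close> exists for all times of that sign and decays.

For the perturbation write \<open>u = \<zeta> + z0 * (\<zeta> / z0) ^ p * w\<close>. The factor in front of \<open>w\<close> solves the
linearization of the ordinary differential equation at \<open>\<zeta>\<close>, so the equation for \<open>w\<close> has no linear term
besides the Laplacian:
\<open>w' = \<i> * \<triangle>w + \<i> * z0 ^ (p - 1) * (\<Sum>j=2..p. (p choose j) * (\<zeta> / z0) ^ ((p - 1) * j) * w ^ j)\<close>.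
The free evolution is isometric in the Wiener norm, which moreover is submultiplicative. As long as
\<open>norm w \<le> 1\<close>, the norm of the sum is at most \<open>(2 ^ p - p - 1) * norm w\<close> divided by
\<open>1 + t\<^sup>2 * |rate|\<^sup>2\<close>, which is integrable in time. By Groenwall's inequality \<open>norm w\<close> grows at most by the
factor \<open>exp ((pi / 2) * (2 ^ p - p - 1) / (p - 1))\<close>, the inverse of \<open>C_const p\<close>. The smallness of \<open>u0\<close> thus
keeps \<open>w\<close> in the unit ball, which is the bound on \<open>u - \<zeta>\<close>; in particular \<open>u\<close> tends to 0 with \<open>\<zeta>\<close>.

Three ingredients make this rigorous. The lemma \<open>picard_global_solution\<close> constructs solutions on a half line
directly, as the iterates obey the Groenwall bound themselves; \<open>interaction_solution\<close> applies it after the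
free evolution has been undone, where the equation has no unbounded operator. The Wiener algebra is
replaced by the Banach space of absolutely summable sequences with a weighted convolution
(\<open>norm_conv_le\<close>, \<open>eval_at_conv\<close>). Finally, an element of the algebra is recovered from its coefficients by
the uniqueness theorem for Fourier coefficients of integrable functions (\<open>fourier_uniqueness_cell\<close>). It
is also what turns \<open>u ^ p\<close> into a convolution power for arbitrary solutions, as needed for their
uniqueness (\<open>nls_solution_unique\<close>).
\<close>

section \<open>Differential equations in Banach spaces\<close>

lemma continuous_on_if_vector_derivative:
  "(\<And>x. x \<in> S \<Longrightarrow> (f has_vector_derivative f' x) (at x within S)) \<Longrightarrow> continuous_on S f"
  by (auto simp: continuous_on_eq_continuous_within intro: has_vector_derivative_continuous)

text \<open>The bound in the conclusion is the antiderivative of the bound on the derivative: the estimate passes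
from one Taylor term of the exponential series to the next. Both proofs in this section iterate it,
once because these terms tend to 0 (uniqueness) and once because they are summable (convergence of
Picard's iteration).\<close>

lemma norm_bound_iterate:
  fixes D :: "real \<Rightarrow> 'a::real_normed_vector"
  assumes D0: "D 0 = 0"
    and der: "\<And>s. s \<in> {0..T} \<Longrightarrow> (D has_vector_derivative D' s) (at s within {0..T})"
    and bnd: "\<And>s. s \<in> {0..T} \<Longrightarrow> norm (D' s) \<le> L * (M * ((L * s) ^ n / fact n))"
    and t: "t \<in> {0..T}"
  shows "norm (D t) \<le> M * ((L * t) ^ Suc n / fact (Suc n))"
proof (cases "t = 0")
  case True
  then show ?thesis using D0 by simp
next
  case False
  with t have t0: "0 < t" and tT: "t \<le> T" by auto
  let ?\<phi> = "\<lambda>s. M * ((L * s) ^ Suc n / fact (Suc n))"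
  have der\<phi>: "(?\<phi> has_vector_derivative L * (M * ((L * s) ^ n / fact n))) (at s)" for s
  proof -
    have eq: "M * ((real (Suc n) * (L * s) ^ n * L) / fact (Suc n)) = L * (M * ((L * s) ^ n / fact n))"
      by (simp add: fact_Suc field_simps del: of_nat_Suc)
    have "((\<lambda>s. M * ((L * s) ^ Suc n / fact (Suc n))) has_real_derivative
        M * ((real (Suc n) * (L * s) ^ n * L) / fact (Suc n))) (at s)"
      by (rule derivative_eq_intros | simp)+
    then show ?thesis unfolding eq has_real_derivative_iff_has_vector_derivative .
  qed
  have "norm (D t - D 0) \<le> ?\<phi> t - ?\<phi> 0"
  proof (rule differentiable_bound_general[OF t0])
    have "continuous_on {0..T} D"
      by (rule continuous_on_if_vector_derivative[OF der])
    then show "continuous_on {0..t} D"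
      by (rule continuous_on_subset) (use tT in auto)
    show "continuous_on {0..t} ?\<phi>"
      by (intro continuous_intros) auto
    fix s assume s: "0 < s" "s < t"
    have "at s within {0..T} = at s"
      by (rule at_within_interior) (use s tT in auto)
    then show "(D has_vector_derivative D' s) (at s)"
      using der[of s] s tT by auto
    show "(?\<phi> has_vector_derivative L * (M * ((L * s) ^ n / fact n))) (at s)" by (rule der\<phi>)
    show "norm (D' s) \<le> L * (M * ((L * s) ^ n / fact n))" using bnd s tT by auto
  qed
  then show ?thesis using D0 by simp
qed

text \<open>Groenwall's inequality with vanishing initial value: starting from any bound on the compact interval,
each iteration replaces it by the next term of an exponential series.\<close>

lemma zero_if_derivative_bounded:
  fixes D :: "real \<Rightarrow> 'a::real_normed_vector"
  assumes D0: "D 0 = 0" and L: "L \<ge> 0"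
    and der: "\<And>s. s \<in> {0..T} \<Longrightarrow> (D has_vector_derivative D' s) (at s within {0..T})"
    and bnd: "\<And>s. s \<in> {0..T} \<Longrightarrow> norm (D' s) \<le> L * norm (D s)"
    and t: "t \<in> {0..T}"
  shows "D t = 0"
proof -
  have "continuous_on {0..T} D"
    by (rule continuous_on_if_vector_derivative[OF der])
  then have "bounded (D ` {0..T})"
    by (intro compact_imp_bounded compact_continuous_image) auto
  then obtain M where M: "\<And>s. s \<in> {0..T} \<Longrightarrow> norm (D s) \<le> M"
    unfolding bounded_iff by fastforce
  have *: "norm (D s) \<le> M * ((L * s) ^ n / fact n)" if "s \<in> {0..T}" for s n
    using that
  proof (induction n arbitrary: s)
    case 0
    then show ?case using M by simp
  next
    case (Suc n)
    show ?case
    proof (rule norm_bound_iterate[OF D0 der _ Suc.prems])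
      fix r assume r: "r \<in> {0..T}"
      have "norm (D' r) \<le> L * norm (D r)" by (rule bnd[OF r])
      also have "\<dots> \<le> L * (M * ((L * r) ^ n / fact n))"
        by (intro mult_left_mono Suc.IH r L)
      finally show "norm (D' r) \<le> L * (M * ((L * r) ^ n / fact n))" .
    qed
  qed
  have "summable (\<lambda>n. (L * t) ^ n / fact n)"
    using summable_exp[of "L * t"] by (simp add: divide_inverse mult.commute)
  then have "(\<lambda>n. M * ((L * t) ^ n / fact n)) \<longlonglongrightarrow> M * 0"
    by (intro tendsto_mult tendsto_const summable_LIMSEQ_zero)
  then have "norm (D t) \<le> M * 0"
    by (rule LIMSEQ_le_const) (use * t in auto)
  then show ?thesis by simp
qed

lemma integral_has_vector_derivative_halfline:
  fixes g :: "real \<Rightarrow> 'a::banach"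
  assumes g: "continuous_on {0..} g" and t: "t \<ge> 0"
  shows "((\<lambda>t. integral {0..t} g) has_vector_derivative g t) (at t within {0..})"
proof -
  have "((\<lambda>t. integral {0..t} g) has_vector_derivative g t) (at t within {0..t+1})"
    by (rule integral_has_vector_derivative) (use t in \<open>auto intro: continuous_on_subset[OF g]\<close>)
  moreover have "at t within {0..t+1} = at t within {0..}"
    by (rule at_within_nhd[of t "{..<t+1}"]) auto
  ultimately show ?thesis by simp
qed

text \<open>Picard's iteration on a half line without a continuation argument. The linear growth bound with rate
\<open>h\<close> reproduces itself under the iteration: if an iterate is bounded by \<open>norm x0 * exp H\<close>, where
\<open>H\<close> is the primitive of \<open>h\<close>, then so is the next one. By the smallness condition on \<open>x0\<close> all
iterates therefore stay for all times in the ball of radius \<open>R\<close>, the only place where \<open>f\<close> is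
controlled.\<close>

lemma picard_global_solution:
  fixes f :: "real \<Rightarrow> 'a::banach \<Rightarrow> 'a"
  assumes cont: "\<And>b. continuous_on {0..} b \<Longrightarrow> (\<And>t. t \<ge> 0 \<Longrightarrow> norm (b t) \<le> R) \<Longrightarrow>
        continuous_on {0..} (\<lambda>t. f t (b t))"
    and growth: "\<And>t x. t \<ge> 0 \<Longrightarrow> norm x \<le> R \<Longrightarrow> norm (f t x) \<le> h t * norm x"
    and lip: "\<And>t x y. t \<ge> 0 \<Longrightarrow> norm x \<le> R \<Longrightarrow> norm y \<le> R \<Longrightarrow> norm (f t x - f t y) \<le> L * norm (x - y)"
    and L: "L \<ge> 0"
    and H: "\<And>t. (H has_real_derivative h t) (at t)" and H0: "H 0 = 0"
    and h: "\<And>t. h t \<ge> 0"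
    and x0: "\<And>t. t \<ge> 0 \<Longrightarrow> norm x0 * exp (H t) \<le> R"
  shows "\<exists>b. b 0 = x0 \<and>
      (\<forall>t\<ge>0. (b has_vector_derivative f t (b t)) (at t within {0..}) \<and> norm (b t) \<le> norm x0 * exp (H t))"
proof -
  define P where "P b t = x0 + integral {0..t} (\<lambda>s. f s (b s))" for b :: "real \<Rightarrow> 'a" and t
  \<comment> \<open>the estimate that is invariant under the iteration; it keeps the iterates in the ball\<close>
  define good where "good b \<longleftrightarrow> continuous_on {0..} b \<and> (\<forall>t\<ge>0. norm (b t) \<le> norm x0 * exp (H t))"
    for b :: "real \<Rightarrow> 'a"
  have goodR: "norm (b t) \<le> R" if "good b" "t \<ge> 0" for b t
    using that x0[of t] unfolding good_def by force
  have fcont: "continuous_on {0..} (\<lambda>t. f t (b t))" if "good b" for b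
    using that goodR[OF that] cont unfolding good_def by blast
  have fcont': "continuous_on {0..T} (\<lambda>t. f t (b t))" if "good b" for b T
    by (rule continuous_on_subset[OF fcont[OF that]]) auto
  have P0: "P b 0 = x0" for b by (simp add: P_def)
  have Pder: "(P b has_vector_derivative f t (b t)) (at t within {0..})" if "good b" "t \<ge> 0" for b t
    unfolding P_def[abs_def]
    by (auto intro!: derivative_eq_intros integral_has_vector_derivative_halfline fcont that)
  have contH: "continuous_on S H" for S
    by (rule continuous_on_subset[of UNIV]) (use H in \<open>auto intro: DERIV_continuous_on\<close>)
  have Pgood: "good (P b)" if b: "good b" for b
    unfolding good_def
  proof (intro conjI allI impI)
    show Pc: "continuous_on {0..} (P b)"
      by (rule continuous_on_if_vector_derivative) (use Pder[OF b] in auto)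
    fix t :: real assume t: "t \<ge> 0"
    show "norm (P b t) \<le> norm x0 * exp (H t)"
    proof (cases "t = 0")
      case True then show ?thesis by (simp add: P0 H0)
    next
      case False
      with t have t0: "0 < t" by simp
      have "norm (P b t - P b 0) \<le> norm x0 * exp (H t) - norm x0 * exp (H 0)"
      proof (rule differentiable_bound_general[OF t0])
        show "continuous_on {0..t} (P b)" by (rule continuous_on_subset[OF Pc]) auto
        show "continuous_on {0..t} (\<lambda>t. norm x0 * exp (H t))"
          by (intro continuous_intros contH)
        fix s assume s: "0 < s" "s < t"
        have "at s within {0..} = at s" by (rule at_within_interior) (use s in auto)
        then show "(P b has_vector_derivative f s (b s)) (at s)" using Pder[OF b, of s] s by simp
        have "((\<lambda>t. norm x0 * exp (H t)) has_real_derivative norm x0 * (exp (H s) * h s)) (at s)"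
          by (auto intro!: derivative_eq_intros H)
        then show "((\<lambda>t. norm x0 * exp (H t)) has_vector_derivative norm x0 * (exp (H s) * h s)) (at s)"
          by (simp add: has_real_derivative_iff_has_vector_derivative)
        have "norm (f s (b s)) \<le> h s * norm (b s)"
          by (rule growth) (use s goodR[OF b] in auto)
        also have "\<dots> \<le> h s * (norm x0 * exp (H s))"
          by (rule mult_left_mono) (use h s b in \<open>auto simp: good_def\<close>)
        finally show "norm (f s (b s)) \<le> norm x0 * (exp (H s) * h s)" by (simp add: mult_ac)
      qed
      then have "norm (P b t - x0) \<le> norm x0 * exp (H t) - norm x0" by (simp add: P0 H0)
      then show ?thesis using norm_triangle_ineq[of "P b t - x0" x0] by simp
    qed
  qed
  define B where "B n = (P ^^ n) (\<lambda>_. x0)" for n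
  have Hnn: "H t \<ge> 0" if "t \<ge> 0" for t
  proof -
    have "H 0 \<le> H t"
      by (rule DERIV_nonneg_imp_nondecreasing[OF that]) (use H h in blast)
    then show ?thesis using H0 by simp
  qed
  have "norm x0 * 1 \<le> norm x0 * exp (H t)" if "t \<ge> 0" for t
    by (rule mult_left_mono) (use Hnn[OF that] in auto)
  then have good: "good (B n)" for n
    by (induction n) (auto simp: B_def Pgood, simp add: good_def)
  have BS: "B (Suc n) = P (B n)" for n by (simp add: B_def)
  \<comment> \<open>the first two iterates lie in the ball of radius \<open>R\<close>, so their distance is at most its diameter\<close>
  have diff: "norm (B (Suc n) t - B n t) \<le> 2 * R * ((L * t) ^ n / fact n)" if "t \<in> {0..T}" for n t T
    using that
  proof (induction n arbitrary: t)
    case 0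
    have "norm (B (Suc 0) t - B 0 t) \<le> norm (B (Suc 0) t) + norm (B 0 t)"
      by (rule norm_triangle_ineq4)
    then show ?case using goodR[OF good, of t "Suc 0"] goodR[OF good, of t 0] 0 by simp
  next
    case (Suc n)
    let ?D = "\<lambda>t. B (Suc (Suc n)) t - B (Suc n) t"
    show ?case
    proof (rule norm_bound_iterate[of ?D T, OF _ _ _ Suc.prems])
      show "?D 0 = 0" by (simp add: BS P0)
      fix s assume s: "s \<in> {0..T}"
      have "((\<lambda>t. P (B (Suc n)) t - P (B n) t) has_vector_derivative f s (B (Suc n) s) - f s (B n s))
          (at s within {0..})"
        by (intro has_vector_derivative_diff Pder good) (use s in auto)
      then show "(?D has_vector_derivative f s (B (Suc n) s) - f s (B n s)) (at s within {0..T})"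
        unfolding BS[symmetric] by (rule has_vector_derivative_within_subset) auto
      have "norm (f s (B (Suc n) s) - f s (B n s)) \<le> L * norm (B (Suc n) s - B n s)"
        by (rule lip) (use s goodR[OF good] in auto)
      also have "\<dots> \<le> L * (2 * R * ((L * s) ^ n / fact n))"
        by (rule mult_left_mono[OF Suc.IH[OF s] L])
      finally show "norm (f s (B (Suc n) s) - f s (B n s)) \<le> L * (2 * R * ((L * s) ^ n / fact n))" .
    qed
  qed
  have "\<exists>l. \<forall>T. uniform_limit {0..T} B l sequentially"
  proof -
    define l where "l t = x0 + (\<Sum>n. B (Suc n) t - B n t)" for t
    have "uniform_limit {0..T} B l sequentially" for T
    proof -
      have "R \<ge> 0" using x0[of 0] by (smt (verit) norm_ge_zero mult_nonneg_nonneg exp_ge_zero)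
      have "uniform_limit {0..T} (\<lambda>N t. \<Sum>n<N. B (Suc n) t - B n t) (\<lambda>t. \<Sum>n. B (Suc n) t - B n t) sequentially"
      proof (rule Weierstrass_m_test)
        show "norm (B (Suc n) t - B n t) \<le> 2 * R * ((L * T) ^ n / fact n)" if "t \<in> {0..T}" for n t
          using that \<open>R \<ge> 0\<close> L
          by (intro order_trans[OF diff[OF that]] mult_left_mono divide_right_mono power_mono) auto
        have "summable (\<lambda>n. (L * T) ^ n / fact n)"
          using summable_exp[of "L * T"] by (simp add: divide_inverse mult.commute)
        then show "summable (\<lambda>n. 2 * R * ((L * T) ^ n / fact n))"
          by (rule summable_mult)
      qed
      then have "uniform_limit {0..T} (\<lambda>N t. x0 + (\<Sum>n<N. B (Suc n) t - B n t)) l sequentially"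
        unfolding l_def by (intro uniform_limit_intros)
      moreover have "x0 + (\<Sum>n<N. B (Suc n) t - B n t) = B N t" for N t
        by (subst sum_lessThan_telescope) (simp add: B_def)
      ultimately show ?thesis by simp
    qed
    then show ?thesis by blast
  qed
  then obtain b where b: "\<And>T. uniform_limit {0..T} B b sequentially" by blast
  have lim: "(\<lambda>n. B n t) \<longlonglongrightarrow> b t" if "t \<ge> 0" for t
    by (rule tendsto_uniform_limitI[OF b[of t]]) (use that in auto)
  have gb: "good b"
    unfolding good_def
  proof (intro conjI allI impI)
    have Bcont: "continuous_on {0..T} (B n)" for n T
      using good[of n] continuous_on_subset[of "{0..}" "B n" "{0..T}"] by (auto simp: good_def)
    have "continuous_on {0..T} b" for T
      by (rule uniform_limit_theorem[OF _ b])
        (use Bcont in \<open>auto intro!: always_eventually\<close>)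
    then have "continuous (at t within {0..}) b" if "t \<ge> 0" for t
    proof -
      have "continuous (at t within {0..t+1}) b"
        using \<open>\<And>T. continuous_on {0..T} b\<close>[of "t+1"] that by (auto simp: continuous_on_eq_continuous_within)
      moreover have "at t within {0..t+1} = at t within {0..}"
        by (rule at_within_nhd[of t "{..<t+1}"]) auto
      ultimately show ?thesis by simp
    qed
    then show "continuous_on {0..} b" by (auto simp: continuous_on_eq_continuous_within)
    fix t :: real assume t: "t \<ge> 0"
    have "(\<lambda>n. norm (B n t)) \<longlonglongrightarrow> norm (b t)" by (intro tendsto_norm lim t)
    then show "norm (b t) \<le> norm x0 * exp (H t)"
      by (rule LIMSEQ_le_const2) (use good t in \<open>auto simp: good_def\<close>)
  qed
  have fix_pt: "b t = P b t" if t: "t \<ge> 0" for t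
  proof -
    have "uniform_limit {0..t} (\<lambda>n s. f s (B n s)) (\<lambda>s. f s (b s)) sequentially"
    proof (rule uniform_limitI)
      fix e :: real assume e: "e > 0"
      have "\<forall>\<^sub>F n in sequentially. \<forall>s\<in>{0..t}. dist (B n s) (b s) < e / (L + 1)"
        using b[of t] e L by (intro uniform_limitD) auto
      then show "\<forall>\<^sub>F n in sequentially. \<forall>s\<in>{0..t}. dist (f s (B n s)) (f s (b s)) < e"
      proof (rule eventually_mono, intro ballI)
        fix n s assume a: "\<forall>s\<in>{0..t}. dist (B n s) (b s) < e / (L + 1)" and s: "s \<in> {0..t}"
        have "norm (f s (B n s) - f s (b s)) \<le> L * norm (B n s - b s)"
          by (rule lip) (use s goodR[OF good] goodR[OF gb] in auto)
        also have "\<dots> \<le> L * (e / (L + 1))"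
          using a s L by (intro mult_left_mono) (auto simp: dist_norm less_imp_le)
        also have "\<dots> < e" using e L by (simp add: field_simps)
        finally show "dist (f s (B n s)) (f s (b s)) < e" by (simp add: dist_norm)
      qed
    qed
    then obtain I J where I: "\<And>n. ((\<lambda>s. f s (B n s)) has_integral I n) {0..t}"
      and J: "((\<lambda>s. f s (b s)) has_integral J) {0..t}" and IJ: "I \<longlonglongrightarrow> J"
      by (rule uniform_limit_integral) (auto intro: fcont'[OF good])
    have "(\<lambda>n. integral {0..t} (\<lambda>s. f s (B n s))) \<longlonglongrightarrow> integral {0..t} (\<lambda>s. f s (b s))"
      using IJ unfolding integral_unique[OF I] integral_unique[OF J] .
    then have "(\<lambda>n. B (Suc n) t) \<longlonglongrightarrow> P b t"
      unfolding BS P_def by (intro tendsto_intros)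
    then show ?thesis using LIMSEQ_Suc[OF lim[OF t]] LIMSEQ_unique by blast
  qed
  have "(b has_vector_derivative f t (b t)) (at t within {0..})" if "t \<ge> 0" for t
    by (rule has_vector_derivative_transform[OF _ _ Pder[OF gb that]]) (use that fix_pt in auto)
  then show ?thesis using gb fix_pt[of 0] P0 by (intro exI[of _ b]) (auto simp: good_def)
qed

section \<open>Absolutely summable families\<close>

text \<open>A norm with weights \<open>\<nu> ^ index_norm k\<close> cannot be put on a type, because \<open>\<nu>\<close> is a variable. The
type therefore carries the unweighted norm, and a function is represented by its Fourier coefficients
\<^emph>\<open>multiplied by the weights\<close>. The weights reappear in the product and in the evaluation at
a point.\<close>

typedef 'k ell1 = "{f :: 'k \<Rightarrow> complex. (\<lambda>k. norm (f k)) summable_on UNIV}"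
  morphisms coef Ell1
  by (rule exI[of _ "\<lambda>_. 0"]) simp

setup_lifting type_definition_ell1

lemma ell1_eqI: "(\<And>k. coef A k = coef B k) \<Longrightarrow> A = B"
  by (metis coef_inject ext)

lemma coef_summable: "(\<lambda>k. norm (coef A k)) summable_on UNIV"
  using coef[of A] by simp

lemma coef_Ell1: "(\<lambda>k. norm (f k)) summable_on UNIV \<Longrightarrow> coef (Ell1 f) = f"
  by (simp add: Ell1_inverse)

lemma abs_summable_add:
  fixes f g :: "'k \<Rightarrow> complex"
  assumes "(\<lambda>k. norm (f k)) summable_on UNIV" "(\<lambda>k. norm (g k)) summable_on UNIV"
  shows "(\<lambda>k. norm (f k + g k)) summable_on UNIV"
  by (rule summable_on_comparison_test[OF summable_on_add[OF assms]]) (auto intro: norm_triangle_ineq)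

instantiation ell1 :: (type) real_vector
begin

lift_definition zero_ell1 :: "'a ell1" is "\<lambda>_. 0" by simp

lift_definition plus_ell1 :: "'a ell1 \<Rightarrow> 'a ell1 \<Rightarrow> 'a ell1" is "\<lambda>f g k. f k + g k"
  by (rule abs_summable_add)

lift_definition uminus_ell1 :: "'a ell1 \<Rightarrow> 'a ell1" is "\<lambda>f k. - f k" by simp

lift_definition minus_ell1 :: "'a ell1 \<Rightarrow> 'a ell1 \<Rightarrow> 'a ell1" is "\<lambda>f g k. f k - g k"
proof -
  fix f g :: "'a \<Rightarrow> complex"
  assume "(\<lambda>k. norm (f k)) summable_on UNIV" "(\<lambda>k. norm (g k)) summable_on UNIV"
  then show "(\<lambda>k. norm (f k - g k)) summable_on UNIV" using abs_summable_add[of f "\<lambda>k. - g k"] by simp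
qed

lift_definition scaleR_ell1 :: "real \<Rightarrow> 'a ell1 \<Rightarrow> 'a ell1" is "\<lambda>r f k. r *\<^sub>R f k"
  by (auto intro: summable_on_cmult_right)

instance
proof
  fix A B C :: "'a ell1" and r s :: real
  show "A + B + C = A + (B + C)" by transfer (simp add: add_ac)
  show "A + B = B + A" by transfer (simp add: add_ac)
  show "0 + A = A" by transfer simp
  show "- A + A = 0" by transfer simp
  show "A - B = A + - B" by transfer simp
  show "r *\<^sub>R (A + B) = r *\<^sub>R A + r *\<^sub>R B" by transfer (simp add: algebra_simps)
  show "(r + s) *\<^sub>R A = r *\<^sub>R A + s *\<^sub>R A" by transfer (simp add: algebra_simps)
  show "r *\<^sub>R s *\<^sub>R A = (r * s) *\<^sub>R A" by transfer simp
  show "1 *\<^sub>R A = A" by transfer simp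
qed

end

instantiation ell1 :: (type) real_normed_vector
begin

lift_definition norm_ell1 :: "'a ell1 \<Rightarrow> real" is "\<lambda>f. \<Sum>\<^sub>\<infinity>k. norm (f k)" .

definition sgn_ell1 :: "'a ell1 \<Rightarrow> 'a ell1" where "sgn_ell1 A = A /\<^sub>R norm A"
definition dist_ell1 :: "'a ell1 \<Rightarrow> 'a ell1 \<Rightarrow> real" where "dist_ell1 A B = norm (A - B)"
definition uniformity_ell1 :: "('a ell1 \<times> 'a ell1) filter"
  where "uniformity_ell1 = (INF e\<in>{0 <..}. principal {(x, y). dist x y < e})"
definition open_ell1 :: "'a ell1 set \<Rightarrow> bool"
  where "open_ell1 U \<longleftrightarrow> (\<forall>x\<in>U. eventually (\<lambda>(x', y). x' = x \<longrightarrow> y \<in> U) uniformity)"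

instance
proof
  fix A B C :: "'a ell1" and r s :: real
  show "dist A B = norm (A - B)" by (rule dist_ell1_def)
  show "sgn A = A /\<^sub>R norm A" by (rule sgn_ell1_def)
  show "uniformity = (INF e\<in>{0 <..}. principal {(x, y :: 'a ell1). dist x y < e})"
    by (rule uniformity_ell1_def)
  show "open U \<longleftrightarrow> (\<forall>x\<in>U. \<forall>\<^sub>F (x', y) in uniformity. x' = x \<longrightarrow> y \<in> U)" for U :: "'a ell1 set"
    by (rule open_ell1_def)
  show "norm A = 0 \<longleftrightarrow> A = 0"
  proof
    assume "norm A = 0"
    then show "A = 0"
    proof transfer
      fix f :: "'a \<Rightarrow> complex"
      assume f: "(\<lambda>k. norm (f k)) summable_on UNIV" and "(\<Sum>\<^sub>\<infinity>k. norm (f k)) = 0"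
      then have "norm (f k) = 0" for k
        by (intro nonneg_infsum_le_0D[OF _ f]) auto
      then show "f = (\<lambda>_. 0)" by auto
    qed
  next
    assume "A = 0" then show "norm A = 0" by transfer simp
  qed
  show "norm (A + B) \<le> norm A + norm B"
  proof transfer
    fix f g :: "'a \<Rightarrow> complex"
    assume fg: "(\<lambda>k. norm (f k)) summable_on UNIV" "(\<lambda>k. norm (g k)) summable_on UNIV"
    have "(\<Sum>\<^sub>\<infinity>k. norm (f k + g k)) \<le> (\<Sum>\<^sub>\<infinity>k. norm (f k) + norm (g k))"
    proof (rule infsum_mono)
      show s: "(\<lambda>k. norm (f k) + norm (g k)) summable_on UNIV" by (intro summable_on_add fg)
      show "(\<lambda>k. norm (f k + g k)) summable_on UNIV" by (rule abs_summable_add[OF fg])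
    qed (rule norm_triangle_ineq)
    also have "\<dots> = (\<Sum>\<^sub>\<infinity>k. norm (f k)) + (\<Sum>\<^sub>\<infinity>k. norm (g k))" by (intro infsum_add fg)
    finally show "(\<Sum>\<^sub>\<infinity>k. norm (f k + g k)) \<le> (\<Sum>\<^sub>\<infinity>k. norm (f k)) + (\<Sum>\<^sub>\<infinity>k. norm (g k))" .
  qed
  show "norm (r *\<^sub>R A) = \<bar>r\<bar> * norm A"
    by transfer (simp add: infsum_cmult_right')
qed

end

lemma coef_simps [simp]:
  "coef 0 k = 0" "coef (A + B) k = coef A k + coef B k" "coef (A - B) k = coef A k - coef B k"
  "coef (- A) k = - coef A k" "coef (r *\<^sub>R A) k = r *\<^sub>R coef A k"
  by (simp_all add: zero_ell1.rep_eq plus_ell1.rep_eq minus_ell1.rep_eq uminus_ell1.rep_eq scaleR_ell1.rep_eq)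

lemma coef_sum [simp]: "coef (\<Sum>i\<in>I. A i) k = (\<Sum>i\<in>I. coef (A i) k)"
  by (induction I rule: infinite_finite_induct) auto

lemma norm_ell1_eq: "norm A = (\<Sum>\<^sub>\<infinity>k. norm (coef A k))"
  by (rule norm_ell1.rep_eq)

lemma norm_has_sum_ell1: "((\<lambda>k. norm (coef A k)) has_sum norm A) UNIV"
  using coef_summable[of A] by (simp add: norm_ell1_eq)

lemma sum_coef_le_norm: "finite F \<Longrightarrow> (\<Sum>k\<in>F. norm (coef A k)) \<le> norm A"
  by (rule finite_sum_le_has_sum[OF norm_has_sum_ell1]) auto

lemma norm_coef_le: "norm (coef A k) \<le> norm A"
  using sum_coef_le_norm[of "{k}" A] by simp

lemma bounded_linear_coef: "bounded_linear (\<lambda>A. coef A k)"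
  by (rule bounded_linear_intro[of _ 1]) (auto simp: norm_coef_le)

lemma ell1_of_bounded_sums:
  fixes f :: "'k \<Rightarrow> complex"
  assumes "\<And>F. finite F \<Longrightarrow> (\<Sum>k\<in>F. norm (f k)) \<le> C"
  shows "coef (Ell1 f) = f" "norm (Ell1 f) \<le> C"
proof -
  have s: "(\<lambda>k. norm (f k)) summable_on UNIV"
    by (rule nonneg_bdd_above_summable_on) (use assms in \<open>auto intro!: bdd_aboveI2\<close>)
  then show "coef (Ell1 f) = f" by (rule coef_Ell1)
  then show "norm (Ell1 f) \<le> C" unfolding norm_ell1_eq
    by (simp add: infsum_le_finite_sums[OF s] assms)
qed

instance ell1 :: (type) banach
proof
  fix X :: "nat \<Rightarrow> 'a ell1" assume X: "Cauchy X"
  have "Cauchy (\<lambda>n. coef (X n) k)" for k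
    by (rule bounded_linear.Cauchy[OF bounded_linear_coef X])
  then have "\<forall>k. \<exists>a. (\<lambda>n. coef (X n) k) \<longlonglongrightarrow> a"
    by (simp add: Cauchy_convergent_iff convergent_def)
  then obtain a where a: "\<And>k. (\<lambda>n. coef (X n) k) \<longlonglongrightarrow> a k" by metis
  have key: "(\<Sum>k\<in>F. norm (a k - coef (X n) k)) \<le> e"
    if "finite F" and n: "\<And>m. m \<ge> N \<Longrightarrow> norm (X m - X n) \<le> e" for F e N n
  proof (rule LIMSEQ_le_const2)
    show "(\<lambda>m. \<Sum>k\<in>F. norm (coef (X m) k - coef (X n) k)) \<longlonglongrightarrow> (\<Sum>k\<in>F. norm (a k - coef (X n) k))"
      by (intro tendsto_intros a)
    show "\<exists>M. \<forall>m\<ge>M. (\<Sum>k\<in>F. norm (coef (X m) k - coef (X n) k)) \<le> e"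
    proof (intro exI allI impI)
      fix m assume "m \<ge> N"
      then show "(\<Sum>k\<in>F. norm (coef (X m) k - coef (X n) k)) \<le> e"
        using order_trans[OF sum_coef_le_norm[OF \<open>finite F\<close>, of "X m - X n"] n[of m]] by simp
    qed
  qed
  have cau: "\<exists>N. \<forall>m\<ge>N. \<forall>n\<ge>N. norm (X m - X n) \<le> e" if "e > 0" for e
    using X that unfolding Cauchy_def dist_norm by (meson less_imp_le)
  obtain N1 where N1: "\<And>m n. m \<ge> N1 \<Longrightarrow> n \<ge> N1 \<Longrightarrow> norm (X m - X n) \<le> 1" using cau[of 1] by auto
  define Y where "Y = X N1 + Ell1 (\<lambda>k. a k - coef (X N1) k)"
  have "coef (Ell1 (\<lambda>k. a k - coef (X N1) k)) = (\<lambda>k. a k - coef (X N1) k)"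
    by (rule ell1_of_bounded_sums(1)[of _ 1], rule key) (use N1 in auto)
  then have Y: "coef Y k = a k" for k by (simp add: Y_def)
  have "X \<longlonglongrightarrow> Y"
  proof (rule LIMSEQ_I)
    fix e :: real assume "e > 0"
    then obtain N where N: "\<And>m n. m \<ge> N \<Longrightarrow> n \<ge> N \<Longrightarrow> norm (X m - X n) \<le> e / 2" using cau[of "e/2"] by auto
    have "norm (X n - Y) < e" if "n \<ge> N" for n
    proof -
      have "norm (Y - X n) \<le> e / 2" unfolding norm_ell1_eq
        by (rule infsum_le_finite_sums[OF coef_summable]) (use key[of _ N n "e/2"] N that Y in auto)
      then show ?thesis using \<open>e > 0\<close> by (simp add: norm_minus_commute)
    qed
    then show "\<exists>N. \<forall>n\<ge>N. norm (X n - Y) < e" by blast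
  qed
  then show "convergent X" by (auto simp: convergent_def)
qed

definition diag :: "('k \<Rightarrow> complex) \<Rightarrow> 'k ell1 \<Rightarrow> 'k ell1" where
  "diag m A = Ell1 (\<lambda>k. m k * coef A k)"

lemma
  assumes m: "\<And>k. norm (m k) \<le> C"
  shows coef_diag: "coef (diag m A) k = m k * coef A k"
    and norm_diag_le: "norm (diag m A) \<le> C * norm A"
proof -
  have C: "C \<ge> 0" using m[of k] norm_ge_zero[of "m k"] by linarith
  have *: "(\<Sum>k\<in>F. norm (m k * coef A k)) \<le> C * norm A" if "finite F" for F
  proof -
    have "(\<Sum>k\<in>F. norm (m k * coef A k)) \<le> (\<Sum>k\<in>F. C * norm (coef A k))"
      by (intro sum_mono) (auto simp: norm_mult intro: mult_right_mono m)
    also have "\<dots> \<le> C * norm A"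
      unfolding sum_distrib_left[symmetric] by (intro mult_left_mono sum_coef_le_norm that C)
    finally show ?thesis .
  qed
  show "coef (diag m A) k = m k * coef A k"
    unfolding diag_def by (subst ell1_of_bounded_sums(1)[OF *]) auto
  show "norm (diag m A) \<le> C * norm A"
    unfolding diag_def by (rule ell1_of_bounded_sums(2)[OF *])
qed

definition cscale :: "complex \<Rightarrow> 'k ell1 \<Rightarrow> 'k ell1" where "cscale c = diag (\<lambda>_. c)"

lemma coef_cscale [simp]: "coef (cscale c A) k = c * coef A k"
  unfolding cscale_def by (rule coef_diag) (rule order_refl)

lemma norm_cscale [simp]: "norm (cscale c A) = norm c * norm A"
  unfolding norm_ell1_eq by (simp add: norm_mult infsum_cmult_right')

lemma bounded_bilinear_cscale: "bounded_bilinear cscale"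
  by (rule bounded_bilinear.intro)
     (auto intro!: ell1_eqI exI[of _ 1] simp: algebra_simps scaleR_conv_of_real)

definition unit :: "'k \<Rightarrow> 'k ell1" where "unit j = Ell1 (\<lambda>k. if k = j then 1 else 0)"

lemma unit_has_sum: "((\<lambda>k. norm (if k = j then 1 else 0 :: complex)) has_sum 1) UNIV"
  by (rule has_sum_finite_neutralI[of "{j}"]) auto

lemma coef_unit [simp]: "coef (unit j) k = (if k = j then 1 else 0)"
  unfolding unit_def by (subst coef_Ell1[OF has_sum_imp_summable[OF unit_has_sum]]) (rule refl)

lemma norm_unit [simp]: "norm (unit j) = 1"
  unfolding norm_ell1_eq coef_unit by (rule infsumI[OF unit_has_sum])

lemma truncation_tendsto:
  "((\<lambda>F. \<Sum>k\<in>F. cscale (coef A k) (unit k)) \<longlongrightarrow> A) (finite_subsets_at_top UNIV)"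
proof -
  have eq: "norm (A - (\<Sum>k\<in>F. cscale (coef A k) (unit k))) = norm A - (\<Sum>k\<in>F. norm (coef A k))"
    if F: "finite F" for F
  proof -
    have "((\<lambda>k. if k \<in> F then norm (coef A k) else 0) has_sum (\<Sum>k\<in>F. norm (coef A k))) UNIV"
      by (rule has_sum_finite_neutralI[of F]) (use F in auto)
    from has_sum_add[OF norm_has_sum_ell1[of A] has_sum_uminusI[OF this]]
    have "((\<lambda>k. norm (coef (A - (\<Sum>k\<in>F. cscale (coef A k) (unit k))) k)) has_sum
        (norm A + - (\<Sum>k\<in>F. norm (coef A k)))) UNIV"
      by (rule back_subst[where P="\<lambda>f. (f has_sum _) UNIV"])
         (auto simp: fun_eq_iff if_distrib[where f="\<lambda>x. _ * x"] F cong: if_cong)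
    then show ?thesis unfolding norm_ell1_eq[of "A - _"] by (simp add: infsumI)
  qed
  have "((\<lambda>F. norm A - (\<Sum>k\<in>F. norm (coef A k))) \<longlongrightarrow> norm A - norm A) (finite_subsets_at_top UNIV)"
    using norm_has_sum_ell1[of A] unfolding has_sum_def by (intro tendsto_intros)
  moreover have "\<forall>\<^sub>F F in finite_subsets_at_top UNIV. norm A - (\<Sum>k\<in>F. norm (coef A k))
      = norm (A - (\<Sum>k\<in>F. cscale (coef A k) (unit k)))"
    by (rule eventually_finite_subsets_at_top_weakI) (simp add: eq)
  ultimately have "((\<lambda>F. norm (A - (\<Sum>k\<in>F. cscale (coef A k) (unit k)))) \<longlongrightarrow> 0) (finite_subsets_at_top UNIV)"
    by (simp add: tendsto_cong)
  then show ?thesis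
    by (simp add: norm_minus_commute[of A] tendsto_norm_zero_iff Lim_null[of _ A])
qed

text \<open>Finitely supported families are dense, so a property that is stable under limits of sequences needs to
be checked only along the addition of multiples of unit vectors.\<close>

lemma ell1_induct [case_names closed zero add]:
  assumes cl: "\<And>X A. (\<And>n. P (X n)) \<Longrightarrow> X \<longlonglongrightarrow> A \<Longrightarrow> P A"
    and zero: "P 0" and add: "\<And>A k c. P A \<Longrightarrow> P (A + cscale c (unit k))"
  shows "P A"
proof -
  have fin: "P (\<Sum>k\<in>F. cscale (c k) (unit k))" if "finite F" for F c
    using that
  proof (induction F)
    case (insert k F)
    then show ?case using add[OF insert.IH, of "c k" k] by (simp add: add.commute)
  qed (simp add: zero)
  have "closed {A. P A}"
    unfolding closed_sequential_limits using cl by blast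
  then have "A \<in> {A. P A}"
    by (rule Lim_in_closed_set[OF _ _ _ truncation_tendsto])
       (auto intro!: eventually_finite_subsets_at_top_weakI fin)
  then show ?thesis by simp
qed

text \<open>The multipliers \<open>cis (t * c k)\<close> with unbounded \<open>c\<close> depend continuously on \<open>t\<close> only in the strong sense.
For unit vectors this is the continuity of one scalar function; density gives it for a fixed argument,
and the contraction property for an argument that moves.\<close>

lemma continuous_on_diag:
  fixes m :: "'t::topological_space \<Rightarrow> 'k \<Rightarrow> complex"
  assumes m: "\<And>k. continuous_on S (\<lambda>t. m t k)" and m1: "\<And>t k. norm (m t k) \<le> 1"
    and A: "continuous_on S A"
  shows "continuous_on S (\<lambda>t. diag (m t) (A t))"
proof -
  have diff: "diag (m t) A - diag (m t) B = diag (m t) (A - B)" for t A B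
    by (intro ell1_eqI) (simp add: coef_diag[OF m1] algebra_simps)
  have n1: "norm (diag (m t) B) \<le> norm B" for t B
    using norm_diag_le[of "m t" 1 B] m1 by simp
  have fixed: "continuous_on S (\<lambda>t. diag (m t) B)" for B
  proof (induction B rule: ell1_induct)
    case (closed X B)
    have "uniform_limit S (\<lambda>n t. diag (m t) (X n)) (\<lambda>t. diag (m t) B) sequentially"
    proof (rule uniform_limitI)
      fix e :: real assume "e > 0"
      then have "\<forall>\<^sub>F n in sequentially. dist (X n) B < e" using closed(2) by (auto simp: tendsto_iff)
      then show "\<forall>\<^sub>F n in sequentially. \<forall>t\<in>S. dist (diag (m t) (X n)) (diag (m t) B) < e"
        by eventually_elim (use n1 in \<open>auto simp: dist_norm diff intro: le_less_trans\<close>)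
    qed
    then show ?case
      by (rule uniform_limit_theorem[rotated]) (use closed in \<open>auto intro!: always_eventually\<close>)
  next
    case zero
    have "diag (m t) 0 = 0" for t by (intro ell1_eqI) (simp add: coef_diag[OF m1])
    then show ?case by simp
  next
    case (add B k c)
    have "diag (m t) (B + cscale c (unit k)) = diag (m t) B + cscale (m t k * c) (unit k)" for t
      by (intro ell1_eqI) (simp add: coef_diag[OF m1] algebra_simps)
    then show ?case
      by (auto intro!: continuous_on_add add bounded_bilinear.continuous_on[OF bounded_bilinear_cscale]
          continuous_intros m)
  qed
  show ?thesis
  proof (clarsimp simp: continuous_on_def)
    fix t0 assume t0: "t0 \<in> S"
    have 1: "((\<lambda>t. diag (m t) (A t0)) \<longlongrightarrow> diag (m t0) (A t0)) (at t0 within S)"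
      using fixed t0 by (auto simp: continuous_on_def)
    have "((\<lambda>t. A t - A t0) \<longlongrightarrow> 0) (at t0 within S)"
      using A t0 by (auto simp: continuous_on_def LIM_zero_iff)
    then have 2: "((\<lambda>t. diag (m t) (A t - A t0)) \<longlongrightarrow> 0) (at t0 within S)"
      by (rule Lim_null_comparison[rotated, OF tendsto_norm_zero]) (use n1 in auto)
    show "((\<lambda>t. diag (m t) (A t)) \<longlongrightarrow> diag (m t0) (A t0)) (at t0 within S)"
      using tendsto_add[OF 2 1] by (simp add: diff[symmetric])
  qed
qed

section \<open>Weighted convolution\<close>

locale beurling_weight =
  fixes \<rho> :: "'k::ab_group_add \<Rightarrow> real"
  assumes weight_ge1: "\<rho> k \<ge> 1" and weight_0: "\<rho> 0 = 1" and weight_add: "\<rho> (k + l) \<le> \<rho> k * \<rho> l"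
begin

lemma weight_pos: "\<rho> k > 0" and weight_nz: "\<rho> k \<noteq> 0"
  using weight_ge1[of k] by auto

text \<open>The product of two functions has as its Fourier coefficients the convolution of the coefficients. Since
the sequences include the weights, the convolution carries the quotient of weights below; it is at most
1 by submultiplicativity, which makes the product contractive.\<close>

definition conv_term :: "'k ell1 \<Rightarrow> 'k ell1 \<Rightarrow> 'k \<Rightarrow> 'k \<Rightarrow> complex" where
  "conv_term A B k l = of_real (\<rho> k / (\<rho> l * \<rho> (k - l))) * (coef A l * coef B (k - l))"

definition conv :: "'k ell1 \<Rightarrow> 'k ell1 \<Rightarrow> 'k ell1" where
  "conv A B = Ell1 (\<lambda>k. \<Sum>\<^sub>\<infinity>l. conv_term A B k l)"

text \<open>The substitution of \<open>(l, k - l)\<close> for \<open>(k, l)\<close> turns the double family into the product of two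
absolutely summable families.\<close>

lemma conv_term_summable:
  shows "(\<lambda>(k, l). norm (conv_term A B k l)) summable_on UNIV" (is ?S)
    and "(\<Sum>\<^sub>\<infinity>(k, l). norm (conv_term A B k l)) \<le> norm A * norm B" (is ?B)
proof -
  have prod: "((\<lambda>(l, m). norm (coef A l) * norm (coef B m)) has_sum (norm A * norm B)) UNIV"
  proof -
    have "(\<lambda>x. norm (case x of (l, m) \<Rightarrow> coef A l * coef B m)) summable_on (UNIV \<times> UNIV)"
      by (rule Infinite_Sum.abs_summable_on_Sigma_iff[THEN iffD2])
         (auto simp: norm_mult infsum_cmult_right' norm_ell1_eq[symmetric]
            intro!: summable_on_cmult_right summable_on_cmult_left coef_summable)
    then have s: "(\<lambda>(l, m). norm (coef A l) * norm (coef B m)) summable_on (UNIV \<times> UNIV)"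
      by (simp add: case_prod_beta' norm_mult)
    have "(\<Sum>\<^sub>\<infinity>(l, m)\<in>UNIV \<times> UNIV. norm (coef A l) * norm (coef B m)) = norm A * norm B"
      by (subst infsum_Sigma'_banach[OF s, symmetric])
         (simp add: infsum_cmult_right' infsum_cmult_left' norm_ell1_eq)
    with s show ?thesis by (simp add: has_sum_iff)
  qed
  have prod': "((\<lambda>(k, l). norm (coef A l) * norm (coef B (k - l))) has_sum (norm A * norm B)) UNIV"
    by (rule has_sum_reindex_bij_witness[where i="\<lambda>(k, l). (l, k - l)" and j="\<lambda>(l, m). (l + m, l)",
          THEN iffD1, OF _ _ _ _ _ _ prod]) auto
  have le: "norm (conv_term A B k l) \<le> norm (coef A l) * norm (coef B (k - l))" for k l
  proof -
    have "\<rho> k \<le> \<rho> l * \<rho> (k - l)" using weight_add[of l "k - l"] by simp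
    then have "\<bar>\<rho> k / (\<rho> l * \<rho> (k - l))\<bar> \<le> 1"
      using weight_pos[of k] weight_pos[of l] weight_pos[of "k-l"] by (simp add: field_simps)
    then show ?thesis
      unfolding conv_term_def norm_mult norm_of_real
      by (intro mult_left_le_one_le mult_nonneg_nonneg) auto
  qed
  have s: "(\<lambda>(k, l). norm (coef A l) * norm (coef B (k - l))) summable_on UNIV"
    using prod' by (simp add: has_sum_iff)
  show S: ?S
    by (rule summable_on_comparison_test[OF s]) (use le in auto)
  show ?B
    unfolding infsumI[OF prod', symmetric] by (rule infsum_mono[OF S s]) (use le in auto)
qed

lemma conv_term_abs_summable: "(\<lambda>l. norm (conv_term A B k l)) summable_on UNIV"
  using conv_term_summable(1)[of A B]
  by (intro summable_on_SigmaD1[where A=UNIV and B="\<lambda>_. UNIV"]) auto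

lemma conv_term_summable': "conv_term A B k summable_on UNIV"
  by (rule abs_summable_summable[OF conv_term_abs_summable])

lemma
  shows coef_conv: "coef (conv A B) k = (\<Sum>\<^sub>\<infinity>l. conv_term A B k l)"
    and norm_conv_le: "norm (conv A B) \<le> norm A * norm B"
proof -
  have s: "(\<lambda>(k, l). norm (conv_term A B k l)) summable_on (UNIV \<times> UNIV)"
    using conv_term_summable(1)[of A B] by simp
  note s' = summable_on_Sigma_banach[OF s]
  have le: "norm (\<Sum>\<^sub>\<infinity>l. conv_term A B k l) \<le> (\<Sum>\<^sub>\<infinity>l. norm (conv_term A B k l))" for k
    by (rule norm_infsum_bound[OF conv_term_abs_summable])
  have s'': "(\<lambda>k. norm (\<Sum>\<^sub>\<infinity>l. conv_term A B k l)) summable_on UNIV"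
    by (rule summable_on_comparison_test[OF s']) (use le in auto)
  show *: "coef (conv A B) k = (\<Sum>\<^sub>\<infinity>l. conv_term A B k l)" for k
    unfolding conv_def coef_Ell1[OF s''] ..
  have "norm (conv A B) \<le> (\<Sum>\<^sub>\<infinity>k. \<Sum>\<^sub>\<infinity>l. norm (conv_term A B k l))"
    unfolding norm_ell1_eq * by (rule infsum_mono[OF s'' s']) (use le in auto)
  also have "\<dots> \<le> norm A * norm B"
    using conv_term_summable(2)[of A B] by (subst infsum_Sigma'_banach[OF s]) simp
  finally show "norm (conv A B) \<le> norm A * norm B" .
qed

lemma bounded_bilinear_conv: "bounded_bilinear conv"
proof
  show "conv (A + A') B = conv A B + conv A' B" for A A' B
    by (rule ell1_eqI) (simp add: coef_conv infsum_add[OF conv_term_summable' conv_term_summable', symmetric],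
        simp add: conv_term_def algebra_simps)
  show "conv A (B + B') = conv A B + conv A B'" for A B B'
    by (rule ell1_eqI) (simp add: coef_conv infsum_add[OF conv_term_summable' conv_term_summable', symmetric],
        simp add: conv_term_def algebra_simps)
  show "conv (r *\<^sub>R A) B = r *\<^sub>R conv A B" for r A B
    by (rule ell1_eqI) (simp add: coef_conv infsum_scaleR_right[symmetric], simp add: conv_term_def)
  show "conv A (r *\<^sub>R B) = r *\<^sub>R conv A B" for r A B
    by (rule ell1_eqI) (simp add: coef_conv infsum_scaleR_right[symmetric], simp add: conv_term_def)
  show "\<exists>K. \<forall>A B. norm (conv A B) \<le> norm A * norm B * K"
    by (rule exI[of _ 1]) (simp add: norm_conv_le)
qed

definition character :: "('k \<Rightarrow> complex) \<Rightarrow> bool" where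
  "character \<psi> \<longleftrightarrow> (\<forall>k. norm (\<psi> k) = 1) \<and> (\<forall>k l. \<psi> (k + l) = \<psi> k * \<psi> l) \<and> \<psi> 0 = 1"

text \<open>The value at a point of the function with weighted Fourier coefficients \<open>A\<close>, if \<open>\<psi>\<close> consists of the
values of all exponentials at that point.\<close>

definition eval_at :: "('k \<Rightarrow> complex) \<Rightarrow> 'k ell1 \<Rightarrow> complex" where
  "eval_at \<psi> A = (\<Sum>\<^sub>\<infinity>k. coef A k * (\<psi> k / \<rho> k))"

context
  fixes \<psi> assumes \<psi>: "character \<psi>"
begin

lemma norm_eval_term: "norm (coef A k * (\<psi> k / \<rho> k)) \<le> norm (coef A k)"
proof -
  have "norm (coef A k) * (1 / \<rho> k) \<le> norm (coef A k) * 1"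
    using weight_ge1[of k] by (intro mult_left_mono) auto
  then show ?thesis using \<psi> weight_pos[of k] by (simp add: norm_mult norm_divide character_def)
qed

lemma eval_abs_summable: "(\<lambda>k. norm (coef A k * (\<psi> k / \<rho> k))) summable_on UNIV"
  by (rule summable_on_comparison_test[OF coef_summable[of A]]) (use norm_eval_term in auto)

lemma eval_summable: "(\<lambda>k. coef A k * (\<psi> k / \<rho> k)) summable_on UNIV"
  by (rule abs_summable_summable[OF eval_abs_summable])

lemma norm_eval_at_le: "norm (eval_at \<psi> A) \<le> norm A"
  unfolding eval_at_def norm_ell1_eq
  by (rule order_trans[OF norm_infsum_bound[OF eval_abs_summable]])
     (rule infsum_mono[OF eval_abs_summable coef_summable norm_eval_term])

lemma eval_at_add: "eval_at \<psi> (A + B) = eval_at \<psi> A + eval_at \<psi> B"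
  unfolding eval_at_def by (subst infsum_add[OF eval_summable eval_summable, symmetric]) (simp add: algebra_simps)

lemma eval_at_cscale: "eval_at \<psi> (cscale c A) = c * eval_at \<psi> A"
  unfolding eval_at_def coef_cscale mult.assoc by (rule infsum_cmult_right')

lemma bounded_linear_eval_at: "bounded_linear (eval_at \<psi>)"
proof (rule bounded_linear_intro[of _ 1])
  show "eval_at \<psi> (A + B) = eval_at \<psi> A + eval_at \<psi> B" for A B by (rule eval_at_add)
  show "eval_at \<psi> (r *\<^sub>R A) = r *\<^sub>R eval_at \<psi> A" for r A
  proof -
    have "r *\<^sub>R A = cscale (of_real r) A" by (rule ell1_eqI) (simp add: scaleR_conv_of_real)
    then show ?thesis by (simp add: eval_at_cscale scaleR_conv_of_real)
  qed
  show "norm (eval_at \<psi> A) \<le> norm A * 1" for A using norm_eval_at_le by simp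
qed

lemma eval_at_unit: "eval_at \<psi> (unit k) = \<psi> k / \<rho> k"
  unfolding eval_at_def
  by (rule infsumI, rule has_sum_finite_neutralI[of "{k}"]) auto

text \<open>Fubini's theorem for absolutely summable families, with the same substitution as for the norm of the
product.\<close>

lemma eval_at_conv: "eval_at \<psi> (conv A B) = eval_at \<psi> A * eval_at \<psi> B"
proof -
  define h where "h A l = coef A l * (\<psi> l / \<rho> l)" for A l
  have hs: "(\<lambda>l. norm (h A l)) summable_on UNIV" for A unfolding h_def by (rule eval_abs_summable)
  have prod: "(\<lambda>x. norm (case x of (l, m) \<Rightarrow> h A l * h B m)) summable_on (UNIV \<times> UNIV)"
    by (rule Infinite_Sum.abs_summable_on_Sigma_iff[THEN iffD2])
       (auto simp: norm_mult infsum_cmult_right' infsum_nonneg intro!: summable_on_cmult_right summable_on_cmult_left hs)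
  have s: "(\<lambda>(l, m). h A l * h B m) summable_on (UNIV \<times> UNIV)"
    by (rule abs_summable_summable[OF prod])
  have term_eq: "conv_term A B k l * (\<psi> k / \<rho> k) = h A l * h B (k - l)" for k l
  proof -
    have "\<psi> k = \<psi> l * \<psi> (k - l)" using \<psi> unfolding character_def by (metis add_diff_cancel_left' diff_add_cancel add.commute)
    then show ?thesis using weight_nz[of k] weight_nz[of l] weight_nz[of "k-l"]
      by (simp add: conv_term_def h_def field_simps)
  qed
  have s2: "(\<lambda>(k, l). h A l * h B (k - l)) summable_on (UNIV \<times> UNIV)"
    by (rule summable_on_reindex_bij_witness[where i="\<lambda>(k, l). (l, k - l)" and j="\<lambda>(l, m). (l + m, l)",
          THEN iffD1, OF _ _ _ _ _ s]) auto
  have "eval_at \<psi> (conv A B) = (\<Sum>\<^sub>\<infinity>k. \<Sum>\<^sub>\<infinity>l. h A l * h B (k - l))"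
    unfolding eval_at_def coef_conv infsum_cmult_left'[symmetric] term_eq ..
  also have "\<dots> = (\<Sum>\<^sub>\<infinity>(k, l)\<in>UNIV \<times> UNIV. h A l * h B (k - l))"
    by (rule infsum_Sigma'_banach[OF s2])
  also have "\<dots> = (\<Sum>\<^sub>\<infinity>(l, m)\<in>UNIV \<times> UNIV. h A l * h B m)"
    by (rule infsum_reindex_bij_witness[symmetric,
          where i="\<lambda>(k, l). (l, k - l)" and j="\<lambda>(l, m). (l + m, l)"]) auto
  also have "\<dots> = (\<Sum>\<^sub>\<infinity>l. \<Sum>\<^sub>\<infinity>m. h A l * h B m)"
    by (rule infsum_Sigma'_banach[OF s, symmetric])
  also have "\<dots> = eval_at \<psi> A * eval_at \<psi> B"
    unfolding infsum_cmult_right' infsum_cmult_left' eval_at_def h_def ..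
  finally show ?thesis .
qed

end

primrec conv_pow :: "'k ell1 \<Rightarrow> nat \<Rightarrow> 'k ell1" where
  "conv_pow A 0 = unit 0"
| "conv_pow A (Suc n) = conv A (conv_pow A n)"

lemma eval_at_conv_pow: "character \<psi> \<Longrightarrow> eval_at \<psi> (conv_pow A n) = eval_at \<psi> A ^ n"
  by (induction n) (auto simp: eval_at_unit eval_at_conv weight_0 character_def)

lemma norm_conv_pow_le: "norm (conv_pow A n) \<le> norm A ^ n"
proof (induction n)
  case (Suc n)
  have "norm (conv A (conv_pow A n)) \<le> norm A * norm (conv_pow A n)" by (rule norm_conv_le)
  also have "\<dots> \<le> norm A * norm A ^ n" using Suc by (intro mult_left_mono) auto
  finally show ?case by simp
qed simp

text \<open>Induction with \<open>A * a - B * b = A * (a - b) + (A - B) * b\<close> for the two lower powers \<open>a\<close> and \<open>b\<close>.\<close>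

lemma norm_conv_pow_diff_le:
  assumes "norm A \<le> R" "norm B \<le> R"
  shows "norm (conv_pow A n - conv_pow B n) \<le> n * R ^ (n - 1) * norm (A - B)"
proof (induction n)
  case (Suc n)
  note diff = bounded_bilinear.diff_left[OF bounded_bilinear_conv] bounded_bilinear.diff_right[OF bounded_bilinear_conv]
  have R: "R \<ge> 0" using assms(1) norm_ge_zero[of A] by linarith
  have "conv_pow A (Suc n) - conv_pow B (Suc n) = conv A (conv_pow A n - conv_pow B n) + conv (A - B) (conv_pow B n)"
    by (simp add: diff)
  also have "norm \<dots> \<le> norm A * norm (conv_pow A n - conv_pow B n) + norm (A - B) * norm (conv_pow B n)"
    by (intro norm_triangle_le add_mono norm_conv_le)
  also have "\<dots> \<le> R * (n * R ^ (n - 1) * norm (A - B)) + norm (A - B) * R ^ n"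
    using assms R by (intro add_mono mult_mono Suc order_trans[OF norm_conv_pow_le] power_mono) auto
  also have "\<dots> = Suc n * R ^ (Suc n - 1) * norm (A - B)"
  proof (cases n)
    case (Suc m)
    have "R * (x * R ^ m * d) + d * (R * R ^ m) = (1 + x) * (R * R ^ m) * d" for x d :: real
      by algebra
    then show ?thesis by (simp add: Suc)
  qed simp
  finally show ?case .
qed simp

lemma continuous_on_conv_pow: "continuous_on S A \<Longrightarrow> continuous_on S (\<lambda>t. conv_pow (A t) n)"
proof (induction n)
  case (Suc n)
  show ?case unfolding conv_pow.simps
    by (rule bounded_bilinear.continuous_on[OF bounded_bilinear_conv Suc.prems Suc.IH[OF Suc.prems]])
qed simp

end

section \<open>Characters of the torus\<close>

lemma phase_add_left: "phase \<omega> (k + l) x = phase \<omega> k x + phase \<omega> l x"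
  by (simp add: phase_def algebra_simps sum.distrib)

lemma phase_zero [simp]: "phase \<omega> 0 x = 0"
  by (simp add: phase_def)

lemma phase_minus: "phase \<omega> (- k) x = - phase \<omega> k x"
  by (simp add: phase_def sum_negf)

lemma phase_axis: "phase \<omega> (axis j 1) x = \<omega> $ j * x $ j"
proof -
  have "phase \<omega> (axis j 1) x = (\<Sum>i\<in>UNIV. if i = j then \<omega> $ i * x $ i else 0)"
    unfolding phase_def by (rule sum.cong) (auto simp: axis_def)
  then show ?thesis by simp
qed

lemma phase_inner: "phase \<omega> k x = (\<chi> j. of_int (k $ j) * \<omega> $ j) \<bullet> x"
  by (simp add: phase_def inner_vec_def)

lemma continuous_on_phase: "continuous_on S (phase \<omega> k)"
  unfolding phase_inner[abs_def] by (intro continuous_intros)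

lemma continuous_on_cis_phase: "continuous_on S (\<lambda>x. cis (phase \<omega> k x))"
  by (rule continuous_on_compose2[OF continuous_on_cis[OF continuous_on_id] continuous_on_phase]) auto

lemma exp_phase: "exp (- \<i> * complex_of_real (phase \<omega> k x)) = cis (phase \<omega> (- k) x)"
  by (simp add: cis_conv_exp phase_minus)

section \<open>Fourier coefficients on the torus\<close>

lemma torus_cell_sets: "torus_cell \<omega> \<in> sets lebesgue"
  by (simp add: torus_cell_def)

lemma compact_torus_cell: "compact (torus_cell \<omega>)"
  by (simp add: torus_cell_def compact_cbox)

definition cell_measure :: "real^'d \<Rightarrow> (real^'d) measure" where
  "cell_measure \<omega> = lebesgue_on (torus_cell \<omega>)"

lemma space_cell_measure [simp]: "space (cell_measure \<omega>) = torus_cell \<omega>"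
  by (simp add: cell_measure_def)

lemma torus_L1_iff: "u \<in> torus_L1 \<omega> \<longleftrightarrow> torus_periodic \<omega> u \<and> integrable (cell_measure \<omega>) u"
  unfolding torus_L1_def cell_measure_def
  by (simp add: integrable_restrict_space torus_cell_sets set_integrable_def)

lemma fourier_coeff_eq:
  "fourier_coeff \<omega> u k =
     (\<integral>x. u x * cis (phase \<omega> (- k) x) \<partial>cell_measure \<omega>) / measure lebesgue (torus_cell \<omega>)"
  unfolding fourier_coeff_def cell_measure_def set_lebesgue_integral_def exp_phase
  by (subst integral_restrict_space) (simp_all add: torus_cell_sets)

lemma measurable_cell_continuous: "continuous_on UNIV f \<Longrightarrow> f \<in> borel_measurable (cell_measure \<omega>)"
  unfolding cell_measure_def
  by (rule continuous_imp_measurable_on_sets_lebesgue[OF _ torus_cell_sets]) (auto intro: continuous_on_subset)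

lemma finite_cell_measure: "finite_measure (cell_measure \<omega>)"
  unfolding cell_measure_def
  by (rule finite_measure_lebesgue_on) (simp add: torus_cell_def)

lemma integrable_cell_mult_bounded:
  fixes g h :: "real^'d \<Rightarrow> complex"
  assumes g: "integrable (cell_measure \<omega>) g" and h: "h \<in> borel_measurable (cell_measure \<omega>)"
    and C: "\<And>x. x \<in> torus_cell \<omega> \<Longrightarrow> norm (h x) \<le> C"
  shows "integrable (cell_measure \<omega>) (\<lambda>x. g x * h x)"
proof (rule Bochner_Integration.integrable_bound)
  show "integrable (cell_measure \<omega>) (\<lambda>x. C * norm (g x))" using g by simp
  show "(\<lambda>x. g x * h x) \<in> borel_measurable (cell_measure \<omega>)" using g h by measurable
  show "AE x in cell_measure \<omega>. norm (g x * h x) \<le> norm (C * norm (g x))"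
  proof (rule AE_I2)
    fix x assume "x \<in> space (cell_measure \<omega>)"
    then have "norm (h x) \<le> \<bar>C\<bar>" using C[of x] by simp
    then show "norm (g x * h x) \<le> norm (C * norm (g x))"
      by (simp add: norm_mult abs_mult mult.commute[of "norm (g x)"] mult_right_mono)
  qed
qed

lemma integrable_cell_mult_cis:
  "integrable (cell_measure \<omega>) g \<Longrightarrow> integrable (cell_measure \<omega>) (\<lambda>x. g x * cis (phase \<omega> k x))"
  by (rule integrable_cell_mult_bounded[where C=1])
     (auto intro: measurable_cell_continuous continuous_on_cis_phase)

lemma integrable_cell_bounded:
  fixes h :: "real^'d \<Rightarrow> complex"
  assumes h: "h \<in> borel_measurable (cell_measure \<omega>)" and C: "\<And>x. x \<in> torus_cell \<omega> \<Longrightarrow> norm (h x) \<le> C"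
  shows "integrable (cell_measure \<omega>) h"
proof -
  interpret finite_measure "cell_measure \<omega>" by (rule finite_cell_measure)
  show ?thesis using integrable_cell_mult_bounded[OF _ h C, of "\<lambda>_. 1"] by simp
qed

section \<open>Orthogonality of the characters\<close>

text \<open>Lebesgue measure is a product measure, and the exponential as well as the indicator of a box are
products of functions of one coordinate.\<close>

lemma integral_cbox_cis:
  fixes K :: "'a::euclidean_space"
  shows "(\<integral>x. indicator (cbox 0 L) x *\<^sub>R cis (K \<bullet> x) \<partial>lborel) =
    (\<Prod>b\<in>Basis. \<integral>t. indicator {0..L \<bullet> b} t *\<^sub>R cis ((K \<bullet> b) * t) \<partial>lborel)"
proof -
  interpret product_sigma_finite "\<lambda>_::'a. lborel :: real measure" by standard
  let ?P = "\<Pi>\<^sub>M b\<in>Basis. (lborel :: real measure)"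
  let ?S = "\<lambda>f::'a \<Rightarrow> real. \<Sum>b\<in>Basis. f b *\<^sub>R b"
  have meas: "(\<lambda>x. indicator (cbox 0 L) x *\<^sub>R cis (K \<bullet> x)) \<in> borel_measurable borel"
    by (rule borel_measurable_scaleR[OF borel_measurable_indicator borel_measurable_continuous_onI])
       (auto intro!: continuous_intros)
  have "(\<integral>x. indicator (cbox 0 L) x *\<^sub>R cis (K \<bullet> x) \<partial>lborel) =
      (\<integral>f. indicator (cbox 0 L) (?S f) *\<^sub>R cis (K \<bullet> ?S f) \<partial>?P)"
    unfolding lborel_def[where 'a='a] lborel_eq_real[symmetric]
    by (rule integral_distr[OF _ meas]) measurable
  also have "\<dots> = (\<integral>f. (\<Prod>b\<in>Basis. indicator {0..L \<bullet> b} (f b) *\<^sub>R cis ((K \<bullet> b) * f b)) \<partial>?P)"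
  proof (rule Bochner_Integration.integral_cong[OF refl])
    fix f :: "'a \<Rightarrow> real"
    have ind: "indicator (cbox 0 L) (?S f) = (\<Prod>b\<in>Basis. indicator {0..L \<bullet> b} (f b) :: real)"
      by (auto simp: mem_box indicator_def prod_zero_iff)
    have "cis (K \<bullet> ?S f) = (\<Prod>b\<in>Basis. cis ((K \<bullet> b) * f b))"
      by (simp add: inner_sum_right cis_conv_exp exp_sum[symmetric] sum_distrib_left mult.commute)
    then show "indicator (cbox 0 L) (?S f) *\<^sub>R cis (K \<bullet> ?S f) =
        (\<Prod>b\<in>Basis. indicator {0..L \<bullet> b} (f b) *\<^sub>R cis ((K \<bullet> b) * f b))"
      unfolding ind by (simp add: scaleR_conv_of_real prod.distrib)
  qed
  also have "\<dots> = (\<Prod>b\<in>Basis. \<integral>t. indicator {0..L \<bullet> b} t *\<^sub>R cis ((K \<bullet> b) * t) \<partial>lborel)"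
    by (rule product_integral_prod)
       (auto intro!: borel_integrable_compact continuous_intros)
  finally show ?thesis .
qed

lemma integral_cis_period:
  assumes c: "c \<noteq> 0" and n: "c * l = 2 * pi * of_int n" and l: "l \<ge> 0"
  shows "(\<integral>t. indicator {0..l} t *\<^sub>R cis (c * t) \<partial>lborel) = 0"
proof -
  have "(\<integral>t. indicator {0..l} t *\<^sub>R cis (c * t) \<partial>lborel) = cis (c * l) / (\<i> * c) - cis (c * 0) / (\<i> * c)"
  proof (rule integral_FTC_Icc[OF l])
    fix t :: real
    have "((\<lambda>t. exp (\<i> * c * of_real t) / (\<i> * c)) has_vector_derivative exp (\<i> * c * of_real t)) (at t within {0..l})"
      using c by (auto intro!: derivative_eq_intros has_vector_derivative_real_field)
    then show "((\<lambda>t. cis (c * t) / (\<i> * c)) has_vector_derivative cis (c * t)) (at t within {0..l})"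
      by (simp add: cis_conv_exp mult.assoc)
  qed (intro continuous_intros)
  also have "cis (c * l) = 1"
    unfolding n by (rule cis_multiple_2pi) simp
  finally show ?thesis by simp
qed

lemma measure_torus_cell_pos:
  fixes \<omega> :: "real^'d"
  assumes "\<And>j. \<omega> $ j \<noteq> 0"
  shows "measure lebesgue (torus_cell \<omega>) > 0"
proof -
  have "(\<chi> j. 2 * pi / \<bar>\<omega> $ j\<bar>) \<bullet> b > 0" if "b \<in> Basis" for b :: "real^'d"
    using that assms by (auto simp: Basis_vec_def inner_axis)
  then show ?thesis
    by (auto simp: torus_cell_def content_cbox_cases intro!: prod_pos)
       (meson less_imp_le)
qed

lemma integral_cell_cis:
  fixes \<omega> :: "real^'d"
  assumes \<omega>: "\<And>j. \<omega> $ j \<noteq> 0"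
  shows "(\<integral>x. cis (phase \<omega> k x) \<partial>cell_measure \<omega>) = (if k = 0 then measure lebesgue (torus_cell \<omega>) else 0)"
proof (cases "k = 0")
  case True
  then show ?thesis
    by (simp add: cell_measure_def measure_restrict_space torus_cell_sets scaleR_conv_of_real)
next
  case False
  then obtain j where j: "k $ j \<noteq> 0" by (auto simp: vec_eq_iff)
  let ?K = "\<chi> j. of_int (k $ j) * \<omega> $ j" and ?L = "\<chi> j. 2 * pi / \<bar>\<omega> $ j\<bar>"
  have "(\<integral>x. cis (phase \<omega> k x) \<partial>cell_measure \<omega>) =
      (\<integral>x. indicator (torus_cell \<omega>) x *\<^sub>R cis (phase \<omega> k x) \<partial>lebesgue)"
    unfolding cell_measure_def by (subst integral_restrict_space) (simp_all add: torus_cell_sets)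
  also have "\<dots> = (\<integral>x. indicator (cbox 0 ?L) x *\<^sub>R cis (?K \<bullet> x) \<partial>lborel)"
    unfolding torus_cell_def phase_inner
  proof (rule integral_completion)
    have "(\<lambda>x. indicator (cbox 0 ?L) x *\<^sub>R cis (?K \<bullet> x)) \<in> borel_measurable borel"
      by (rule borel_measurable_scaleR[OF borel_measurable_indicator borel_measurable_continuous_onI])
         (auto intro!: continuous_intros)
    then show "(\<lambda>x. indicator (cbox 0 ?L) x *\<^sub>R cis (?K \<bullet> x)) \<in> borel_measurable lborel" by simp
  qed
  also have "\<dots> = (\<Prod>b\<in>Basis. \<integral>t. indicator {0..?L \<bullet> b} t *\<^sub>R cis ((?K \<bullet> b) * t) \<partial>lborel)"
    by (rule integral_cbox_cis)
  also have "\<dots> = 0"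
  proof (rule prod_zero)
    have b: "axis j 1 \<in> (Basis :: (real^'d) set)" by (simp add: axis_in_Basis_iff)
    have period: "(?K \<bullet> axis j 1) * (?L \<bullet> axis j 1) = 2 * pi * of_int (k $ j * (if \<omega> $ j > 0 then 1 else -1))"
      using \<omega>[of j] by (auto simp: inner_axis abs_if field_simps)
    have "(\<integral>t. indicator {0..?L \<bullet> axis j 1} t *\<^sub>R cis ((?K \<bullet> axis j 1) * t) \<partial>lborel) = 0"
      by (rule integral_cis_period[OF _ period]) (use \<omega>[of j] j in \<open>auto simp: inner_axis\<close>)
    then show "\<exists>b\<in>Basis. (\<integral>t. indicator {0..?L \<bullet> b} t *\<^sub>R cis ((?K \<bullet> b) * t) \<partial>lborel) = 0"
      using b by blast
  qed simp
  finally show ?thesis using False by simp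
qed

section \<open>Uniqueness of Fourier coefficients\<close>

inductive trig_poly :: "real^'d \<Rightarrow> (real^'d \<Rightarrow> complex) \<Rightarrow> bool" for \<omega> where
  mono: "trig_poly \<omega> (\<lambda>x. c * cis (phase \<omega> k x))"
| add: "trig_poly \<omega> f \<Longrightarrow> trig_poly \<omega> g \<Longrightarrow> trig_poly \<omega> (\<lambda>x. f x + g x)"

lemma trig_poly_const: "trig_poly \<omega> (\<lambda>x. c)"
  using trig_poly.mono[of \<omega> c 0] by simp

lemma trig_poly_mult:
  assumes "trig_poly \<omega> f" "trig_poly \<omega> g"
  shows "trig_poly \<omega> (\<lambda>x. f x * g x)"
  using assms
proof (induction f)
  case (mono c k)
  from mono show ?case
  proof (induction g)
    case (mono d l)
    have "trig_poly \<omega> (\<lambda>x. (c * d) * cis (phase \<omega> (k + l) x))" by (rule trig_poly.mono)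
    then show ?case by (simp add: phase_add_left cis_mult[symmetric] mult_ac)
  next
    case (add f g)
    then show ?case using trig_poly.add[OF add.IH] by (simp add: algebra_simps)
  qed
next
  case (add f h)
  then show ?case using trig_poly.add[OF add.IH] by (simp add: algebra_simps)
qed

lemma trig_poly_sum: "(\<And>i. i \<in> I \<Longrightarrow> trig_poly \<omega> (f i)) \<Longrightarrow> trig_poly \<omega> (\<lambda>x. \<Sum>i\<in>I. f i x)"
  by (induction I rule: infinite_finite_induct) (auto intro: trig_poly_const trig_poly.add)

text \<open>The torus as a product of circles in \<open>complex^'d\<close>: a compact subset of a Euclidean space, to which the
Stone--Weierstrass theorem for polynomials applies.\<close>

definition torus_embed :: "real^'d \<Rightarrow> real^'d \<Rightarrow> complex^'d" where
  "torus_embed \<omega> x = (\<chi> j. cis (\<omega> $ j * x $ j))"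

lemma continuous_on_torus_embed: "continuous_on S (torus_embed \<omega>)"
  unfolding torus_embed_def[abs_def] by (intro continuous_intros)

text \<open>Real and imaginary parts of the coordinates on the product of circles are cosines and sines, hence
combinations of exponentials with opposite frequencies.\<close>

lemma trig_poly_of_polynomial:
  fixes P :: "complex^'d \<Rightarrow> real"
  assumes "real_polynomial_function P"
  shows "trig_poly \<omega> (\<lambda>x. of_real (P (torus_embed \<omega> x)))"
  using assms
proof induction
  case (linear h)
  interpret h: bounded_linear h by fact
  have h: "h z = (\<Sum>j\<in>UNIV. Re (z $ j) * h (axis j 1) + Im (z $ j) * h (axis j \<i>))" for z
  proof -
    have "z = (\<Sum>j\<in>UNIV. Re (z $ j) *\<^sub>R axis j 1 + Im (z $ j) *\<^sub>R axis j \<i>)"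
      by (auto simp: vec_eq_iff axis_def complex_eq_iff if_distrib[where f="\<lambda>x. _ *\<^sub>R x"]
           if_distrib[where f=Re] if_distrib[where f=Im] sum.distrib cong: if_cong)
    then have "h z = h (\<Sum>j\<in>UNIV. Re (z $ j) *\<^sub>R axis j 1 + Im (z $ j) *\<^sub>R axis j \<i>)" by simp
    then show ?thesis by (simp add: h.sum h.add h.scaleR)
  qed
  have c: "trig_poly \<omega> (\<lambda>x. of_real (cos (\<omega> $ j * x $ j)))" for j
  proof -
    have "trig_poly \<omega> (\<lambda>x. (1/2) * cis (phase \<omega> (axis j 1) x) + (1/2) * cis (phase \<omega> (- axis j 1) x))"
      by (intro trig_poly.intros)
    then show ?thesis by (rule back_subst[where P="trig_poly \<omega>"])
      (auto simp: fun_eq_iff phase_minus phase_axis complex_eq_iff)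
  qed
  have s: "trig_poly \<omega> (\<lambda>x. of_real (sin (\<omega> $ j * x $ j)))" for j
  proof -
    have "trig_poly \<omega> (\<lambda>x. (-\<i>/2) * cis (phase \<omega> (axis j 1) x) + (\<i>/2) * cis (phase \<omega> (- axis j 1) x))"
      by (intro trig_poly.intros)
    then show ?thesis by (rule back_subst[where P="trig_poly \<omega>"])
      (auto simp: fun_eq_iff phase_minus phase_axis complex_eq_iff)
  qed
  have "trig_poly \<omega> (\<lambda>x. \<Sum>j\<in>UNIV. of_real (cos (\<omega> $ j * x $ j)) * of_real (h (axis j 1)) +
      of_real (sin (\<omega> $ j * x $ j)) * of_real (h (axis j \<i>)))"
    by (rule trig_poly_sum, rule trig_poly.add)
       (rule trig_poly_mult[OF c trig_poly_const] trig_poly_mult[OF s trig_poly_const])+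
  also have "(\<lambda>x. \<Sum>j\<in>UNIV. of_real (cos (\<omega> $ j * x $ j)) * of_real (h (axis j 1)) +
      of_real (sin (\<omega> $ j * x $ j)) * of_real (h (axis j \<i>))) = (\<lambda>x. complex_of_real (h (torus_embed \<omega> x)))"
  proof
    fix x
    show "(\<Sum>j\<in>UNIV. of_real (cos (\<omega> $ j * x $ j)) * of_real (h (axis j 1)) +
      of_real (sin (\<omega> $ j * x $ j)) * of_real (h (axis j \<i>))) = complex_of_real (h (torus_embed \<omega> x))"
      unfolding h[of "torus_embed \<omega> x"] by (simp add: torus_embed_def)
  qed
  finally show ?case .
next
  case (const c)
  show ?case by (rule trig_poly_const)
next
  case (add f g)
  then show ?case using trig_poly.add[OF add.IH] by simp
next
  case (mult f g)
  then show ?case using trig_poly_mult[OF mult.IH] by simp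
qed

lemma torus_embed_inj:
  assumes x: "\<And>j. 0 \<le> x $ j \<and> x $ j < 2 * pi / \<bar>\<omega> $ j\<bar>"
    and y: "\<And>j. 0 \<le> y $ j \<and> y $ j < 2 * pi / \<bar>\<omega> $ j\<bar>"
    and \<omega>: "\<And>j. \<omega> $ j \<noteq> 0" and eq: "torus_embed \<omega> x = torus_embed \<omega> y"
  shows "x = y"
proof (subst vec_eq_iff, rule allI)
  fix j
  have "cis (\<omega> $ j * x $ j) = cis (\<omega> $ j * y $ j)"
    using eq by (simp add: torus_embed_def vec_eq_iff)
  then have "cis (\<omega> $ j * (x $ j - y $ j)) = 1"
    by (simp add: right_diff_distrib cis_divide[symmetric])
  then have "cos (\<omega> $ j * (x $ j - y $ j)) = 1" by (simp add: complex_eq_iff)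
  then obtain n :: int where n: "\<omega> $ j * (x $ j - y $ j) = of_int n * 2 * pi"
    unfolding cos_one_2pi_int by blast
  have "\<bar>x $ j - y $ j\<bar> < 2 * pi / \<bar>\<omega> $ j\<bar>" using x[of j] y[of j] by auto
  then have "\<bar>\<omega> $ j * (x $ j - y $ j)\<bar> < 2 * pi"
    using \<omega>[of j] by (simp only: abs_mult) (simp add: less_divide_eq mult.commute)
  then have "\<bar>of_int n\<bar> < (1::real)" unfolding n by (simp add: abs_mult)
  then have "n = 0" by linarith
  then show "x $ j = y $ j" using n \<omega>[of j] by simp
qed

text \<open>Up to a null set, the set where \<open>r\<close> is positive is a countable union of compact sets. On each of them
the integral of the positive function \<open>r\<close> vanishes, so each of them is a null set.\<close>

lemma positive_part_null_if_compact_integrals_zero: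
  fixes r :: "'a::euclidean_space \<Rightarrow> real"
  assumes r: "integrable (lebesgue_on T) r" and T: "T \<in> sets lebesgue" and U: "U \<in> sets lebesgue"
    and UT: "U \<subseteq> T"
    and zero: "\<And>C. compact C \<Longrightarrow> C \<subseteq> U \<Longrightarrow> (\<integral>x. r x * indicator C x \<partial>lebesgue_on T) = 0"
  shows "negligible {x\<in>U. r x > 0}"
proof -
  have "{x\<in>space (lebesgue_on T). r x > 0} \<in> sets (lebesgue_on T)"
    using r by measurable
  then have "{x\<in>T. r x > 0} \<in> sets lebesgue"
    using T by (simp add: sets_restrict_space_iff)
  then have "{x\<in>T. r x > 0} \<inter> U \<in> sets lebesgue" using U by (rule sets.Int)
  also have "{x\<in>T. r x > 0} \<inter> U = {x\<in>U. r x > 0}" using UT by auto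
  finally have "{x\<in>U. r x > 0} \<in> sets lebesgue" .
  then obtain C N where C: "fsigma C" and N: "N \<in> null_sets lebesgue" and CN: "C \<union> N = {x\<in>U. r x > 0}"
    by (rule lebesgue_set_almost_fsigma)
  obtain F :: "nat \<Rightarrow> 'a set" where F: "range F \<subseteq> Collect compact" and CF: "C = \<Union>(range F)"
    using C fsigma_Union_compact by metis
  have "negligible (F n)" for n
  proof -
    have cF: "compact (F n)" using F by auto
    have sub: "F n \<subseteq> {x\<in>U. r x > 0}" using CF CN by auto
    have m: "F n \<in> sets (lebesgue_on T)"
      using cF sub UT T by (auto simp: sets_restrict_space_iff intro: fmeasurableD lmeasurable_compact)
    have i: "integrable (lebesgue_on T) (\<lambda>x. r x * indicator (F n) x)"
      by (rule integrable_real_mult_indicator[OF m r])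
    have "(\<integral>x. r x * indicator (F n) x \<partial>lebesgue_on T) = 0"
      by (rule zero[OF cF]) (use sub in auto)
    moreover have "AE x in lebesgue_on T. 0 \<le> r x * indicator (F n) x"
      using sub by (intro AE_I2) (auto simp: indicator_def)
    ultimately have "AE x in lebesgue_on T. r x * indicator (F n) x = 0"
      using integral_nonneg_eq_0_iff_AE[OF i] by simp
    then have "AE x in lebesgue_on T. x \<notin> F n"
      by eventually_elim (use sub in \<open>auto simp: indicator_def split: if_splits\<close>)
    then have "AE x in lebesgue. x \<in> T \<longrightarrow> x \<notin> F n"
      using T by (simp add: AE_restrict_space_iff)
    then have "AE x in lebesgue. x \<notin> F n"
      by eventually_elim (use sub UT in auto)
    then have "F n \<in> null_sets lebesgue"
      using cF by (subst AE_iff_null_sets) (auto intro: fmeasurableD lmeasurable_compact)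
    then show ?thesis by (simp add: negligible_iff_null_sets)
  qed
  then have "negligible C" unfolding CF by (intro negligible_countable_Union) auto
  then show ?thesis
    using N unfolding CN[symmetric] negligible_iff_null_sets by (rule null_sets.Un)
qed

text \<open>An integrable function with vanishing Fourier coefficients is orthogonal to trigonometric polynomials,
by Stone--Weierstrass to all continuous functions on the torus, and by dominated convergence to
indicators of closed sets. Hence its integral over every compact subset of the open cell vanishes, so
that it is 0 almost everywhere.\<close>

theorem fourier_uniqueness_cell:
  fixes g :: "real^'d \<Rightarrow> complex"
  assumes \<omega>: "\<And>j. \<omega> $ j \<noteq> 0" and g: "integrable (cell_measure \<omega>) g"
    and zero: "\<And>k. (\<integral>x. g x * cis (phase \<omega> k x) \<partial>cell_measure \<omega>) = 0"
  shows "AE x in cell_measure \<omega>. g x = 0"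
proof -
  let ?M = "cell_measure \<omega>" and ?e = "torus_embed \<omega>"
  have trig: "integrable ?M (\<lambda>x. g x * f x) \<and> (\<integral>x. g x * f x \<partial>?M) = 0" if "trig_poly \<omega> f" for f
    using that
  proof induction
    case (mono c k)
    show ?case
      using zero[of k] integrable_cell_mult_cis[OF g, of k]
      by (simp add: mult.left_commute[of "g _" c])
  next
    case (add f h)
    then show ?case by (simp add: distrib_left)
  qed
  \<comment> \<open>the embedded torus is compact, so that polynomials approximate uniformly there\<close>
  have cont: "(\<integral>x. g x * of_real (F (?e x)) \<partial>?M) = 0"
    if F: "continuous_on UNIV F" for F :: "complex^'d \<Rightarrow> real"
  proof -
    let ?S = "?e ` torus_cell \<omega>"
    have S: "compact ?S"
      by (rule compact_continuous_image[OF continuous_on_torus_embed compact_torus_cell])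
    have iF: "integrable ?M (\<lambda>x. g x * of_real (F (?e x)))"
    proof -
      have "bounded (F ` ?S)"
        by (rule compact_imp_bounded[OF compact_continuous_image[OF _ S]]) (rule continuous_on_subset[OF F], simp)
      then obtain C where C: "\<forall>y\<in>F ` ?S. norm y \<le> C" unfolding bounded_iff by blast
      show ?thesis
      proof (rule integrable_cell_mult_bounded[OF g])
        show "(\<lambda>x. complex_of_real (F (?e x))) \<in> borel_measurable ?M"
          by (intro measurable_cell_continuous continuous_intros
              continuous_on_compose2[OF F continuous_on_torus_embed]) auto
        show "norm (complex_of_real (F (?e x))) \<le> C" if "x \<in> torus_cell \<omega>" for x using C that by simp
      qed
    qed
    have "norm (\<integral>x. g x * of_real (F (?e x)) \<partial>?M) \<le> e * (\<integral>x. norm (g x) \<partial>?M)" if "e > 0" for e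
    proof -
      obtain P where P: "real_polynomial_function P" and FP: "\<And>z. z \<in> ?S \<Longrightarrow> \<bar>F z - P z\<bar> < e"
        by (rule Stone_Weierstrass_real_polynomial_function[OF S _ \<open>e > 0\<close>, of F])
           (auto intro: continuous_on_subset[OF F])
      note tP = trig[OF trig_poly_of_polynomial[OF P, of \<omega>]]
      have iFP: "integrable ?M (\<lambda>x. g x * of_real (F (?e x)) - g x * of_real (P (?e x)))"
        by (intro Bochner_Integration.integrable_diff iF conjunct1[OF tP])
      have "(\<integral>x. g x * of_real (F (?e x)) \<partial>?M) =
          (\<integral>x. g x * of_real (F (?e x)) - g x * of_real (P (?e x)) \<partial>?M)"
        using Bochner_Integration.integral_diff[OF iF conjunct1[OF tP]] tP by simp
      also have "norm \<dots> \<le>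
          (\<integral>x. norm (g x * of_real (F (?e x)) - g x * of_real (P (?e x))) \<partial>?M)"
        by (rule integral_norm_bound)
      also have "\<dots> \<le> (\<integral>x. e * norm (g x) \<partial>?M)"
      proof (rule Bochner_Integration.integral_mono[OF integrable_norm[OF iFP]])
        show "integrable ?M (\<lambda>x. e * norm (g x))" using g by simp
        fix x assume "x \<in> space ?M"
        then have "\<bar>F (?e x) - P (?e x)\<bar> \<le> e" using FP[of "?e x"] by (auto intro: less_imp_le)
        then have "norm (g x) * \<bar>F (?e x) - P (?e x)\<bar> \<le> norm (g x) * e"
          by (intro mult_left_mono) auto
        moreover have "norm (g x * of_real (F (?e x)) - g x * of_real (P (?e x))) =
            norm (g x) * \<bar>F (?e x) - P (?e x)\<bar>"
          by (simp only: right_diff_distrib[symmetric] of_real_diff[symmetric] norm_mult norm_of_real)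
        ultimately show "norm (g x * of_real (F (?e x)) - g x * of_real (P (?e x))) \<le> e * norm (g x)"
          by (simp add: mult.commute)
      qed
      finally show ?thesis by simp
    qed
    note bound = this
    have arith: "N = 0" if N: "\<And>e. e > 0 \<Longrightarrow> N \<le> e * G" "N \<ge> 0" "G \<ge> 0" for N G :: real
    proof (rule ccontr)
      assume "N \<noteq> 0"
      then have "N > 0" using N by simp
      then have "N / (2 * (G + 1)) > 0" using N(3) by simp
      then have "N \<le> N / (2 * (G + 1)) * G" by (rule N(1))
      also have "\<dots> < N" using \<open>N > 0\<close> N(3) mult_nonneg_nonneg[of G N] by (simp add: field_simps add_nonneg_pos)
      finally show False by simp
    qed
    show ?thesis
      using arith[OF bound norm_ge_zero] by simp
  qed
  \<comment> \<open>indicators of compact sets are limits of continuous functions of the embedded point; compact sets in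
    the open cell are determined by their image in the torus\<close>
  have compact_zero: "(\<integral>x. g x * of_real (indicator C x) \<partial>?M) = 0"
    if C: "compact C" and CU: "C \<subseteq> box 0 (\<chi> j. 2 * pi / \<bar>\<omega> $ j\<bar>)" for C
  proof (cases "C = {}")
    case True then show ?thesis by simp
  next
    case False
    let ?A = "?e ` C"
    have A: "closed ?A" "?A \<noteq> {}"
      using compact_imp_closed[OF compact_continuous_image[OF continuous_on_torus_embed C]] False by auto
    define F where "F n z = max 0 (1 - real n * infdist z ?A)" for n z
    have Fc: "continuous_on UNIV (F n)" for n
      unfolding F_def by (intro continuous_intros)
    have F_lim: "(\<lambda>n. F n z) \<longlonglongrightarrow> indicator ?A z" for z
    proof (cases "z \<in> ?A")
      case True
      then show ?thesis by (simp add: F_def)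
    next
      case False
      then have d: "infdist z ?A > 0" using A infdist_pos_not_in_closed by blast
      obtain N where N: "real N * infdist z ?A > 1" using reals_Archimedean3[OF d] by blast
      have "F n z = 0" if "n \<ge> N" for n
      proof -
        have "real N * infdist z ?A \<le> real n * infdist z ?A"
          using that d by (intro mult_right_mono) auto
        then show ?thesis using N by (simp add: F_def)
      qed
      then have "(\<lambda>n. F n z) \<longlonglongrightarrow> 0"
        by (intro tendsto_eventually) (auto simp: eventually_sequentially)
      then show ?thesis using False by simp
    qed
    have "(\<lambda>n. \<integral>x. g x * of_real (F n (?e x)) \<partial>?M) \<longlonglongrightarrow> (\<integral>x. g x * of_real (indicator ?A (?e x)) \<partial>?M)"
    proof (rule integral_dominated_convergence[where w="\<lambda>x. norm (g x)"])
      have gm: "g \<in> borel_measurable ?M" using g by measurable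
      have Fm: "(\<lambda>x. complex_of_real (F n (?e x))) \<in> borel_measurable ?M" for n
        by (intro measurable_cell_continuous continuous_intros
            continuous_on_compose2[OF Fc continuous_on_torus_embed]) auto
      show "(\<lambda>x. g x * of_real (F n (?e x))) \<in> borel_measurable ?M" for n
        by (rule borel_measurable_times[OF gm Fm])
      have "(\<lambda>x. complex_of_real (indicator ?A (?e x))) \<in> borel_measurable ?M"
        by (rule borel_measurable_LIMSEQ_metric[where f="\<lambda>n x. complex_of_real (F n (?e x))", OF Fm]) (intro tendsto_of_real F_lim)
      then show "(\<lambda>x. g x * of_real (indicator ?A (?e x))) \<in> borel_measurable ?M"
        by (rule borel_measurable_times[OF gm])
      show "integrable ?M (\<lambda>x. norm (g x))" using g by simp
      show "AE x in ?M. (\<lambda>n. g x * of_real (F n (?e x))) \<longlonglongrightarrow> g x * of_real (indicator ?A (?e x))"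
        by (intro AE_I2 tendsto_intros F_lim)
      show "AE x in ?M. norm (g x * of_real (F n (?e x))) \<le> norm (g x)" for n
      proof (rule AE_I2)
        fix x
        have "\<bar>F n (?e x)\<bar> \<le> 1" by (auto simp: F_def infdist_nonneg)
        then show "norm (g x * of_real (F n (?e x))) \<le> norm (g x)"
          by (simp add: norm_mult mult_left_le)
      qed
    qed
    then have "(\<integral>x. g x * of_real (indicator ?A (?e x)) \<partial>?M) = 0"
      using cont[OF Fc] by (simp add: LIMSEQ_const_iff)
    moreover have "(\<integral>x. g x * of_real (indicator ?A (?e x)) \<partial>?M) = (\<integral>x. g x * of_real (indicator C x) \<partial>?M)"
    proof (rule Bochner_Integration.integral_cong_AE)
      have gm: "g \<in> borel_measurable ?M" using g by measurable
      have "C \<in> sets ?M" using C CU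
        by (auto simp: cell_measure_def sets_restrict_space_iff torus_cell_sets torus_cell_def
            intro: fmeasurableD lmeasurable_compact dest: subsetD[OF box_subset_cbox])
      then have "(\<lambda>x. complex_of_real (indicator C x)) \<in> borel_measurable ?M" by measurable
      then show "(\<lambda>x. g x * of_real (indicator C x)) \<in> borel_measurable ?M"
        by (rule borel_measurable_times[OF gm])
      have "?e \<in> borel_measurable ?M" by (rule measurable_cell_continuous[OF continuous_on_torus_embed])
      moreover have "(indicator ?A :: _ \<Rightarrow> real) \<in> borel_measurable borel"
        by (rule borel_measurable_indicator) (use A(1) in simp)
      ultimately have "(\<lambda>x. indicator ?A (?e x) :: real) \<in> borel_measurable ?M"
        by (rule measurable_compose)
      then have "(\<lambda>x. complex_of_real (indicator ?A (?e x))) \<in> borel_measurable ?M" by measurable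
      then show "(\<lambda>x. g x * of_real (indicator ?A (?e x))) \<in> borel_measurable ?M"
        by (rule borel_measurable_times[OF gm])
      have "negligible (torus_cell \<omega> - box 0 (\<chi> j. 2 * pi / \<bar>\<omega> $ j\<bar>))"
        unfolding torus_cell_def by (rule negligible_frontier_interval)
      then have "AE x in lebesgue. x \<notin> torus_cell \<omega> - box 0 (\<chi> j. 2 * pi / \<bar>\<omega> $ j\<bar>)"
        unfolding negligible_iff_null_sets by (rule AE_not_in)
      then have "AE x in ?M. x \<in> box 0 (\<chi> j. 2 * pi / \<bar>\<omega> $ j\<bar>)"
        unfolding cell_measure_def by (subst AE_restrict_space_iff) (auto simp: torus_cell_sets elim: eventually_mono)
      then show "AE x in ?M. g x * of_real (indicator ?A (?e x)) = g x * of_real (indicator C x)"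
      proof eventually_elim
        case (elim x)
        have "?e x \<in> ?A \<longleftrightarrow> x \<in> C"
        proof
          assume "?e x \<in> ?A"
          then obtain y where y: "y \<in> C" "?e x = ?e y" by auto
          have "x = y"
            by (rule torus_embed_inj[OF _ _ \<omega> y(2)]) (use elim y CU in \<open>auto simp: mem_box_cart less_imp_le\<close>)
          then show "x \<in> C" using y by simp
        qed auto
        then show ?case by (simp add: indicator_def)
      qed
    qed
    ultimately show ?thesis by simp
  qed
  let ?U = "box 0 (\<chi> j. 2 * pi / \<bar>\<omega> $ j\<bar>)"
  have parts: "negligible {x\<in>?U. L (g x) > 0}"
    if L: "bounded_linear L" for L :: "complex \<Rightarrow> real"
  proof (rule positive_part_null_if_compact_integrals_zero[where T="torus_cell \<omega>"])
    show "integrable (lebesgue_on (torus_cell \<omega>)) (\<lambda>x. L (g x))"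
      using integrable_bounded_linear[OF L g] by (simp add: cell_measure_def)
    show "?U \<subseteq> torus_cell \<omega>" unfolding torus_cell_def by (rule box_subset_cbox)
    fix C :: "(real^'d) set" assume C: "compact C" "C \<subseteq> ?U"
    have Cs: "C \<in> sets ?M" using C
      by (auto simp: cell_measure_def sets_restrict_space_iff torus_cell_sets torus_cell_def
            intro: fmeasurableD lmeasurable_compact dest: subsetD[OF box_subset_cbox])
    have "(\<lambda>x. complex_of_real (indicator C x)) \<in> borel_measurable ?M"
      using Cs by measurable
    then have "integrable ?M (\<lambda>x. g x * of_real (indicator C x))"
      by (rule integrable_cell_mult_bounded[OF g, where C=1]) (auto simp: indicator_def)
    then have "(\<integral>x. L (g x * of_real (indicator C x)) \<partial>?M) = L (\<integral>x. g x * of_real (indicator C x) \<partial>?M)"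
      by (rule integral_bounded_linear[OF L])
    also have "\<dots> = 0" using compact_zero[OF C] by (simp add: linear_0[OF bounded_linear.linear[OF L]])
    also have "(\<integral>x. L (g x * of_real (indicator C x)) \<partial>?M) = (\<integral>x. L (g x) * indicator C x \<partial>?M)"
      by (rule Bochner_Integration.integral_cong) (auto simp: indicator_def linear_0[OF bounded_linear.linear[OF L]])
    finally show "(\<integral>x. L (g x) * indicator C x \<partial>lebesgue_on (torus_cell \<omega>)) = 0"
      by (simp add: cell_measure_def)
  qed (auto simp: torus_cell_sets)
  have "negligible (torus_cell \<omega> - ?U)"
    unfolding torus_cell_def by (rule negligible_frontier_interval)
  moreover have "negligible {x\<in>?U. Re (g x) > 0}" "negligible {x\<in>?U. - Re (g x) > 0}"
    "negligible {x\<in>?U. Im (g x) > 0}" "negligible {x\<in>?U. - Im (g x) > 0}"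
    by (intro parts bounded_linear_minus bounded_linear_Re bounded_linear_Im)+
  ultimately have "negligible ((torus_cell \<omega> - ?U) \<union> {x\<in>?U. Re (g x) > 0} \<union> {x\<in>?U. - Re (g x) > 0}
      \<union> {x\<in>?U. Im (g x) > 0} \<union> {x\<in>?U. - Im (g x) > 0})"
    by (intro negligible_Un)
  moreover have "{x\<in>torus_cell \<omega>. g x \<noteq> 0} \<subseteq> (torus_cell \<omega> - ?U) \<union> {x\<in>?U. Re (g x) > 0} \<union> {x\<in>?U. - Re (g x) > 0}
      \<union> {x\<in>?U. Im (g x) > 0} \<union> {x\<in>?U. - Im (g x) > 0}"
    by (auto simp: complex_eq_iff)
  ultimately have "negligible {x\<in>torus_cell \<omega>. g x \<noteq> 0}" by (rule negligible_subset)
  then have "AE x in lebesgue. x \<notin> {x\<in>torus_cell \<omega>. g x \<noteq> 0}"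
    unfolding negligible_iff_null_sets by (rule AE_not_in)
  then show ?thesis
    unfolding cell_measure_def by (subst AE_restrict_space_iff) (auto simp: torus_cell_sets elim: eventually_mono)
qed

section \<open>From the fundamental cell to the whole space\<close>

lemma torus_periodic_int:
  assumes "torus_periodic \<omega> u"
  shows "u (x + axis j (of_int m * (2 * pi / \<omega> $ j))) = u x"
proof -
  let ?P = "2 * pi / \<omega> $ j"
  have nat: "u (x + axis j (of_nat n * ?P)) = u x" for n x
  proof (induction n)
    case 0
    have "x + axis j (of_nat 0 * ?P) = x" by (simp add: vec_eq_iff axis_def)
    then show ?case by (rule arg_cong[of _ _ u])
  next
    case (Suc n)
    have step: "x + axis j (of_nat (Suc n) * P) = (x + axis j (of_nat n * P)) + axis j P" for P :: real
      by (auto simp: vec_eq_iff axis_def algebra_simps)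
    have "u (y + axis j ?P) = u y" for y using assms by (auto simp: torus_periodic_def)
    then show ?case using Suc by (simp only: step)
  qed
  show ?thesis
  proof (cases m)
    case (nonneg n)
    then show ?thesis using nat by simp
  next
    case (neg n)
    have eq: "(x + axis j (of_int m * P)) + axis j (of_nat (Suc n) * P) = x" for P :: real
      by (auto simp: vec_eq_iff axis_def neg algebra_simps)
    show ?thesis using nat[of "x + axis j (of_int m * ?P)" "Suc n"] unfolding eq by simp
  qed
qed

definition lattice_shift :: "real^'d \<Rightarrow> int^'d \<Rightarrow> real^'d" where
  "lattice_shift \<omega> m = (\<chi> j. of_int (m $ j) * (2 * pi / \<omega> $ j))"

lemma torus_periodic_lattice:
  assumes u: "torus_periodic \<omega> u"
  shows "u (x + lattice_shift \<omega> m) = u x"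
proof -
  have "u (x + (\<Sum>j\<in>F. axis j (of_int (m $ j) * (2 * pi / \<omega> $ j)))) = u x" if "finite F" for F
    using that
  proof (induction F)
    case (insert i F)
    have "x + (\<Sum>j\<in>insert i F. axis j (of_int (m $ j) * (2 * pi / \<omega> $ j))) =
      (x + (\<Sum>j\<in>F. axis j (of_int (m $ j) * (2 * pi / \<omega> $ j)))) + axis i (of_int (m $ i) * (2 * pi / \<omega> $ i))"
      using insert by (simp add: algebra_simps)
    then show ?case using insert.IH by (simp only: torus_periodic_int[OF u])
  qed simp
  moreover have "lattice_shift \<omega> m = (\<Sum>j\<in>UNIV. axis j (of_int (m $ j) * (2 * pi / \<omega> $ j)))"
    by (auto simp: vec_eq_iff lattice_shift_def axis_def)
  ultimately show ?thesis by simp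
qed

text \<open>The set where two periodic functions differ is covered by countably many translates of its part in the
fundamental cell.\<close>

lemma torus_AE_eq_if_cell_AE_eq:
  fixes u v :: "real^'d \<Rightarrow> complex"
  assumes \<omega>: "\<And>j. \<omega> $ j \<noteq> 0" and u: "torus_periodic \<omega> u" and v: "torus_periodic \<omega> v"
    and eq: "AE x in cell_measure \<omega>. u x = v x"
  shows "AE x in lebesgue. u x = v x"
proof -
  let ?N = "{x\<in>torus_cell \<omega>. u x \<noteq> v x}"
  have "AE x in lebesgue. x \<in> torus_cell \<omega> \<longrightarrow> u x = v x"
    using eq unfolding cell_measure_def by (subst (asm) AE_restrict_space_iff) (auto simp: torus_cell_sets)
  then have "\<exists>Z\<in>null_sets lebesgue. {x\<in>space lebesgue. \<not> (x \<in> torus_cell \<omega> \<longrightarrow> u x = v x)} \<subseteq> Z"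
    by (simp only: eventually_ae_filter)
  then obtain Z where Z: "Z \<in> null_sets lebesgue"
    and sub: "{x\<in>space lebesgue. \<not> (x \<in> torus_cell \<omega> \<longrightarrow> u x = v x)} \<subseteq> Z" ..
  have "?N \<subseteq> Z" using sub by simp
  then have "negligible ?N"
    using Z negligible_subset unfolding negligible_iff_null_sets[symmetric] by metis
  then have "negligible (\<Union>m. (+) (lattice_shift \<omega> m) ` ?N)"
    by (intro negligible_countable_Union) (auto intro: negligible_translation)
  moreover have "{x. u x \<noteq> v x} \<subseteq> (\<Union>m. (+) (lattice_shift \<omega> m) ` ?N)"
  proof
    fix x assume x: "x \<in> {x. u x \<noteq> v x}"
    \<comment> \<open>the periods \<open>2 * pi / \<omega> $ j\<close> may be negative, the sides of the cell are not\<close>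
    define s where "s j = (if \<omega> $ j > 0 then 1 else -1 :: int)" for j
    define n where "n j = \<lfloor>x $ j / (2 * pi / \<bar>\<omega> $ j\<bar>)\<rfloor>" for j
    define m where "m = (\<chi> j. s j * n j)"
    define y where "y = x - lattice_shift \<omega> m"
    have "0 \<le> y $ j \<and> y $ j \<le> 2 * pi / \<bar>\<omega> $ j\<bar>" for j
    proof -
      have p: "2 * pi / \<bar>\<omega> $ j\<bar> > 0" using \<omega>[of j] by simp
      have "lattice_shift \<omega> m $ j = of_int (n j) * (2 * pi / \<bar>\<omega> $ j\<bar>)"
        using \<omega>[of j] by (simp add: lattice_shift_def m_def s_def abs_if)
      moreover have "of_int (n j) \<le> x $ j / (2 * pi / \<bar>\<omega> $ j\<bar>)" "x $ j / (2 * pi / \<bar>\<omega> $ j\<bar>) \<le> of_int (n j) + 1"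
        unfolding n_def by linarith+
      then have "of_int (n j) * (2 * pi / \<bar>\<omega> $ j\<bar>) \<le> x $ j" "x $ j \<le> (of_int (n j) + 1) * (2 * pi / \<bar>\<omega> $ j\<bar>)"
        unfolding le_divide_eq[of _ "x $ j"] divide_le_eq[of "x $ j"] using p by auto
      ultimately show ?thesis
        unfolding y_def vector_minus_component distrib_right mult_1 by linarith
    qed
    then have "y \<in> torus_cell \<omega>" by (simp add: torus_cell_def mem_box_cart)
    moreover have xy: "x = y + lattice_shift \<omega> m" by (simp add: y_def)
    then have "u y = u x" "v y = v x" using torus_periodic_lattice[OF u] torus_periodic_lattice[OF v] by auto
    ultimately have "y \<in> ?N" using x by simp
    then show "x \<in> (\<Union>m. (+) (lattice_shift \<omega> m) ` ?N)" using xy by (auto simp: add.commute)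
  qed
  ultimately have "negligible {x. u x \<noteq> v x}" by (rule negligible_subset)
  then have "{x. u x \<noteq> v x} \<in> null_sets lebesgue" by (simp add: negligible_iff_null_sets)
  from AE_not_in[OF this] show ?thesis by simp
qed

section \<open>The Wiener algebra as a space of sequences\<close>

lemma index_norm_0 [simp]: "index_norm 0 = 0"
  by (simp add: index_norm_def)

lemma index_norm_add: "index_norm (k + l) \<le> index_norm k + index_norm l"
  unfolding index_norm_def sum.distrib[symmetric] by (intro sum_mono) auto

locale torus_wiener =
  fixes \<omega> :: "real^'d" and \<nu> :: real
  assumes \<omega>_nz: "\<And>j. \<omega> $ j \<noteq> 0" and \<nu>_ge1: "\<nu> \<ge> 1"

sublocale torus_wiener \<subseteq> beurling_weight "\<lambda>k :: int^'d. \<nu> ^ index_norm k"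
proof
  show "\<nu> ^ index_norm (k + l) \<le> \<nu> ^ index_norm k * \<nu> ^ index_norm l" for k l :: "int^'d"
    unfolding power_add[symmetric] by (rule power_increasing[OF index_norm_add \<nu>_ge1])
qed (use \<nu>_ge1 in \<open>auto intro: one_le_power\<close>)

context torus_wiener begin

abbreviation wt :: "int^'d \<Rightarrow> real" where "wt k \<equiv> \<nu> ^ index_norm k"

text \<open>Mutually inverse up to null sets: the function with given weighted Fourier coefficients, and the
weighted Fourier coefficients of a given element of the Wiener algebra.\<close>

definition fourier_sum :: "(int^'d) ell1 \<Rightarrow> real^'d \<Rightarrow> complex" where
  "fourier_sum A x = eval_at (\<lambda>k. cis (phase \<omega> k x)) A"

definition fourier_seq :: "(real^'d \<Rightarrow> complex) \<Rightarrow> (int^'d) ell1" where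
  "fourier_seq u = Ell1 (\<lambda>k. fourier_coeff \<omega> u k * wt k)"

lemma character_cis: "character (\<lambda>k. cis (phase \<omega> k x))"
  by (simp add: character_def phase_add_left cis_mult)

lemmas norm_fourier_sum_le = norm_eval_at_le[OF character_cis, folded fourier_sum_def]
  and fourier_sum_conv = eval_at_conv[OF character_cis, folded fourier_sum_def]
  and fourier_sum_conv_pow = eval_at_conv_pow[OF character_cis, folded fourier_sum_def]
  and fourier_sum_cscale = eval_at_cscale[OF character_cis, folded fourier_sum_def]
  and fourier_sum_unit = eval_at_unit[OF character_cis, folded fourier_sum_def]

lemma bounded_linear_fourier_sum: "bounded_linear (\<lambda>A. fourier_sum A x)"
  unfolding fourier_sum_def by (rule bounded_linear_eval_at[OF character_cis])

lemma \<nu>_nz [simp]: "\<nu> \<noteq> 0"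
  using \<nu>_ge1 by auto

lemma norm_wt [simp]: "cmod (complex_of_real \<nu> ^ n) = \<nu> ^ n"
  using \<nu>_ge1 by (simp add: norm_power)

lemma fourier_sum_linear:
  "fourier_sum (A + B) x = fourier_sum A x + fourier_sum B x" "fourier_sum (A - B) x = fourier_sum A x - fourier_sum B x" "fourier_sum 0 x = 0"
  "fourier_sum (\<Sum>i\<in>I. f i) x = (\<Sum>i\<in>I. fourier_sum (f i) x)"
proof -
  interpret bounded_linear "\<lambda>A. fourier_sum A x" by (rule bounded_linear_fourier_sum)
  show "fourier_sum (A + B) x = fourier_sum A x + fourier_sum B x" "fourier_sum (A - B) x = fourier_sum A x - fourier_sum B x" "fourier_sum 0 x = 0"
    "fourier_sum (\<Sum>i\<in>I. f i) x = (\<Sum>i\<in>I. fourier_sum (f i) x)"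
    by (rule add diff zero sum)+
qed

lemma fourier_sum_periodic: "torus_periodic \<omega> (fourier_sum A)"
proof -
  have "cis (phase \<omega> k (x + axis j (2 * pi / \<omega> $ j))) = cis (phase \<omega> k x)" for k x j
  proof -
    have "phase \<omega> k (axis j (2 * pi / \<omega> $ j)) = (\<Sum>i\<in>UNIV. if i = j then 2 * pi * of_int (k $ i) else 0)"
      unfolding phase_def by (rule sum.cong) (auto simp: axis_def \<omega>_nz)
    then have "cis (phase \<omega> k (axis j (2 * pi / \<omega> $ j))) = 1"
      by simp
    moreover have "phase \<omega> k (x + y) = phase \<omega> k x + phase \<omega> k y" for y
      by (simp add: phase_inner inner_right_distrib)
    ultimately show ?thesis by (simp add: cis_mult[symmetric])
  qed
  then show ?thesis by (simp add: torus_periodic_def fourier_sum_def)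
qed

lemma continuous_on_fourier_sum: "continuous_on S (fourier_sum A)"
proof (induction A rule: ell1_induct)
  case (closed X A)
  have "uniform_limit S (\<lambda>n x. fourier_sum (X n) x) (fourier_sum A) sequentially"
  proof (rule uniform_limitI)
    fix e :: real assume "e > 0"
    then have "\<forall>\<^sub>F n in sequentially. dist (X n) A < e" using closed(2) by (auto simp: tendsto_iff)
    then show "\<forall>\<^sub>F n in sequentially. \<forall>x\<in>S. dist (fourier_sum (X n) x) (fourier_sum A x) < e"
    proof eventually_elim
      case (elim n)
      then show ?case
        using norm_fourier_sum_le[where A="X n - A"] by (auto simp: dist_norm fourier_sum_linear intro: le_less_trans)
    qed
  qed
  then show ?case
    by (rule uniform_limit_theorem[rotated]) (use closed in \<open>auto intro!: always_eventually\<close>)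
next
  case zero
  have "fourier_sum 0 = (\<lambda>_. 0)" by (simp add: fun_eq_iff fourier_sum_linear)
  then show ?case by simp
next
  case (add A k c)
  have "fourier_sum (A + cscale c (unit k)) = (\<lambda>x. fourier_sum A x + c * (cis (phase \<omega> k x) / wt k))"
    by (simp add: fun_eq_iff fourier_sum_linear fourier_sum_cscale fourier_sum_unit)
  then show ?case
    by (auto intro!: continuous_intros continuous_on_cis_phase add simp: \<nu>_ge1)
qed

lemma measurable_fourier_sum: "fourier_sum A \<in> borel_measurable (cell_measure \<omega>)"
  by (rule measurable_cell_continuous[OF continuous_on_fourier_sum])

lemma integrable_fourier_sum: "integrable (cell_measure \<omega>) (fourier_sum A)"
  by (rule integrable_cell_bounded[OF measurable_fourier_sum norm_fourier_sum_le])

lemma fourier_sum_L1: "fourier_sum A \<in> torus_L1 \<omega>"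
  by (simp add: torus_L1_iff fourier_sum_periodic integrable_fourier_sum)

lemma fourier_coeff_add:
  assumes "integrable (cell_measure \<omega>) u" "integrable (cell_measure \<omega>) v"
  shows "fourier_coeff \<omega> (\<lambda>x. u x + v x) k = fourier_coeff \<omega> u k + fourier_coeff \<omega> v k"
    and "fourier_coeff \<omega> (\<lambda>x. u x - v x) k = fourier_coeff \<omega> u k - fourier_coeff \<omega> v k"
  unfolding fourier_coeff_eq
  using integrable_cell_mult_cis[OF assms(1)] integrable_cell_mult_cis[OF assms(2)]
  by (simp_all add: algebra_simps add_divide_distrib diff_divide_distrib)

lemma fourier_coeff_cong_AE:
  assumes u: "u \<in> borel_measurable (cell_measure \<omega>)" and v: "v \<in> borel_measurable (cell_measure \<omega>)"
    and eq: "AE x in cell_measure \<omega>. u x = v x"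
  shows "fourier_coeff \<omega> u k = fourier_coeff \<omega> v k"
proof -
  have c: "(\<lambda>x. cis (phase \<omega> (- k) x)) \<in> borel_measurable (cell_measure \<omega>)"
    by (rule measurable_cell_continuous[OF continuous_on_cis_phase])
  have "(\<integral>x. u x * cis (phase \<omega> (- k) x) \<partial>cell_measure \<omega>) = (\<integral>x. v x * cis (phase \<omega> (- k) x) \<partial>cell_measure \<omega>)"
    by (rule Bochner_Integration.integral_cong_AE[OF borel_measurable_times[OF u c] borel_measurable_times[OF v c]])
       (use eq in auto)
  then show ?thesis by (simp add: fourier_coeff_eq)
qed

lemma AE_cell: "AE x in lebesgue. P x \<Longrightarrow> AE x in cell_measure \<omega>. P x"
  unfolding cell_measure_def by (subst AE_restrict_space_iff) (auto simp: torus_cell_sets)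

lemma norm_fourier_coeff_le:
  assumes h: "h \<in> borel_measurable (cell_measure \<omega>)" and C: "\<And>x. norm (h x) \<le> C"
  shows "norm (fourier_coeff \<omega> h k) \<le> C"
proof -
  interpret finite_measure "cell_measure \<omega>" by (rule finite_cell_measure)
  let ?V = "measure lebesgue (torus_cell \<omega>)"
  have V: "?V > 0" by (rule measure_torus_cell_pos) (rule \<omega>_nz)
  have i: "integrable (cell_measure \<omega>) (\<lambda>x. h x * cis (phase \<omega> (- k) x))"
    by (rule integrable_cell_mult_cis[OF integrable_cell_bounded[OF h C]])
  have "norm (\<integral>x. h x * cis (phase \<omega> (- k) x) \<partial>cell_measure \<omega>) \<le>
      (\<integral>x. norm (h x * cis (phase \<omega> (- k) x)) \<partial>cell_measure \<omega>)"
    by (rule integral_norm_bound)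
  also have "\<dots> \<le> (\<integral>x. C \<partial>cell_measure \<omega>)"
    by (rule Bochner_Integration.integral_mono[OF integrable_norm[OF i]]) (auto simp: norm_mult C)
  also have "\<dots> = C * ?V"
    by (simp add: cell_measure_def measure_restrict_space torus_cell_sets mult.commute)
  finally show ?thesis
    using V by (simp add: fourier_coeff_eq norm_divide divide_le_eq)
qed

text \<open>Both sides are bounded linear functionals of \<open>A\<close>; on unit vectors they agree by orthogonality.\<close>

lemma fourier_coeff_fourier_sum: "fourier_coeff \<omega> (fourier_sum A) k = coef A k / wt k"
proof (induction A rule: ell1_induct)
  case (closed X A)
  have le: "norm (fourier_coeff \<omega> (fourier_sum (X n)) k - fourier_coeff \<omega> (fourier_sum A) k) \<le> norm (X n - A)" for n
  proof -
    have "fourier_sum (X n - A) = (\<lambda>x. fourier_sum (X n) x - fourier_sum A x)" by (simp add: fun_eq_iff fourier_sum_linear)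
    then have "fourier_coeff \<omega> (fourier_sum (X n)) k - fourier_coeff \<omega> (fourier_sum A) k = fourier_coeff \<omega> (fourier_sum (X n - A)) k"
      by (simp add: fourier_coeff_add(2)[OF integrable_fourier_sum integrable_fourier_sum])
    then show ?thesis using norm_fourier_coeff_le[OF measurable_fourier_sum norm_fourier_sum_le] by simp
  qed
  have "(\<lambda>n. norm (X n - A)) \<longlonglongrightarrow> 0"
    by (rule tendsto_norm_zero[OF LIM_zero[OF closed(2)]])
  then have "(\<lambda>n. fourier_coeff \<omega> (fourier_sum (X n)) k - fourier_coeff \<omega> (fourier_sum A) k) \<longlonglongrightarrow> 0"
    by (rule Lim_null_comparison[OF always_eventually, rotated]) (simp add: le)
  then have 1: "(\<lambda>n. fourier_coeff \<omega> (fourier_sum (X n)) k) \<longlonglongrightarrow> fourier_coeff \<omega> (fourier_sum A) k"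
    by (rule LIM_zero_cancel)
  have "(\<lambda>n. coef (X n) k / wt k) \<longlonglongrightarrow> coef A k / wt k"
    using weight_nz[of k]
    by (intro tendsto_intros bounded_linear.tendsto[OF bounded_linear_coef closed(2)]) auto
  then show ?case using LIMSEQ_unique[OF 1] unfolding closed(1) by blast
next
  case zero
  have "fourier_sum 0 = (\<lambda>_. 0)" by (simp add: fun_eq_iff fourier_sum_linear)
  then show ?case by (simp add: fourier_coeff_eq)
next
  case (add A l c)
  have V: "measure lebesgue (torus_cell \<omega>) > 0" by (rule measure_torus_cell_pos) (rule \<omega>_nz)
  have "fourier_coeff \<omega> (fourier_sum (cscale c (unit l))) k = coef (cscale c (unit l)) k / wt k"
  proof -
    have "fourier_sum (cscale c (unit l)) x * cis (phase \<omega> (- k) x) = c / wt l * cis (phase \<omega> (l - k) x)" for x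
      using phase_add_left[of \<omega> l "- k" x] by (simp add: fourier_sum_cscale fourier_sum_unit cis_mult)
    then show ?thesis using V
      by (simp add: fourier_coeff_eq integral_cell_cis[OF \<omega>_nz])
  qed
  moreover have "fourier_sum (A + cscale c (unit l)) = (\<lambda>x. fourier_sum A x + fourier_sum (cscale c (unit l)) x)"
    by (simp add: fun_eq_iff fourier_sum_linear)
  ultimately show ?case
    using add by (simp add: fourier_coeff_add(1)[OF integrable_fourier_sum integrable_fourier_sum] add_divide_distrib)
qed

lemma fourier_sum_wiener: "fourier_sum A \<in> wiener_algebra \<omega> \<nu>"
  and wiener_norm_fourier_sum: "wiener_norm \<omega> \<nu> (fourier_sum A) = norm A"
  and fourier_seq_fourier_sum: "fourier_seq (fourier_sum A) = A"
proof -
  have eq: "cmod (fourier_coeff \<omega> (fourier_sum A) k) * wt k = norm (coef A k)" for k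
    using weight_pos[of k] by (simp add: fourier_coeff_fourier_sum norm_divide)
  show "fourier_sum A \<in> wiener_algebra \<omega> \<nu>" by (simp add: wiener_algebra_def fourier_sum_L1 eq coef_summable)
  show "wiener_norm \<omega> \<nu> (fourier_sum A) = norm A" by (simp add: wiener_norm_def eq norm_ell1_eq)
  show "fourier_seq (fourier_sum A) = A" unfolding fourier_seq_def fourier_coeff_fourier_sum
    using weight_nz by (simp add: coef_inverse)
qed

text \<open>Identities in the convolution algebra may thus be verified pointwise, by ordinary algebra of complex
numbers.\<close>

lemma fourier_sum_eqD: "(\<And>x. fourier_sum A x = fourier_sum B x) \<Longrightarrow> A = B"
  by (metis fourier_seq_fourier_sum ext)

lemma
  assumes u: "u \<in> wiener_algebra \<omega> \<nu>"
  shows coef_fourier_seq: "coef (fourier_seq u) k = fourier_coeff \<omega> u k * wt k"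
    and wiener_integrable: "integrable (cell_measure \<omega>) u"
    and fourier_sum_fourier_seq_AE: "AE x in lebesgue. u x = fourier_sum (fourier_seq u) x"
proof -
  show i: "integrable (cell_measure \<omega>) u"
    using u by (simp add: wiener_algebra_def torus_L1_iff)
  have p: "torus_periodic \<omega> u"
    using u by (simp add: wiener_algebra_def torus_L1_iff)
  have eq: "norm (fourier_coeff \<omega> u k * wt k) = cmod (fourier_coeff \<omega> u k) * wt k" for k
    using weight_pos[of k] by (simp add: norm_mult)
  have c: "coef (fourier_seq u) = (\<lambda>k. fourier_coeff \<omega> u k * wt k)"
    unfolding fourier_seq_def by (rule coef_Ell1) (use u in \<open>simp add: wiener_algebra_def norm_mult\<close>)
  then show "coef (fourier_seq u) k = fourier_coeff \<omega> u k * wt k" by simp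
  have V: "measure lebesgue (torus_cell \<omega>) > 0" by (rule measure_torus_cell_pos) (rule \<omega>_nz)
  have "AE x in cell_measure \<omega>. u x - fourier_sum (fourier_seq u) x = 0"
  proof (rule fourier_uniqueness_cell[OF \<omega>_nz])
    show "integrable (cell_measure \<omega>) (\<lambda>x. u x - fourier_sum (fourier_seq u) x)"
      by (intro Bochner_Integration.integrable_diff i integrable_fourier_sum)
    fix k
    have "fourier_coeff \<omega> (\<lambda>x. u x - fourier_sum (fourier_seq u) x) (- k) = 0"
      using weight_nz[of "- k"] by (simp add: fourier_coeff_add(2)[OF i integrable_fourier_sum] fourier_coeff_fourier_sum c)
    then show "(\<integral>x. (u x - fourier_sum (fourier_seq u) x) * cis (phase \<omega> k x) \<partial>cell_measure \<omega>) = 0"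
      using V by (simp add: fourier_coeff_eq)
  qed
  then show "AE x in lebesgue. u x = fourier_sum (fourier_seq u) x"
    by (intro torus_AE_eq_if_cell_AE_eq[OF \<omega>_nz p fourier_sum_periodic]) auto
qed

lemma wiener_norm_fourier_seq: "u \<in> wiener_algebra \<omega> \<nu> \<Longrightarrow> wiener_norm \<omega> \<nu> u = norm (fourier_seq u)"
  using weight_pos by (simp add: wiener_norm_def norm_ell1_eq coef_fourier_seq norm_mult abs_of_pos)

lemma wiener_norm_diff:
  assumes "u \<in> wiener_algebra \<omega> \<nu>" "v \<in> wiener_algebra \<omega> \<nu>"
  shows "wiener_norm \<omega> \<nu> (\<lambda>x. u x - v x) = norm (fourier_seq u - fourier_seq v)"
  using weight_pos
  by (simp add: wiener_norm_def norm_ell1_eq coef_fourier_seq[OF assms(1)] coef_fourier_seq[OF assms(2)]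
      fourier_coeff_add(2)[OF wiener_integrable[OF assms(1)] wiener_integrable[OF assms(2)]]
      left_diff_distrib[symmetric] norm_mult abs_of_pos)

text \<open>An element of the Wiener algebra agrees almost everywhere with its Fourier sum, which turns convolution
powers into pointwise powers.\<close>

lemma fourier_coeff_power:
  assumes "u \<in> wiener_algebra \<omega> \<nu>"
  shows "fourier_coeff \<omega> (\<lambda>x. u x ^ n) k = coef (conv_pow (fourier_seq u) n) k / wt k"
proof -
  have um: "u \<in> borel_measurable (cell_measure \<omega>)"
    using wiener_integrable[OF assms] by (rule borel_measurable_integrable)
  have "fourier_coeff \<omega> (\<lambda>x. u x ^ n) k = fourier_coeff \<omega> (fourier_sum (conv_pow (fourier_seq u) n)) k"
  proof (rule fourier_coeff_cong_AE[OF borel_measurable_power[OF um] measurable_fourier_sum])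
    show "AE x in cell_measure \<omega>. u x ^ n = fourier_sum (conv_pow (fourier_seq u) n) x"
      using AE_cell[OF fourier_sum_fourier_seq_AE[OF assms]] by eventually_elim (simp add: fourier_sum_conv_pow)
  qed
  then show ?thesis by (simp add: fourier_coeff_fourier_sum)
qed

end

section \<open>The Schroedinger equation for Fourier coefficients\<close>

lemma cis_has_vector_derivative:
  "((\<lambda>s. cis (c * s)) has_vector_derivative \<i> * c * cis (c * s)) (at s within S)"
proof -
  have "((\<lambda>s. exp (\<i> * c * of_real s)) has_vector_derivative \<i> * c * exp (\<i> * c * of_real s)) (at s within S)"
    by (auto intro!: derivative_eq_intros has_vector_derivative_real_field)
  then show ?thesis by (simp add: cis_conv_exp mult.assoc)
qed

text \<open>Differentiability of each coefficient is much weaker than differentiability in norm. It suffices if the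
derivatives form a norm continuous curve: its integral then has the same coefficients up to additive
constants.\<close>

lemma ell1_derivative_from_coef:
  fixes D :: "real \<Rightarrow> 'k ell1"
  assumes g: "continuous_on {0..T} g"
    and der: "\<And>k s. s \<in> {0..T} \<Longrightarrow>
      ((\<lambda>s. coef (D s) k) has_vector_derivative coef (g s) k) (at s within {0..T})"
    and s: "s \<in> {0..T}"
  shows "(D has_vector_derivative g s) (at s within {0..T})"
proof -
  define G where "G s = D 0 + integral {0..s} g" for s
  have Gder: "(G has_vector_derivative g s) (at s within {0..T})" if "s \<in> {0..T}" for s
    unfolding G_def
    by (auto intro!: derivative_eq_intros integral_has_vector_derivative[OF g that])
  have eq: "D s = G s" if s: "s \<in> {0..T}" for s
  proof (rule ell1_eqI)
    fix k
    have "((\<lambda>s. coef (D s) k - coef (G s) k) has_vector_derivative coef (g s) k - coef (g s) k) (at s within {0..T})"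
      if "s \<in> {0..T}" for s
      by (intro has_vector_derivative_diff der that
          bounded_linear.has_vector_derivative[OF bounded_linear_coef Gder])
    then have zero: "((\<lambda>s. coef (D s) k - coef (G s) k) has_vector_derivative 0) (at s within {0..T})"
      if "s \<in> {0..T}" for s using that by simp
    have "coef (D s) k - coef (G s) k = coef (D 0) k - coef (G 0) k"
    proof (rule has_vector_derivative_zero_constant[OF convex_real_interval(5) zero])
      fix c assume c: "\<And>s. s \<in> {0..T} \<Longrightarrow> coef (D s) k - coef (G s) k = c"
      show ?thesis using c[of 0] c[OF s] s by simp
    qed
    moreover have "G 0 = D 0" by (simp add: G_def)
    ultimately show "coef (D s) k = coef (G s) k" by simp
  qed
  show ?thesis
    by (rule has_vector_derivative_transform[OF s eq Gder[OF s]])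
qed

context torus_wiener begin

definition laplace_symbol :: "int^'d \<Rightarrow> real" where "laplace_symbol k = (\<Sum>j\<in>UNIV. (of_int (k $ j) * \<omega> $ j)\<^sup>2)"

text \<open>The propagator \<open>exp (\<i> * t * \<triangle>)\<close> of the free equation. It preserves the norm and, unlike the
Laplacian, is defined on the whole space.\<close>

definition flow :: "real \<Rightarrow> (int^'d) ell1 \<Rightarrow> (int^'d) ell1" where
  "flow t = diag (\<lambda>k. cis (- (laplace_symbol k * t)))"

lemma coef_flow: "coef (flow t A) k = cis (- (laplace_symbol k * t)) * coef A k"
  unfolding flow_def by (rule coef_diag[where C=1]) simp

lemma norm_flow [simp]: "norm (flow t A) = norm A"
  unfolding norm_ell1_eq coef_flow by (simp add: norm_mult)

lemma flow_diff: "flow t A - flow t B = flow t (A - B)"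
  by (rule ell1_eqI) (simp add: coef_flow algebra_simps)

lemma flow_inverse [simp]: "flow t (flow (- t) A) = A" "flow (- t) (flow t A) = A"
  by (rule ell1_eqI, simp add: coef_flow flip: mult.assoc, simp add: cis_mult)+

lemma flow_0 [simp]: "flow 0 A = A"
  by (rule ell1_eqI) (simp add: coef_flow)

lemma continuous_on_flow:
  assumes "continuous_on S \<theta>" "continuous_on S A"
  shows "continuous_on S (\<lambda>t. flow (\<theta> t) (A t))"
  unfolding flow_def by (rule continuous_on_diag) (auto intro!: continuous_intros assms)

text \<open>The right-hand side for a single coefficient; it need not be the coefficient of a summable family.\<close>

definition nls_rhs :: "nat \<Rightarrow> (int^'d) ell1 \<Rightarrow> int^'d \<Rightarrow> complex" where
  "nls_rhs p A k = \<i> * (- complex_of_real (laplace_symbol k) * coef A k + coef (conv_pow A p) k)"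

lemma nls_solution_fourier_seq:
  assumes u: "nls_solution \<omega> \<nu> p w I u"
  shows "continuous_on I (\<lambda>t. fourier_seq (u t))"
    and "t \<in> I \<Longrightarrow> ((\<lambda>s. coef (fourier_seq (u s)) k) has_vector_derivative nls_rhs p (fourier_seq (u t)) k) (at t within I)"
proof -
  have W: "u t \<in> wiener_algebra \<omega> \<nu>" if "t \<in> I" for t
    using u that by (simp add: nls_solution_def)
  show "continuous_on I (\<lambda>t. fourier_seq (u t))"
  proof (clarsimp simp: continuous_on_def)
    fix t assume t: "t \<in> I"
    have "((\<lambda>s. wiener_norm \<omega> \<nu> (\<lambda>x. u s x - u t x)) \<longlongrightarrow> 0) (at t within I)"
      using u t by (simp add: nls_solution_def)
    then have "((\<lambda>s. norm (fourier_seq (u s) - fourier_seq (u t))) \<longlongrightarrow> 0) (at t within I)"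
      by (rule Lim_transform_eventually)
         (auto simp: eventually_at_filter wiener_norm_diff W t intro!: always_eventually)
    then show "((\<lambda>t. fourier_seq (u t)) \<longlongrightarrow> fourier_seq (u t)) (at t within I)"
      by (rule LIM_zero_cancel[OF tendsto_norm_zero_cancel])
  qed
  assume t: "t \<in> I"
  have "((\<lambda>s. fourier_coeff \<omega> (u s) k) has_vector_derivative
         \<i> * (- complex_of_real (laplace_symbol k) * fourier_coeff \<omega> (u t) k
              + fourier_coeff \<omega> (\<lambda>x. u t x ^ p) k)) (at t within I)"
    using u t by (simp add: nls_solution_def laplace_symbol_def)
  then have "((\<lambda>s. fourier_coeff \<omega> (u s) k * wt k) has_vector_derivative
         \<i> * (- complex_of_real (laplace_symbol k) * fourier_coeff \<omega> (u t) k
              + fourier_coeff \<omega> (\<lambda>x. u t x ^ p) k) * wt k) (at t within I)"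
    by (rule has_vector_derivative_mult_left)
  also have "\<i> * (- complex_of_real (laplace_symbol k) * fourier_coeff \<omega> (u t) k
              + fourier_coeff \<omega> (\<lambda>x. u t x ^ p) k) * wt k = nls_rhs p (fourier_seq (u t)) k"
    by (simp add: nls_rhs_def coef_fourier_seq[OF W[OF t]] fourier_coeff_power[OF W[OF t]] algebra_simps)
  finally show "((\<lambda>s. coef (fourier_seq (u s)) k) has_vector_derivative nls_rhs p (fourier_seq (u t)) k) (at t within I)"
    by (rule has_vector_derivative_transform[OF t, rotated]) (simp add: coef_fourier_seq[OF W])
qed

lemma nls_solution_fourier_sum:
  assumes cont: "continuous_on I U"
    and der: "\<And>t k. t \<in> I \<Longrightarrow> ((\<lambda>s. coef (U s) k) has_vector_derivative nls_rhs p (U t) k) (at t within I)"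
    and init: "AE x in lebesgue. fourier_sum (U 0) x = w x"
  shows "nls_solution \<omega> \<nu> p w I (\<lambda>t. fourier_sum (U t))"
  unfolding nls_solution_def
proof (intro conjI ballI allI)
  fix t assume t: "t \<in> I"
  show "fourier_sum (U t) \<in> wiener_algebra \<omega> \<nu>" by (rule fourier_sum_wiener)
  have "((\<lambda>s. norm (U s - U t)) \<longlongrightarrow> 0) (at t within I)"
    using cont t unfolding continuous_on_def by (intro tendsto_norm_zero LIM_zero) auto
  then show "((\<lambda>s. wiener_norm \<omega> \<nu> (\<lambda>x. fourier_sum (U s) x - fourier_sum (U t) x)) \<longlongrightarrow> 0) (at t within I)"
    by (simp add: wiener_norm_diff[OF fourier_sum_wiener fourier_sum_wiener] fourier_seq_fourier_sum)
  fix k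
  have "((\<lambda>s. coef (U s) k * (1 / wt k)) has_vector_derivative nls_rhs p (U t) k * (1 / wt k)) (at t within I)"
    by (rule has_vector_derivative_mult_left[OF der[OF t]])
  moreover have "nls_rhs p (U t) k * (1 / wt k) = \<i> * (- complex_of_real (laplace_symbol k) * fourier_coeff \<omega> (fourier_sum (U t)) k
              + fourier_coeff \<omega> (\<lambda>x. fourier_sum (U t) x ^ p) k)"
    by (simp add: fourier_coeff_fourier_sum fourier_coeff_power[OF fourier_sum_wiener] fourier_seq_fourier_sum nls_rhs_def field_simps)
  ultimately show "((\<lambda>s. fourier_coeff \<omega> (fourier_sum (U s)) k) has_vector_derivative
         \<i> * (- complex_of_real (\<Sum>j\<in>UNIV. (of_int (k $ j) * \<omega> $ j)\<^sup>2) * fourier_coeff \<omega> (fourier_sum (U t)) k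
              + fourier_coeff \<omega> (\<lambda>x. fourier_sum (U t) x ^ p) k)) (at t within I)"
    unfolding fourier_coeff_fourier_sum[of "U _"] laplace_symbol_def[symmetric] by simp
qed (rule init)

text \<open>Undoing the free evolution removes the unbounded Laplacian: the difference \<open>D\<close> of the two solutions in
this picture is differentiable in norm, and its derivative is bounded by a multiple of \<open>D\<close> itself, as
powers are Lipschitz on bounded sets. The sign \<open>\<sigma>\<close> of \<open>t\<close> lets time run forward from 0.\<close>

lemma nls_solution_unique:
  assumes u: "nls_solution \<omega> \<nu> p w J u" and v: "nls_solution \<omega> \<nu> p w J v"
    and J: "is_interval J" "0 \<in> J" and t: "t \<in> J"
  shows "AE x in lebesgue. v t x = u t x"
proof -
  define \<sigma> T where "\<sigma> = (if t \<ge> 0 then 1 else -1 :: real)" and "T = \<bar>t\<bar>"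
  have \<sigma>T: "\<sigma> * T = t" and T: "T \<ge> 0" and \<sigma>: "\<bar>\<sigma>\<bar> = 1" by (auto simp: \<sigma>_def T_def)
  have seg: "\<sigma> * s \<in> J" if "s \<in> {0..T}" for s
  proof (cases "t \<ge> 0")
    case True
    then show ?thesis using that J t by (intro mem_is_interval_1_I[OF J(1) J(2) t]) (auto simp: \<sigma>_def T_def)
  next
    case False
    then show ?thesis using that J t by (intro mem_is_interval_1_I[OF J(1) t J(2)]) (auto simp: \<sigma>_def T_def)
  qed
  have W: "u s \<in> wiener_algebra \<omega> \<nu>" "v s \<in> wiener_algebra \<omega> \<nu>" if "s \<in> J" for s
    using u v that by (auto simp: nls_solution_def)
  define U V where "U s = fourier_seq (u (\<sigma> * s))" and "V s = fourier_seq (v (\<sigma> * s))" for s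
  have cont: "continuous_on {0..T} U" "continuous_on {0..T} V"
    unfolding U_def V_def
    by (rule continuous_on_compose2[OF nls_solution_fourier_seq(1)[OF u], of "{0..T}" "\<lambda>s. \<sigma> * s"]
             continuous_on_compose2[OF nls_solution_fourier_seq(1)[OF v], of "{0..T}" "\<lambda>s. \<sigma> * s"];
        use seg in \<open>auto intro!: continuous_intros\<close>)+
  have chain: "((\<lambda>s. coef (fourier_seq (y (\<sigma> * s))) k) has_vector_derivative \<sigma> *\<^sub>R nls_rhs p (fourier_seq (y (\<sigma> * s))) k)
      (at s within {0..T})" if y: "nls_solution \<omega> \<nu> p w J y" and s: "s \<in> {0..T}" for y s k
  proof -
    have "((\<lambda>s. \<sigma> * s) has_vector_derivative \<sigma>) (at s within {0..T})"
      by (auto intro!: derivative_eq_intros)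
    moreover have "((\<lambda>t. coef (fourier_seq (y t)) k) has_vector_derivative nls_rhs p (fourier_seq (y (\<sigma> * s))) k)
        (at (\<sigma> * s) within (\<lambda>s. \<sigma> * s) ` {0..T})"
      by (rule has_vector_derivative_within_subset[OF nls_solution_fourier_seq(2)[OF y seg[OF s]]]) (use seg in auto)
    ultimately have "((\<lambda>t. coef (fourier_seq (y t)) k) \<circ> (\<lambda>s. \<sigma> * s) has_vector_derivative
        \<sigma> *\<^sub>R nls_rhs p (fourier_seq (y (\<sigma> * s))) k) (at s within {0..T})"
      by (rule vector_diff_chain_within)
    then show ?thesis by (simp add: o_def)
  qed
  define D where "D s = flow (- (\<sigma> * s)) (V s - U s)" for s
  define g where "g s = cscale (\<i> * \<sigma>) (flow (- (\<sigma> * s)) (conv_pow (V s) p - conv_pow (U s) p))" for s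
  have gc: "continuous_on {0..T} g"
    unfolding g_def
    by (intro bounded_bilinear.continuous_on[OF bounded_bilinear_cscale] continuous_on_flow
        continuous_intros continuous_on_conv_pow cont)
  have Dder: "(D has_vector_derivative g s) (at s within {0..T})" if "s \<in> {0..T}" for s
  proof (rule ell1_derivative_from_coef[OF gc _ that])
    fix k s assume s: "s \<in> {0..T}"
    have "((\<lambda>s. cis ((laplace_symbol k * \<sigma>) * s) * (coef (V s) k - coef (U s) k)) has_vector_derivative
        cis ((laplace_symbol k * \<sigma>) * s) * (\<sigma> *\<^sub>R nls_rhs p (V s) k - \<sigma> *\<^sub>R nls_rhs p (U s) k)
        + \<i> * (laplace_symbol k * \<sigma>) * cis ((laplace_symbol k * \<sigma>) * s) * (coef (V s) k - coef (U s) k)) (at s within {0..T})"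
      unfolding U_def V_def
      by (intro has_vector_derivative_mult has_vector_derivative_diff chain u v s)
         (use cis_has_vector_derivative[of "laplace_symbol k * \<sigma>"] in simp)
    moreover have "(\<lambda>s. cis ((laplace_symbol k * \<sigma>) * s) * (coef (V s) k - coef (U s) k)) = (\<lambda>s. coef (D s) k)"
      by (simp add: fun_eq_iff D_def coef_flow mult.assoc)
    moreover have "cis ((laplace_symbol k * \<sigma>) * s) * (\<sigma> *\<^sub>R nls_rhs p (V s) k - \<sigma> *\<^sub>R nls_rhs p (U s) k)
        + \<i> * (laplace_symbol k * \<sigma>) * cis ((laplace_symbol k * \<sigma>) * s) * (coef (V s) k - coef (U s) k) = coef (g s) k"
      by (simp add: g_def coef_flow nls_rhs_def scaleR_conv_of_real mult.assoc) (simp add: algebra_simps)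
    ultimately show "((\<lambda>s. coef (D s) k) has_vector_derivative coef (g s) k) (at s within {0..T})" by simp
  qed
  have "bounded (U ` {0..T} \<union> V ` {0..T})"
    using cont by (intro compact_imp_bounded compact_Un compact_continuous_image) auto
  then obtain R where R: "\<forall>A\<in>U ` {0..T} \<union> V ` {0..T}. norm A \<le> R" unfolding bounded_iff by blast
  have R0: "R \<ge> 0"
  proof -
    have "norm (U 0) \<le> R" using R T by auto
    then show ?thesis using norm_ge_zero[of "U 0"] by linarith
  qed
  have "D T = 0"
  proof (rule zero_if_derivative_bounded[OF _ _ Dder])
    have "AE x in lebesgue. u 0 x = w x" "AE x in lebesgue. v 0 x = w x"
      using u v by (auto simp: nls_solution_def)
    then have "AE x in lebesgue. u 0 x = v 0 x" by eventually_elim auto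
    then have "fourier_coeff \<omega> (u 0) k = fourier_coeff \<omega> (v 0) k" for k
      using W[OF J(2)] by (intro fourier_coeff_cong_AE AE_cell borel_measurable_integrable wiener_integrable)
    then have "U 0 = V 0"
      by (intro ell1_eqI) (simp add: U_def V_def coef_fourier_seq[OF W(1)[OF J(2)]] coef_fourier_seq[OF W(2)[OF J(2)]])
    then show "D 0 = 0" by (simp add: D_def)
    show "p * R ^ (p - 1) \<ge> 0" using R0 by simp
    fix s assume s: "s \<in> {0..T}"
    have "norm (g s) = norm (conv_pow (V s) p - conv_pow (U s) p)" by (simp add: g_def norm_mult \<sigma>)
    also have "\<dots> \<le> p * R ^ (p - 1) * norm (V s - U s)"
      by (rule norm_conv_pow_diff_le) (use R s in auto)
    finally show "norm (g s) \<le> p * R ^ (p - 1) * norm (D s)" by (simp add: D_def)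
  qed (use T in auto)
  then have "norm (V T - U T) = 0" using norm_flow[of "- (\<sigma> * T)" "V T - U T"] by (simp add: D_def)
  then have "fourier_seq (v t) = fourier_seq (u t)" by (simp add: U_def V_def \<sigma>T)
  then show ?thesis
    using fourier_sum_fourier_seq_AE[OF W(1)[OF t]] fourier_sum_fourier_seq_AE[OF W(2)[OF t]] by (auto elim: eventually_elim2)
qed

lemma fourier_sum_unit_0 [simp]: "fourier_sum (unit 0) x = 1"
  by (simp add: fourier_sum_unit)

lemma conv_pow_1: "conv_pow A (Suc 0) = A"
  by (rule fourier_sum_eqD) (simp add: fourier_sum_conv)

text \<open>The binomial theorem; \<open>unit 0\<close> represents the constant function 1.\<close>

lemma conv_pow_const_add:
  "conv_pow (cscale c (unit 0) + cscale d A) n =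
    (\<Sum>j\<le>n. cscale (of_nat (n choose j) * d ^ j * c ^ (n - j)) (conv_pow A j))"
proof (rule fourier_sum_eqD)
  fix x
  have "fourier_sum (conv_pow (cscale c (unit 0) + cscale d A) n) x = (d * fourier_sum A x + c) ^ n"
    by (simp add: fourier_sum_conv_pow fourier_sum_linear fourier_sum_cscale add.commute)
  also have "\<dots> = (\<Sum>j\<le>n. of_nat (n choose j) * (d * fourier_sum A x) ^ j * c ^ (n - j))"
    by (rule binomial_ring)
  also have "\<dots> = fourier_sum (\<Sum>j\<le>n. cscale (of_nat (n choose j) * d ^ j * c ^ (n - j)) (conv_pow A j)) x"
    by (simp add: fourier_sum_linear fourier_sum_cscale fourier_sum_conv_pow power_mult_distrib mult_ac)
  finally show "fourier_sum (conv_pow (cscale c (unit 0) + cscale d A) n) x =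
      fourier_sum (\<Sum>j\<le>n. cscale (of_nat (n choose j) * d ^ j * c ^ (n - j)) (conv_pow A j)) x" .
qed

end

section \<open>The spatially constant solution\<close>

lemma power_diff_bound:
  fixes x y :: complex
  assumes "norm x \<le> R" "norm y \<le> R"
  shows "norm (x ^ n - y ^ n) \<le> n * R ^ (n - 1) * norm (x - y)"
proof -
  have R: "R \<ge> 0" using assms(1) norm_ge_zero[of x] by linarith
  have eq: "norm (x ^ n - y ^ n) = norm (x - y) * norm (\<Sum>i<n. y ^ (n - Suc i) * x ^ i)"
    by (simp add: power_diff_sumr2 norm_mult)
  have "norm (\<Sum>i<n. y ^ (n - Suc i) * x ^ i) \<le> (\<Sum>i<n. R ^ (n - 1))"
  proof (rule sum_norm_le)
    fix i assume "i \<in> {..<n}"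
    then have "n - 1 = (n - Suc i) + i" by auto
    then show "norm (y ^ (n - Suc i) * x ^ i) \<le> R ^ (n - 1)"
      using assms R by (simp only: norm_mult norm_power power_add) (intro mult_mono power_mono, auto)
  qed
  then have "norm (\<Sum>i<n. y ^ (n - Suc i) * x ^ i) \<le> n * R ^ (n - 1)" by simp
  from mult_left_mono[OF this norm_ge_zero[of "x - y"]]
  have "norm (x - y) * norm (\<Sum>i<n. y ^ (n - Suc i) * x ^ i) \<le> n * R ^ (n - 1) * norm (x - y)"
    by (simp only: mult_ac)
  with eq show ?thesis by simp
qed

text \<open>The factor \<open>\<sigma>\<close> is the direction of time, so that both halves of the result are treated at once. The
last assumption is the condition on the argument of \<open>z0\<close>.\<close>

locale scalar_flow =
  fixes p :: nat and z0 :: complex and \<sigma> :: real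
  assumes p: "p \<ge> 2" and z0: "z0 \<noteq> 0" and \<sigma>: "\<sigma> = 1 \<or> \<sigma> = -1"
    and Im_sign: "\<sigma> * Im (z0 ^ (p - 1)) \<ge> 0"
begin

definition rate :: complex where "rate = of_nat (p - 1) * z0 ^ (p - 1)"
definition time_set :: "real set" where "time_set = {t. \<sigma> * t \<ge> 0}"
definition denom :: "real \<Rightarrow> complex" where "denom t = 1 - \<i> * rate * of_real t"

text \<open>The equation \<open>z' = \<i> * z ^ p\<close> says that \<open>1 / z ^ (p - 1)\<close> has the constant derivative \<open>- \<i> * (p - 1)\<close>.
So \<open>(z0 / z) ^ (p - 1)\<close> is the affine function \<open>denom\<close>, and \<open>z / z0\<close> is the root below. The principal
logarithm is the right one because \<open>denom\<close> is 1 at time 0 and stays in the right half plane on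
\<open>time_set\<close>.\<close>

definition ratio :: "real \<Rightarrow> complex" where "ratio t = exp (- Ln (denom t) / of_nat (p - 1))"
definition \<zeta> :: "real \<Rightarrow> complex" where "\<zeta> t = z0 * ratio t"

lemma \<sigma>2 [simp]: "\<sigma> * (\<sigma> * x) = x" and abs_\<sigma> [simp]: "\<bar>\<sigma>\<bar> = 1"
  using \<sigma> by auto

lemma rate_nz: "rate \<noteq> 0"
  using p z0 by (simp add: rate_def)

text \<open>The real part is \<open>1 + t * Im rate\<close>, and the condition on the argument of \<open>z0\<close> says that \<open>Im rate\<close> has
the sign of the chosen direction of time, if it is not 0.\<close>

lemma Re_denom:
  assumes "t \<in> time_set" shows "Re (denom t) \<ge> 1"
proof -
  have "0 \<le> (\<sigma> * t) * (\<sigma> * Im (z0 ^ (p - 1)))"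
    by (rule mult_nonneg_nonneg[OF _ Im_sign]) (use assms in \<open>simp add: time_set_def\<close>)
  also have "\<dots> = t * Im (z0 ^ (p - 1))" using \<sigma> by auto
  finally have "0 \<le> real (p - 1) * (t * Im (z0 ^ (p - 1)))" by simp
  then show ?thesis by (simp add: denom_def rate_def mult_ac)
qed

lemma norm_denom:
  assumes t: "t \<in> time_set" shows "1 + t\<^sup>2 * (cmod rate)\<^sup>2 \<le> (cmod (denom t))\<^sup>2"
proof -
  have "Re (denom t) = 1 + t * Im rate" "Im (denom t) = - (t * Re rate)" by (simp_all add: denom_def)
  then have "(cmod (denom t))\<^sup>2 = 1 + 2 * (t * Im rate) + t\<^sup>2 * (cmod rate)\<^sup>2"
    unfolding cmod_power2 by (simp add: power2_eq_square algebra_simps)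
  moreover have "t * Im rate \<ge> 0" using Re_denom[OF t] by (simp add: denom_def mult.commute)
  ultimately show ?thesis by simp
qed

lemma denom_nz: "t \<in> time_set \<Longrightarrow> denom t \<noteq> 0"
  using Re_denom[of t] by auto

lemma denom_slit: "t \<in> time_set \<Longrightarrow> denom t \<notin> \<real>\<^sub>\<le>\<^sub>0"
  using Re_denom[of t] by (auto simp: complex_nonpos_Reals_iff)

lemma ratio_power: "t \<in> time_set \<Longrightarrow> ratio t ^ (p - 1) = 1 / denom t"
  using p unfolding ratio_def exp_of_nat_mult[symmetric]
  by (simp add: exp_minus denom_nz inverse_eq_divide)

lemma ratio_0: "ratio 0 = 1"
  by (simp add: ratio_def denom_def)

lemma power_pred_mult: "z ^ (p - 1) * z = (z :: complex) ^ p"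
  using p by (cases p) auto

lemma ratio_deriv:
  assumes t: "t \<in> time_set"
  shows "(ratio has_vector_derivative \<i> * z0 ^ (p - 1) * ratio t ^ p) (at t within S)"
proof -
  have n: "of_nat (p - 1) \<noteq> (0 :: complex)" using p by simp
  have "((\<lambda>z. exp (- Ln (1 - \<i> * rate * z) / m)) has_field_derivative
      exp (- Ln (1 - \<i> * rate * of_real t) / m) * (- (inverse (1 - \<i> * rate * of_real t) * (- (\<i> * rate))) / m))
      (at (of_real t))" if "m \<noteq> 0" for m
    using denom_slit[OF t] that by (auto intro!: derivative_eq_intros simp: denom_def divide_inverse)
  from has_vector_derivative_real_field[OF this[OF n]]
  have "(ratio has_vector_derivative ratio t * (- (inverse (denom t) * (- (\<i> * rate))) / of_nat (p - 1))) (at t within S)"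
    unfolding ratio_def[abs_def] denom_def .
  also have "ratio t * (- (inverse (denom t) * (- (\<i> * rate))) / of_nat (p - 1)) = \<i> * z0 ^ (p - 1) * (1 / denom t * ratio t)"
  proof -
    have "x * (- (inverse d * (- (\<i> * (m * z)))) / m) = \<i> * z * (1 / d * x)" if "m \<noteq> 0" for x d m z :: complex
      using that by (simp add: divide_inverse)
    from this[OF n] show ?thesis unfolding rate_def .
  qed
  also have "1 / denom t * ratio t = ratio t ^ p" unfolding ratio_power[OF t, symmetric] by (rule power_pred_mult)
  finally show ?thesis .
qed

lemma ratio_continuous: "continuous_on time_set ratio"
  by (rule continuous_on_if_vector_derivative[OF ratio_deriv])

lemma \<zeta>_deriv:
  assumes "t \<in> time_set" shows "(\<zeta> has_vector_derivative \<i> * \<zeta> t ^ p) (at t within S)"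
proof -
  have "(\<zeta> has_vector_derivative z0 * (\<i> * z0 ^ (p - 1) * ratio t ^ p)) (at t within S)"
    unfolding \<zeta>_def by (rule has_vector_derivative_mult_right[OF ratio_deriv[OF assms]])
  also have "z0 * (\<i> * z0 ^ (p - 1) * ratio t ^ p) = \<i> * ((z0 ^ (p - 1) * z0) * ratio t ^ p)" by simp
  also have "\<dots> = \<i> * \<zeta> t ^ p" by (simp only: power_pred_mult \<zeta>_def power_mult_distrib)
  finally show ?thesis .
qed

lemma ratio_bound:
  assumes t: "t \<in> time_set"
  shows "cmod (ratio t) \<le> (1 / (1 + t\<^sup>2 * (cmod rate)\<^sup>2)) powr (1 / (2 * (real p - 1)))"
proof -
  let ?s = "1 + t\<^sup>2 * (cmod rate)\<^sup>2"
  have s: "?s > 0" by (simp add: add_pos_nonneg)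
  have p1: "real (p - 1) = real p - 1" "real p - 1 > 0" using p by auto
  have "cmod (ratio t) = exp (- ln (cmod (denom t)) / (real p - 1))"
    using denom_nz[OF t] p1 by (simp add: ratio_def Re_divide_of_nat)
  also have "\<dots> \<le> exp (- (ln ?s / 2) / (real p - 1))"
  proof -
    have "ln ?s \<le> ln ((cmod (denom t))\<^sup>2)" using norm_denom[OF t] s by (subst ln_le_cancel_iff) auto
    also have "\<dots> = 2 * ln (cmod (denom t))" using denom_nz[OF t] by (simp add: ln_realpow)
    finally have "ln ?s / 2 / (real p - 1) \<le> ln (cmod (denom t)) / (real p - 1)"
      using p1 by (intro divide_right_mono) auto
    then show ?thesis by simp
  qed
  also have "\<dots> = (1 / ?s) powr (1 / (2 * (real p - 1)))"
    using s by (simp add: powr_def ln_div)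
  finally show ?thesis .
qed

text \<open>Exponents from 2 on yield a bound that is integrable in time; exponent 1 would not.\<close>

lemma inverse_denom_power_bound:
  assumes t: "t \<in> time_set" and j: "j \<ge> 2"
  shows "cmod (1 / denom t) ^ j \<le> 1 / (1 + (cmod rate * t)\<^sup>2)"
proof -
  have "cmod (denom t) \<ge> 1" using Re_denom[OF t] complex_Re_le_cmod[of "denom t"] by linarith
  then have "cmod (1 / denom t) ^ j \<le> cmod (1 / denom t) ^ 2"
    by (intro power_decreasing j) (auto simp: norm_divide divide_le_eq_1)
  also have "\<dots> = 1 / (cmod (denom t))\<^sup>2" by (simp add: norm_divide power_divide)
  also have "\<dots> \<le> 1 / (1 + (cmod rate * t)\<^sup>2)"
    using norm_denom[OF t] denom_nz[OF t]
    by (intro divide_left_mono mult_pos_pos) (auto simp: power_mult_distrib mult.commute add_pos_nonneg)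
  finally show ?thesis .
qed

lemma ratio_tendsto:
  assumes F: "F = at_top \<or> F = at_bot" and ev: "\<forall>\<^sub>F t in F. t \<in> time_set"
  shows "((\<lambda>t. cmod (ratio t)) \<longlongrightarrow> 0) F"
proof -
  have p1: "real p - 1 > 0" using p by auto
  have "filterlim (\<lambda>t::real. t\<^sup>2) at_top F"
    using F filterlim_pow_at_top[OF pos2 filterlim_ident] filterlim_pow_at_bot_even[OF pos2 filterlim_ident] by auto
  then have "filterlim (\<lambda>t. 1 + t\<^sup>2 * (cmod rate)\<^sup>2) at_top F"
    using rate_nz by (intro filterlim_tendsto_add_at_top[OF tendsto_const] filterlim_at_top_mult_tendsto_pos[OF tendsto_const]) auto
  then have "((\<lambda>t. inverse (1 + t\<^sup>2 * (cmod rate)\<^sup>2)) \<longlongrightarrow> 0) F"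
    by (rule tendsto_inverse_0_at_top)
  then have "((\<lambda>t. (1 / (1 + t\<^sup>2 * (cmod rate)\<^sup>2)) powr (1 / (2 * (real p - 1)))) \<longlongrightarrow> 0) F"
    using p1 by (intro tendsto_zero_powrI[OF _ tendsto_const]) (auto simp: inverse_eq_divide add_nonneg_nonneg)
  then show ?thesis
    by (rule Lim_null_comparison[rotated]) (use ev ratio_bound in \<open>auto elim!: eventually_mono\<close>)
qed

lemma ode_the_solution_\<zeta>: "ode_the_solution p z0 time_set \<zeta>"
  unfolding ode_the_solution_def
proof (intro conjI allI impI ballI)
  have "0 \<in> time_set" by (simp add: time_set_def)
  have "\<zeta> 0 = z0" by (simp add: \<zeta>_def ratio_0)
  then show "ode_solution p z0 time_set \<zeta>" by (simp add: ode_solution_def \<zeta>_deriv)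
  fix J \<eta> t
  assume *: "is_interval J \<and> 0 \<in> J \<and> J \<subseteq> time_set \<and> ode_solution p z0 J \<eta>" and t: "t \<in> J"
  then have J: "is_interval J" "0 \<in> J" "J \<subseteq> time_set" and \<eta>0: "\<eta> 0 = z0"
    and \<eta>: "\<And>t. t \<in> J \<Longrightarrow> (\<eta> has_vector_derivative \<i> * \<eta> t ^ p) (at t within J)"
    by (auto simp: ode_solution_def)
  define T where "T = \<sigma> * t"
  have T: "T \<ge> 0" "\<sigma> * T = t" using t J by (auto simp: T_def time_set_def)
  have seg: "\<sigma> * s \<in> J" if "s \<in> {0..T}" for s
  proof -
    have "min 0 t \<le> \<sigma> * s \<and> \<sigma> * s \<le> max 0 t" using that \<sigma> by (auto simp: T_def)
    moreover have "min 0 t \<in> J" "max 0 t \<in> J" using t J by (auto simp: min_def max_def)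
    ultimately show ?thesis using J(1) by (meson mem_is_interval_1_I)
  qed
  have chain: "((\<lambda>s. y (\<sigma> * s)) has_vector_derivative \<sigma> *\<^sub>R (\<i> * y (\<sigma> * s) ^ p)) (at s within {0..T})"
    if y: "\<And>t. t \<in> J \<Longrightarrow> (y has_vector_derivative \<i> * y t ^ p) (at t within J)" and s: "s \<in> {0..T}" for y s
  proof -
    have "((\<lambda>s. \<sigma> * s) has_vector_derivative \<sigma>) (at s within {0..T})"
      by (auto intro!: derivative_eq_intros)
    moreover have "(y has_vector_derivative \<i> * y (\<sigma> * s) ^ p) (at (\<sigma> * s) within (\<lambda>s. \<sigma> * s) ` {0..T})"
      by (rule has_vector_derivative_within_subset[OF y[OF seg[OF s]]]) (use seg in auto)
    ultimately have "(y \<circ> (\<lambda>s. \<sigma> * s) has_vector_derivative \<sigma> *\<^sub>R (\<i> * y (\<sigma> * s) ^ p)) (at s within {0..T})"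
      by (rule vector_diff_chain_within)
    then show ?thesis by (simp add: o_def)
  qed
  note ch = chain[OF \<eta>] chain[OF \<zeta>_deriv[OF subsetD[OF J(3)]]]
  let ?e = "\<lambda>s. \<eta> (\<sigma> * s)" and ?z = "\<lambda>s. \<zeta> (\<sigma> * s)"
  have "bounded (?e ` {0..T} \<union> ?z ` {0..T})"
    by (intro compact_imp_bounded compact_Un compact_continuous_image continuous_on_if_vector_derivative[OF ch(1)]
        continuous_on_if_vector_derivative[OF ch(2)]) auto
  then obtain R where R: "\<forall>A\<in>?e ` {0..T} \<union> ?z ` {0..T}. norm A \<le> R" unfolding bounded_iff by blast
  have R0: "R \<ge> 0"
  proof -
    have "norm (?e 0) \<le> R" by (rule R[rule_format], rule UnI1, rule imageI) (use T in simp)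
    then show ?thesis using norm_ge_zero[of "?e 0"] by linarith
  qed
  have "?e T - ?z T = 0"
  proof (rule zero_if_derivative_bounded[where D="\<lambda>s. ?e s - ?z s", OF _ _ has_vector_derivative_diff[OF ch]])
    show "\<eta> (\<sigma> * 0) - \<zeta> (\<sigma> * 0) = 0" by (simp add: \<eta>0 \<zeta>_def ratio_0)
    show "p * R ^ (p - 1) \<ge> 0" using R0 by simp
    fix s assume s: "s \<in> {0..T}"
    have "norm (\<sigma> *\<^sub>R (\<i> * ?e s ^ p) - \<sigma> *\<^sub>R (\<i> * ?z s ^ p)) = norm (?e s ^ p - ?z s ^ p)"
      by (simp add: scaleR_diff_right[symmetric] right_diff_distrib[symmetric] norm_mult)
    also have "\<dots> \<le> p * R ^ (p - 1) * norm (?e s - ?z s)"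
      by (rule power_diff_bound) (use R s in auto)
    finally show "norm (\<sigma> *\<^sub>R (\<i> * ?e s ^ p) - \<sigma> *\<^sub>R (\<i> * ?z s ^ p)) \<le> p * R ^ (p - 1) * norm (?e s - ?z s)" .
  qed (use T in auto)
  then show "\<eta> t = \<zeta> t" by (simp add: T)
qed

lemma sum_binomial_from_2: "(\<Sum>j=2..p. real (p choose j)) = 2 ^ p - real p - 1"
proof -
  have "(\<Sum>j\<le>p. real (p choose j)) = 2 ^ p"
    using choose_row_sum[of p] by (metis of_nat_numeral of_nat_power of_nat_sum)
  moreover have "{..p} = insert 0 (insert 1 {2..p})" using p by auto
  ultimately show ?thesis by simp
qed

end

section \<open>Global solutions near the constant one\<close>

locale nls_flow = torus_wiener \<omega> \<nu> + scalar_flow p z0 \<sigma>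
  for \<omega> :: "real^'d" and \<nu> p z0 \<sigma>
begin

text \<open>The substitution \<open>u = \<zeta> + z0 * ratio ^ p * w\<close> removes the linear term of the perturbation, because the
factor solves the linearization of \<open>z' = \<i> * z ^ p\<close> at \<open>\<zeta>\<close>. What remains is
\<open>w' = \<i> * \<triangle>w + (\<Sum>j=2..p. nl_coeff t j * w ^ j)\<close>. Here the powers of \<open>ratio\<close> combine to
\<open>ratio ^ ((p - 1) * j)\<close>, which is \<open>(1 / denom) ^ j\<close>.\<close>

definition nl_coeff :: "real \<Rightarrow> nat \<Rightarrow> complex" where
  "nl_coeff t j = \<i> * z0 ^ (p - 1) * of_nat (p choose j) * (1 / denom t) ^ j"

definition scaled_nonlin :: "real \<Rightarrow> (int^'d) ell1 \<Rightarrow> (int^'d) ell1" where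
  "scaled_nonlin t A = (\<Sum>j=2..p. cscale (nl_coeff t j) (conv_pow A j))"

lemma norm_nl_coeff:
  assumes t: "t \<in> time_set" and j: "j \<ge> 2"
  shows "norm (nl_coeff t j) \<le> cmod z0 ^ (p - 1) * real (p choose j) * (1 / (1 + (cmod rate * t)\<^sup>2))"
proof -
  have "norm (nl_coeff t j) = cmod z0 ^ (p - 1) * real (p choose j) * cmod (1 / denom t) ^ j"
    by (simp add: nl_coeff_def norm_mult norm_power)
  also have "\<dots> \<le> cmod z0 ^ (p - 1) * real (p choose j) * (1 / (1 + (cmod rate * t)\<^sup>2))"
    by (intro mult_left_mono inverse_denom_power_bound[OF t j]) auto
  finally show ?thesis .
qed

text \<open>In the unit ball all powers from the second on are bounded by the first, and the binomial coefficients
without the first two add up to \<open>2 ^ p - p - 1\<close>. The factor in front of \<open>norm A\<close> is integrable in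
time.\<close>

lemma norm_scaled_nonlin_le:
  assumes t: "t \<in> time_set" and A: "norm A \<le> 1"
  shows "norm (scaled_nonlin t A) \<le> cmod z0 ^ (p - 1) * (2 ^ p - real p - 1) / (1 + (cmod rate * t)\<^sup>2) * norm A"
proof -
  let ?r = "1 / (1 + (cmod rate * t)\<^sup>2)"
  have "norm (scaled_nonlin t A) \<le> (\<Sum>j=2..p. cmod z0 ^ (p - 1) * real (p choose j) * ?r * norm A)"
    unfolding scaled_nonlin_def
  proof (rule sum_norm_le)
    fix j assume j: "j \<in> {2..p}"
    have "norm (conv_pow A j) \<le> norm A ^ j" by (rule norm_conv_pow_le)
    also have "\<dots> \<le> norm A ^ 1" by (rule power_decreasing) (use j A in auto)
    finally have "norm (conv_pow A j) \<le> norm A" by simp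
    then show "norm (cscale (nl_coeff t j) (conv_pow A j)) \<le> cmod z0 ^ (p - 1) * real (p choose j) * ?r * norm A"
      unfolding norm_cscale using j by (intro mult_mono norm_nl_coeff t) auto
  qed
  also have "\<dots> = cmod z0 ^ (p - 1) * ?r * norm A * (\<Sum>j=2..p. real (p choose j))"
    unfolding sum_distrib_left by (rule sum.cong) (simp_all only: mult_ac)
  also have "\<dots> = cmod z0 ^ (p - 1) * (2 ^ p - real p - 1) / (1 + (cmod rate * t)\<^sup>2) * norm A"
    unfolding sum_binomial_from_2 by (simp add: mult_ac)
  finally show ?thesis .
qed

definition nl_lip :: real where "nl_lip = (\<Sum>j=2..p. cmod z0 ^ (p - 1) * real (p choose j) * real j)"

lemma nl_lip_nonneg: "nl_lip \<ge> 0"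
  unfolding nl_lip_def by (intro sum_nonneg) auto

lemma scaled_nonlin_lipschitz:
  assumes t: "t \<in> time_set" and A: "norm A \<le> 1" and B: "norm B \<le> 1"
  shows "norm (scaled_nonlin t A - scaled_nonlin t B) \<le> nl_lip * norm (A - B)"
proof -
  interpret cs: bounded_bilinear "cscale :: complex \<Rightarrow> (int^'d) ell1 \<Rightarrow> _"
    by (rule bounded_bilinear_cscale)
  have "scaled_nonlin t A - scaled_nonlin t B = (\<Sum>j=2..p. cscale (nl_coeff t j) (conv_pow A j - conv_pow B j))"
    by (simp add: scaled_nonlin_def sum_subtractf cs.diff_right)
  also have "norm \<dots> \<le> (\<Sum>j=2..p. cmod z0 ^ (p - 1) * real (p choose j) * real j * norm (A - B))"
  proof (rule sum_norm_le)
    fix j assume j: "j \<in> {2..p}"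
    have "1 / (1 + (cmod rate * t)\<^sup>2) \<le> 1" by (simp add: add_pos_nonneg divide_le_eq_1)
    then have "cmod z0 ^ (p - 1) * real (p choose j) * (1 / (1 + (cmod rate * t)\<^sup>2))
        \<le> cmod z0 ^ (p - 1) * real (p choose j) * 1"
      by (intro mult_left_mono) auto
    then have 1: "norm (nl_coeff t j) \<le> cmod z0 ^ (p - 1) * real (p choose j)"
      using norm_nl_coeff[OF t, of j] j by simp
    have 2: "norm (conv_pow A j - conv_pow B j) \<le> real j * norm (A - B)"
      using norm_conv_pow_diff_le[OF A B, of j] by simp
    have "norm (nl_coeff t j) * norm (conv_pow A j - conv_pow B j)
        \<le> cmod z0 ^ (p - 1) * real (p choose j) * (real j * norm (A - B))"
      by (intro mult_mono 1 2) auto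
    then show "norm (cscale (nl_coeff t j) (conv_pow A j - conv_pow B j))
        \<le> cmod z0 ^ (p - 1) * real (p choose j) * real j * norm (A - B)"
      by (simp add: mult.assoc)
  qed
  also have "\<dots> = nl_lip * norm (A - B)" by (simp add: nl_lip_def sum_distrib_right)
  finally show ?thesis .
qed

text \<open>The nonlinearity seen after undoing the free evolution: \<open>B = flow (- t) w\<close> satisfies
\<open>B' = interaction_rhs t B\<close>, an equation without the Laplacian.\<close>

definition interaction_rhs :: "real \<Rightarrow> (int^'d) ell1 \<Rightarrow> (int^'d) ell1" where
  "interaction_rhs t B = flow (- t) (scaled_nonlin t (flow t B))"

lemma continuous_on_interaction_rhs:
  assumes \<theta>: "continuous_on S \<theta>" and \<theta>S: "\<And>s. s \<in> S \<Longrightarrow> \<theta> s \<in> time_set" and b: "continuous_on S b"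
  shows "continuous_on S (\<lambda>s. interaction_rhs (\<theta> s) (b s))"
proof -
  have "continuous_on S (\<lambda>s. nl_coeff (\<theta> s) j)" for j
    unfolding nl_coeff_def by (intro continuous_intros) (use denom_nz \<theta>S \<theta> in \<open>auto simp: denom_def intro!: continuous_intros\<close>)
  then show ?thesis
    unfolding interaction_rhs_def scaled_nonlin_def
    by (intro continuous_on_flow continuous_on_sum bounded_bilinear.continuous_on[OF bounded_bilinear_cscale]
        continuous_on_conv_pow continuous_on_minus \<theta> b)
qed

text \<open>The growth rate \<open>h\<close> has total mass \<open>(pi / 2) * (2 ^ p - p - 1) / (p - 1)\<close>, whose exponential is the
inverse of \<open>C_const p\<close>. So the smallness condition is what keeps \<open>B\<close> in the unit ball for all times.\<close>

lemma interaction_solution: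
  assumes W0: "norm W0 < C_const p"
  shows "\<exists>B. B 0 = W0 \<and> (\<forall>t\<in>time_set. (B has_vector_derivative interaction_rhs t (B t)) (at t within time_set) \<and> norm (B t) \<le> 1)"
proof -
  define K where "K = cmod z0 ^ (p - 1) * (2 ^ p - real p - 1)"
  define h where "h s = K / (1 + (cmod rate * s)\<^sup>2)" for s
  define H where "H s = K / cmod rate * arctan (cmod rate * s)" for s
  have tm: "\<sigma> * s \<in> time_set" if "s \<ge> 0" for s using that by (simp add: time_set_def)
  have "K = cmod z0 ^ (p - 1) * (\<Sum>j=2..p. real (p choose j))" by (simp add: K_def sum_binomial_from_2)
  then have K: "K \<ge> 0" by (simp add: sum_nonneg)
  have n\<sigma>: "(cmod rate * (\<sigma> * s))\<^sup>2 = (cmod rate * s)\<^sup>2" for s using \<sigma> by (auto simp: power_mult_distrib)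
  have small: "norm W0 * exp (H s) \<le> 1" for s
  proof -
    have "H s \<le> K / cmod rate * (pi / 2)"
      unfolding H_def using K arctan_ubound[of "cmod rate * s"] by (intro mult_left_mono) auto
    also have "\<dots> = (pi / 2) * ((2 ^ p - real p - 1) / (real p - 1))"
    proof -
      have "cmod z0 ^ (p - 1) \<noteq> 0" using z0 by simp
      moreover have "cmod rate = (real p - 1) * cmod z0 ^ (p - 1)"
      proof -
        have "cmod rate = real (p - 1) * cmod z0 ^ (p - 1)"
          unfolding rate_def norm_mult norm_power norm_of_nat ..
        then show ?thesis using p by simp
      qed
      moreover have "x * N / (m * x) * (pi / 2) = (pi / 2) * (N / m)" if "x \<noteq> 0" for x N m :: real
        using that by (simp add: field_simps)
      ultimately show ?thesis unfolding K_def by metis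
    qed
    finally have "norm W0 * exp (H s) \<le> norm W0 * exp ((pi / 2) * ((2 ^ p - real p - 1) / (real p - 1)))"
      by (intro mult_left_mono) auto
    also have "\<dots> \<le> C_const p * exp ((pi / 2) * ((2 ^ p - real p - 1) / (real p - 1)))"
      using W0 by (intro mult_right_mono) auto
    also have "\<dots> = 1" by (simp add: C_const_def exp_add[symmetric])
    finally show "norm W0 * exp (H s) \<le> 1" .
  qed
  have "\<exists>b. b 0 = W0 \<and> (\<forall>s\<ge>0. (b has_vector_derivative \<sigma> *\<^sub>R interaction_rhs (\<sigma> * s) (b s)) (at s within {0..})
      \<and> norm (b s) \<le> norm W0 * exp (H s))"
  proof (rule picard_global_solution[where R=1 and L=nl_lip and h=h])
    fix b :: "real \<Rightarrow> (int^'d) ell1" assume b: "continuous_on {0..} b"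
    show "continuous_on {0..} (\<lambda>s. \<sigma> *\<^sub>R interaction_rhs (\<sigma> * s) (b s))"
      by (intro continuous_on_scaleR continuous_on_const continuous_on_interaction_rhs b continuous_intros)
         (simp add: tm)
  next
    fix s :: real and x :: "(int^'d) ell1" assume s: "s \<ge> 0" and x: "norm x \<le> 1"
    show "norm (\<sigma> *\<^sub>R interaction_rhs (\<sigma> * s) x) \<le> h s * norm x"
      using norm_scaled_nonlin_le[OF tm[OF s], of "flow (\<sigma> * s) x"] x
      by (simp add: interaction_rhs_def h_def K_def n\<sigma>)
  next
    fix s :: real and x y :: "(int^'d) ell1" assume s: "s \<ge> 0" and x: "norm x \<le> 1" and y: "norm y \<le> 1"
    show "norm (\<sigma> *\<^sub>R interaction_rhs (\<sigma> * s) x - \<sigma> *\<^sub>R interaction_rhs (\<sigma> * s) y) \<le> nl_lip * norm (x - y)"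
      using scaled_nonlin_lipschitz[OF tm[OF s], of "flow (\<sigma> * s) x" "flow (\<sigma> * s) y"] x y
      by (simp add: interaction_rhs_def flow_diff scaleR_diff_right[symmetric])
  next
    show "(H has_real_derivative h s) (at s)" for s
      unfolding H_def h_def using rate_nz
      by (auto intro!: derivative_eq_intros simp: divide_inverse)
    show "h s \<ge> 0" for s using K by (simp add: h_def)
    show "H 0 = 0" by (simp add: H_def)
    show "nl_lip \<ge> 0" by (rule nl_lip_nonneg)
    show "norm W0 * exp (H s) \<le> 1" for s by (rule small)
  qed
  then obtain b where b0: "b 0 = W0"
    and bd: "\<And>s. s \<ge> 0 \<Longrightarrow> (b has_vector_derivative \<sigma> *\<^sub>R interaction_rhs (\<sigma> * s) (b s)) (at s within {0..})"
    and bn: "\<And>s. s \<ge> 0 \<Longrightarrow> norm (b s) \<le> norm W0 * exp (H s)" by auto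
  show ?thesis
  proof (intro exI[of _ "\<lambda>t. b (\<sigma> * t)"] conjI ballI)
    show "b (\<sigma> * 0) = W0" by (simp add: b0)
    fix t assume t: "t \<in> time_set"
    then have s: "\<sigma> * t \<ge> 0" by (simp add: time_set_def)
    show "norm (b (\<sigma> * t)) \<le> 1" by (rule order_trans[OF bn[OF s] small])
    have "((\<lambda>t. \<sigma> * t) has_vector_derivative \<sigma>) (at t within time_set)"
      by (auto intro!: derivative_eq_intros)
    moreover have "(b has_vector_derivative \<sigma> *\<^sub>R interaction_rhs (\<sigma> * (\<sigma> * t)) (b (\<sigma> * t)))
        (at (\<sigma> * t) within (\<lambda>t. \<sigma> * t) ` time_set)"
      by (rule has_vector_derivative_within_subset[OF bd[OF s]]) (auto simp: time_set_def)
    ultimately have "(b \<circ> (\<lambda>t. \<sigma> * t) has_vector_derivative \<sigma> *\<^sub>R \<sigma> *\<^sub>R interaction_rhs (\<sigma> * (\<sigma> * t)) (b (\<sigma> * t)))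
        (at t within time_set)"
      by (rule vector_diff_chain_within)
    moreover have "\<sigma> * \<sigma> = 1" using \<sigma> by auto
    ultimately show "((\<lambda>t. b (\<sigma> * t)) has_vector_derivative interaction_rhs t (b (\<sigma> * t))) (at t within time_set)"
      by (simp add: o_def)
  qed
qed

text \<open>Back from \<open>B\<close> to \<open>U = \<zeta> + z0 * ratio ^ p * w\<close>. That \<open>B\<close> stays in the unit ball is precisely the
claimed bound on the deviation from \<open>\<zeta>\<close>.\<close>

lemma nls_solution_exists:
  assumes W0: "norm W0 < C_const p"
  obtains U where "continuous_on time_set U"
    and "\<And>t k. t \<in> time_set \<Longrightarrow> ((\<lambda>s. coef (U s) k) has_vector_derivative nls_rhs p (U t) k) (at t within time_set)"
    and "U 0 = cscale z0 (unit 0) + cscale z0 W0"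
    and "\<And>t. t \<in> time_set \<Longrightarrow> norm (U t - cscale (\<zeta> t) (unit 0)) \<le> cmod z0 * cmod (ratio t) ^ p"
proof -
  obtain B where B0: "B 0 = W0"
    and Bd: "\<And>t. t \<in> time_set \<Longrightarrow> (B has_vector_derivative interaction_rhs t (B t)) (at t within time_set)"
    and Bn: "\<And>t. t \<in> time_set \<Longrightarrow> norm (B t) \<le> 1"
    using interaction_solution[OF W0] by auto
  define W where "W t = flow t (B t)" for t
  define U where "U t = cscale (\<zeta> t) (unit 0) + cscale (z0 * ratio t ^ p) (W t)" for t
  show thesis
  proof
    have Bc: "continuous_on time_set B" by (rule continuous_on_if_vector_derivative[OF Bd])
    have "continuous_on time_set \<zeta>" by (rule continuous_on_if_vector_derivative[OF \<zeta>_deriv])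
    then show "continuous_on time_set U"
      unfolding U_def W_def
      by (intro continuous_on_add bounded_bilinear.continuous_on[OF bounded_bilinear_cscale]
          continuous_on_flow continuous_on_mult continuous_on_power continuous_on_const continuous_on_id ratio_continuous Bc)
    show "U 0 = cscale z0 (unit 0) + cscale z0 W0"
      by (simp add: U_def W_def B0 \<zeta>_def ratio_0)
    fix t assume t: "t \<in> time_set"
    have "U t - cscale (\<zeta> t) (unit 0) = cscale (z0 * ratio t ^ p) (W t)" by (simp add: U_def)
    then have "norm (U t - cscale (\<zeta> t) (unit 0)) = cmod z0 * cmod (ratio t) ^ p * norm (B t)"
      by (simp add: W_def norm_mult norm_power)
    also have "\<dots> \<le> cmod z0 * cmod (ratio t) ^ p * 1" using Bn[OF t] by (intro mult_left_mono) auto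
    finally show "norm (U t - cscale (\<zeta> t) (unit 0)) \<le> cmod z0 * cmod (ratio t) ^ p" by simp
    fix k :: "int^'d"
    define \<delta> where "\<delta> = coef (unit (0 :: int^'d)) k"
    have laplace_symbol\<delta>: "of_real (laplace_symbol k) * \<delta> = 0" by (auto simp: \<delta>_def laplace_symbol_def)
    \<comment> \<open>the derivative of the factor \<open>z0 * ratio ^ p\<close>, equal to \<open>\<i> * p * \<zeta> ^ (p - 1)\<close> times that factor\<close>
    let ?Q = "\<i> * of_nat p * z0 ^ p * ratio t ^ (p - 1) * ratio t ^ p"
    have qp: "((\<lambda>s. z0 * ratio s ^ p) has_vector_derivative ?Q) (at t within time_set)"
    proof -
      have "((\<lambda>s. ratio s ^ n) has_vector_derivative of_nat n * ratio t ^ (n - 1) * (\<i> * z0 ^ (p - 1) * ratio t ^ p)) (at t within time_set)" for n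
      proof (induction n)
        case (Suc n)
        have "((\<lambda>s. ratio s * ratio s ^ n) has_vector_derivative
            ratio t * (of_nat n * ratio t ^ (n - 1) * (\<i> * z0 ^ (p - 1) * ratio t ^ p)) + (\<i> * z0 ^ (p - 1) * ratio t ^ p) * ratio t ^ n)
            (at t within time_set)"
          by (rule has_vector_derivative_mult[OF ratio_deriv[OF t] Suc])
        moreover have "ratio t * (of_nat n * ratio t ^ (n - 1) * (\<i> * z0 ^ (p - 1) * ratio t ^ p)) + (\<i> * z0 ^ (p - 1) * ratio t ^ p) * ratio t ^ n =
            of_nat (Suc n) * ratio t ^ (Suc n - 1) * (\<i> * z0 ^ (p - 1) * ratio t ^ p)"
          by (cases n) (simp_all add: algebra_simps)
        ultimately show ?case by simp
      qed simp
      from has_vector_derivative_mult_right[OF this[of p], of z0]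
      have "((\<lambda>s. z0 * ratio s ^ p) has_vector_derivative z0 * (of_nat p * ratio t ^ (p - 1) * (\<i> * z0 ^ (p - 1) * ratio t ^ p))) (at t within time_set)" .
      also have "z0 * (of_nat p * ratio t ^ (p - 1) * (\<i> * z0 ^ (p - 1) * ratio t ^ p)) =
          \<i> * of_nat p * (z0 ^ (p - 1) * z0) * ratio t ^ (p - 1) * ratio t ^ p" by (simp add: mult_ac)
      finally show ?thesis unfolding power_pred_mult .
    qed
    let ?w = "coef (W t) k" and ?N = "coef (scaled_nonlin t (W t)) k"
    have Wd: "((\<lambda>s. coef (W s) k) has_vector_derivative - \<i> * laplace_symbol k * ?w + ?N) (at t within time_set)"
    proof -
      have "((\<lambda>s. cis (- laplace_symbol k * s) * coef (B s) k) has_vector_derivative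
          cis (- laplace_symbol k * t) * coef (interaction_rhs t (B t)) k + \<i> * (- laplace_symbol k) * cis (- laplace_symbol k * t) * coef (B t) k)
          (at t within time_set)"
        using has_vector_derivative_mult[OF cis_has_vector_derivative[of "- laplace_symbol k"]
            bounded_linear.has_vector_derivative[OF bounded_linear_coef[of k] Bd[OF t]]] by simp
      moreover have "(\<lambda>s. cis (- laplace_symbol k * s) * coef (B s) k) = (\<lambda>s. coef (W s) k)"
        by (simp add: fun_eq_iff W_def coef_flow)
      moreover have "cis (- laplace_symbol k * t) * coef (interaction_rhs t (B t)) k = ?N"
      proof -
        have "cis (- laplace_symbol k * t) * coef (interaction_rhs t (B t)) k = coef (flow t (interaction_rhs t (B t))) k"
          by (simp add: coef_flow)
        then show ?thesis by (simp add: interaction_rhs_def W_def)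
      qed
      ultimately show ?thesis by (simp add: W_def coef_flow mult.assoc add.commute)
    qed
    have "((\<lambda>s. \<zeta> s * \<delta> + z0 * ratio s ^ p * coef (W s) k) has_vector_derivative
        \<i> * \<zeta> t ^ p * \<delta> + (z0 * ratio t ^ p * (- \<i> * laplace_symbol k * ?w + ?N) + ?Q * ?w)) (at t within time_set)"
      by (intro has_vector_derivative_add has_vector_derivative_mult_left \<zeta>_deriv t
          has_vector_derivative_mult qp Wd)
    moreover have "(\<lambda>s. \<zeta> s * \<delta> + z0 * ratio s ^ p * coef (W s) k) = (\<lambda>s. coef (U s) k)"
      by (simp add: fun_eq_iff U_def \<delta>_def)
    moreover have "\<i> * \<zeta> t ^ p * \<delta> + (z0 * ratio t ^ p * (- \<i> * laplace_symbol k * ?w + ?N) + ?Q * ?w) = nls_rhs p (U t) k"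
    proof -
      let ?c = "\<lambda>j. of_nat (p choose j) * (z0 * ratio t ^ p) ^ j * \<zeta> t ^ (p - j) * coef (conv_pow (W t) j) k"
      have "coef (conv_pow (U t) p) k = (\<Sum>j\<le>p. ?c j)"
        unfolding U_def conv_pow_const_add by simp
      \<comment> \<open>the terms of order 0 and 1 are cancelled by \<open>\<zeta>\<close> and by the derivative of the factor\<close>
      also have "{..p} = insert 0 (insert 1 {2..p})" using p by auto
      also have "(\<Sum>j\<in>insert 0 (insert 1 {2..p}). ?c j) = ?c 0 + ?c 1 + (\<Sum>j=2..p. ?c j)" by simp
      also have "?c 0 = \<zeta> t ^ p * \<delta>" by (simp add: \<delta>_def)
      also have "?c 1 = of_nat p * z0 ^ p * ratio t ^ (p - 1) * ratio t ^ p * ?w"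
      proof -
        have "?c 1 = of_nat p * (z0 ^ (p - 1) * z0) * ratio t ^ (p - 1) * ratio t ^ p * ?w"
          by (simp add: conv_pow_1 \<zeta>_def power_mult_distrib mult_ac del: conv_pow.simps)
        then show ?thesis unfolding power_pred_mult .
      qed
      also have "(\<Sum>j=2..p. ?c j) = - \<i> * (z0 * ratio t ^ p * ?N)"
      proof -
        have "?c j = - \<i> * (z0 * ratio t ^ p * (nl_coeff t j * coef (conv_pow (W t) j) k))" if j: "j \<in> {2..p}" for j
        proof -
          have "(1 / denom t) ^ j = ratio t ^ ((p - 1) * j)" unfolding ratio_power[OF t, symmetric] by (simp add: power_mult)
          then have "- \<i> * (z0 * ratio t ^ p * nl_coeff t j) = of_nat (p choose j) * (z0 ^ (p - 1) * z0) * (ratio t ^ p * ratio t ^ ((p - 1) * j))"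
            by (simp add: nl_coeff_def mult_ac)
          also have "\<dots> = of_nat (p choose j) * z0 ^ p * (ratio t ^ (p + (p - 1) * j))"
            unfolding power_pred_mult power_add[symmetric] ..
          also have "p + (p - 1) * j = p * j + (p - j)"
            using j p by (auto simp: diff_mult_distrib)
          also have "z0 ^ p = z0 ^ j * z0 ^ (p - j)" using j by (simp flip: power_add)
          also have "of_nat (p choose j) * (z0 ^ j * z0 ^ (p - j)) * ratio t ^ (p * j + (p - j)) =
              of_nat (p choose j) * (z0 * ratio t ^ p) ^ j * \<zeta> t ^ (p - j)"
            unfolding \<zeta>_def power_add power_mult power_mult_distrib by (simp only: mult_ac)
          finally have E: "- \<i> * (z0 * ratio t ^ p * nl_coeff t j) =
              of_nat (p choose j) * (z0 * ratio t ^ p) ^ j * \<zeta> t ^ (p - j)" .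
          show ?thesis unfolding E[symmetric] by (simp only: mult.assoc)
        qed
        then show ?thesis by (simp add: scaled_nonlin_def sum_distrib_left)
      qed
      finally have P: "coef (conv_pow (U t) p) k =
          \<zeta> t ^ p * \<delta> + of_nat p * z0 ^ p * ratio t ^ (p - 1) * ratio t ^ p * ?w + - \<i> * (z0 * ratio t ^ p * ?N)" .
      have cU: "coef (U t) k = \<zeta> t * \<delta> + z0 * ratio t ^ p * ?w" by (simp add: U_def \<delta>_def)
      have "of_real (laplace_symbol k) * coef (U t) k = \<zeta> t * (of_real (laplace_symbol k) * \<delta>) + z0 * ratio t ^ p * (laplace_symbol k * ?w)"
        unfolding cU by (simp only: distrib_left mult_ac)
      then have "of_real (laplace_symbol k) * coef (U t) k = z0 * ratio t ^ p * (laplace_symbol k * ?w)"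
        unfolding laplace_symbol\<delta> by simp
      then have "nls_rhs p (U t) k = \<i> * (- (z0 * ratio t ^ p * (laplace_symbol k * ?w)) + coef (conv_pow (U t) p) k)"
        by (simp add: nls_rhs_def)
      then show ?thesis unfolding P by (simp add: algebra_simps)
    qed
    ultimately show "((\<lambda>s. coef (U s) k) has_vector_derivative nls_rhs p (U t) k) (at t within time_set)" by simp
  qed
qed

end

context nls_flow begin

lemma global_decaying_solution:
  assumes u0: "u0 \<in> wiener_algebra \<omega> \<nu>" and small: "wiener_norm \<omega> \<nu> u0 < C_const p * cmod z0"
    and F: "F = at_top \<or> F = at_bot" and ev: "\<forall>\<^sub>F t in F. t \<in> time_set"
  shows "\<exists>u \<zeta>. nls_the_solution \<omega> \<nu> p (\<lambda>x. z0 + u0 x) time_set u \<and>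
      ((\<lambda>t. wiener_norm \<omega> \<nu> (u t)) \<longlongrightarrow> 0) F \<and>
      ode_the_solution p z0 time_set \<zeta> \<and> decay_bounds \<omega> \<nu> p z0 time_set u \<zeta>"
proof -
  have "norm (fourier_seq u0) < C_const p * cmod z0" using small by (simp add: wiener_norm_fourier_seq[OF u0])
  then have "norm (cscale (1 / z0) (fourier_seq u0)) < C_const p"
    using z0 by (simp add: norm_divide divide_less_eq)
  from nls_solution_exists[OF this]
  obtain U where Uc: "continuous_on time_set U"
    and Ud: "\<And>t k. t \<in> time_set \<Longrightarrow> ((\<lambda>s. coef (U s) k) has_vector_derivative nls_rhs p (U t) k) (at t within time_set)"
    and U0: "U 0 = cscale z0 (unit 0) + cscale z0 (cscale (1 / z0) (fourier_seq u0))"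
    and Un: "\<And>t. t \<in> time_set \<Longrightarrow> norm (U t - cscale (\<zeta> t) (unit 0)) \<le> cmod z0 * cmod (ratio t) ^ p"
    by blast
  let ?u = "\<lambda>t. fourier_sum (U t)"
  have \<zeta>ratio: "cmod (\<zeta> t / z0) = cmod (ratio t)" for t using z0 by (simp add: \<zeta>_def)
  have sol: "nls_solution \<omega> \<nu> p (\<lambda>x. z0 + u0 x) time_set ?u"
  proof (rule nls_solution_fourier_sum[OF Uc Ud])
    have "fourier_sum (U 0) x = z0 + fourier_sum (fourier_seq u0) x" for x
      using z0 by (simp add: U0 fourier_sum_linear fourier_sum_cscale)
    then show "AE x in lebesgue. fourier_sum (U 0) x = z0 + u0 x"
      by (intro eventually_mono[OF fourier_sum_fourier_seq_AE[OF u0]]) simp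
  qed
  have restrict: "nls_solution \<omega> \<nu> p w J v" if "nls_solution \<omega> \<nu> p w I v" "J \<subseteq> I" for w I J v
    using that unfolding nls_solution_def
    by (meson subsetD tendsto_within_subset has_vector_derivative_within_subset)
  have "nls_the_solution \<omega> \<nu> p (\<lambda>x. z0 + u0 x) time_set ?u"
    unfolding nls_the_solution_def
  proof (intro conjI allI impI ballI sol)
    fix J v t
    assume *: "is_interval J \<and> 0 \<in> J \<and> J \<subseteq> time_set \<and> nls_solution \<omega> \<nu> p (\<lambda>x. z0 + u0 x) J v" and t: "t \<in> J"
    show "AE x in lebesgue. v t x = ?u t x"
      by (rule nls_solution_unique[OF restrict[OF sol]]) (use * t in auto)
  qed
  moreover have "((\<lambda>t. wiener_norm \<omega> \<nu> (?u t)) \<longlongrightarrow> 0) F"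
  proof (rule Lim_null_comparison)
    have "norm (U t) \<le> cmod z0 * cmod (ratio t) + cmod z0 * cmod (ratio t) ^ p" if "t \<in> time_set" for t
    proof -
      have "norm (U t) \<le> norm (cscale (\<zeta> t) (unit (0 :: int^'d))) + norm (U t - cscale (\<zeta> t) (unit 0))"
        using norm_triangle_ineq[of "cscale (\<zeta> t) (unit 0)" "U t - cscale (\<zeta> t) (unit 0)"] by simp
      also have "\<dots> \<le> cmod z0 * cmod (ratio t) + cmod z0 * cmod (ratio t) ^ p"
        using Un[OF that] by (simp add: \<zeta>_def norm_mult)
      finally show ?thesis .
    qed
    then show "\<forall>\<^sub>F t in F. norm (wiener_norm \<omega> \<nu> (?u t)) \<le> cmod z0 * cmod (ratio t) + cmod z0 * cmod (ratio t) ^ p"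
      using ev by (auto simp: wiener_norm_fourier_sum elim!: eventually_mono)
    have "((\<lambda>t. cmod z0 * cmod (ratio t) + cmod z0 * cmod (ratio t) ^ p) \<longlongrightarrow> cmod z0 * 0 + cmod z0 * 0 ^ p) F"
      by (intro tendsto_intros ratio_tendsto F ev)
    then show "((\<lambda>t. cmod z0 * cmod (ratio t) + cmod z0 * cmod (ratio t) ^ p) \<longlongrightarrow> 0) F"
      using p by (simp add: power_0_left)
  qed
  moreover have "decay_bounds \<omega> \<nu> p z0 time_set ?u \<zeta>"
    unfolding decay_bounds_def \<zeta>ratio
  proof (intro ballI conjI)
    fix t assume t: "t \<in> time_set"
    show "cmod (ratio t) \<le> (1 / (1 + t\<^sup>2 * (cmod (of_nat (p - 1) * z0 ^ (p - 1)))\<^sup>2)) powr (1 / (2 * (real p - 1)))"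
      using ratio_bound[OF t] by (simp only: rate_def)
    have "(\<lambda>x. ?u t x - \<zeta> t) = fourier_sum (U t - cscale (\<zeta> t) (unit 0))"
      by (simp add: fun_eq_iff fourier_sum_linear fourier_sum_cscale)
    then show "wiener_norm \<omega> \<nu> (\<lambda>x. ?u t x - \<zeta> t) \<le> cmod z0 * cmod (ratio t) ^ p"
      using Un[OF t] by (simp add: wiener_norm_fourier_sum)
  qed
  ultimately show ?thesis using ode_the_solution_\<zeta> by blast
qed

end

section \<open>Decay of solutions\<close>

lemma Im_power_eq_sin_Arg: "Im (z ^ n) = cmod z ^ n * sin (real n * Arg z)"
proof -
  have "z ^ n = (of_real (cmod z) * cis (Arg z)) ^ n" by (simp add: rcis_def[symmetric] rcis_cmod_Arg)
  also have "\<dots> = of_real (cmod z ^ n) * cis (real n * Arg z)"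
    unfolding power_mult_distrib Complex.DeMoivre of_real_power ..
  finally show ?thesis by simp
qed

lemma sin_of_angle_in:
  shows "angle_in \<theta> 0 pi \<Longrightarrow> sin \<theta> \<ge> 0" and "angle_in \<theta> pi (2 * pi) \<Longrightarrow> sin \<theta> \<le> 0"
proof -
  have per: "sin (\<theta> + 2 * pi * of_int m) = sin \<theta>" for m
    by (simp add: sin_add cos_int_2pin sin_int_2pin)
  {
    assume "angle_in \<theta> 0 pi"
    then show "sin \<theta> \<ge> 0" unfolding angle_in_def using per sin_ge_zero by (metis atLeastAtMost_iff)
  next
    assume "angle_in \<theta> pi (2 * pi)"
    then obtain m :: int where "\<theta> + 2 * pi * of_int m \<in> {pi..2 * pi}" unfolding angle_in_def by blast
    then have "sin (\<theta> + 2 * pi * of_int m - pi) \<ge> 0" by (intro sin_ge_zero) auto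
    then show "sin \<theta> \<le> 0" by (simp only: sin_minus_pi per neg_0_le_iff_le)
  }
qed

theorem theorem1p3:
  fixes p :: nat and \<omega> :: "real^'d" and \<nu> :: real
    and z0 :: complex and u0 :: "real^'d \<Rightarrow> complex"
  assumes "p \<ge> 2"
    and "\<And>j. \<omega> $ j \<noteq> 0"
    and "\<nu> \<ge> 1"
    and "u0 \<in> wiener_algebra \<omega> \<nu>"
    and "wiener_norm \<omega> \<nu> u0 < C_const p * cmod z0"
  shows
    "(angle_in (real (p - 1) * Arg z0) 0 pi \<longrightarrow>
       (\<exists>u \<zeta>. nls_the_solution \<omega> \<nu> p (\<lambda>x. z0 + u0 x) {0..} u \<and>
              ((\<lambda>t. wiener_norm \<omega> \<nu> (u t)) \<longlongrightarrow> 0) at_top \<and>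
              ode_the_solution p z0 {0..} \<zeta> \<and>
              decay_bounds \<omega> \<nu> p z0 {0..} u \<zeta>)) \<and>
     (angle_in (real (p - 1) * Arg z0) pi (2 * pi) \<longrightarrow>
       (\<exists>u \<zeta>. nls_the_solution \<omega> \<nu> p (\<lambda>x. z0 + u0 x) {..0} u \<and>
              ((\<lambda>t. wiener_norm \<omega> \<nu> (u t)) \<longlongrightarrow> 0) at_bot \<and>
              ode_the_solution p z0 {..0} \<zeta> \<and>
              decay_bounds \<omega> \<nu> p z0 {..0} u \<zeta>))"
proof (intro conjI impI)
  have "wiener_norm \<omega> \<nu> u0 \<ge> 0"
    unfolding wiener_norm_def by (rule infsum_nonneg) (use assms(3) in auto)
  then have z0: "z0 \<noteq> 0" using assms(5) by auto
  have flow: "nls_flow \<omega> \<nu> p z0 \<sigma>" if "\<sigma> = 1 \<or> \<sigma> = -1" "\<sigma> * sin (real (p - 1) * Arg z0) \<ge> 0" for \<sigma>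
  proof
    show "0 \<le> \<sigma> * Im (z0 ^ (p - 1))"
      using mult_nonneg_nonneg[OF that(2), of "cmod z0 ^ (p - 1)"]
      unfolding Im_power_eq_sin_Arg by (simp add: mult_ac)
  qed (use assms(1-3) that z0 in auto)
  {
    assume "angle_in (real (p - 1) * Arg z0) 0 pi"
    then interpret nls_flow \<omega> \<nu> p z0 1
      by (intro flow) (use sin_of_angle_in(1) in auto)
    have "time_set = {0..}" by (auto simp: time_set_def)
    then show "\<exists>u \<zeta>. nls_the_solution \<omega> \<nu> p (\<lambda>x. z0 + u0 x) {0..} u \<and>
        ((\<lambda>t. wiener_norm \<omega> \<nu> (u t)) \<longlongrightarrow> 0) at_top \<and>
        ode_the_solution p z0 {0..} \<zeta> \<and> decay_bounds \<omega> \<nu> p z0 {0..} u \<zeta>"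
      using global_decaying_solution[OF assms(4,5), of at_top] by (simp add: eventually_ge_at_top)
  next
    assume "angle_in (real (p - 1) * Arg z0) pi (2 * pi)"
    then interpret nls_flow \<omega> \<nu> p z0 "-1"
      by (intro flow) (use sin_of_angle_in(2) in auto)
    have "time_set = {..0}" by (auto simp: time_set_def)
    then show "\<exists>u \<zeta>. nls_the_solution \<omega> \<nu> p (\<lambda>x. z0 + u0 x) {..0} u \<and>
        ((\<lambda>t. wiener_norm \<omega> \<nu> (u t)) \<longlongrightarrow> 0) at_bot \<and>
        ode_the_solution p z0 {..0} \<zeta> \<and> decay_bounds \<omega> \<nu> p z0 {..0} u \<zeta>"
      using global_decaying_solution[OF assms(4,5), of at_bot] by (simp add: eventually_le_at_bot)
  }
qed

end
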